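(* Let $f^*$ be a bounded linear functional on $H_0^1(\Omega)$, let $u\in H_0^1(\Omega)$ be the solution of $a(u,v)=f^*(v)$ for all $v\in H_0^1(\Omega)$, and let $\ell\ge0$ be an integer. Let $w$ and $w_\ell$ be the best approximations of $u$ in $\mathcal W$ and $\mathcal W_\ell$, respectively, with respect to the energy norm. Then $$\|u-w_\ell\|\,\leq\,\bigg(1+\frac{2q^{\ell}}{1+q^{2\ell}}\bigg)\|u-w\|+\frac{2q^{\ell}}{1+q^{2\ell}}\,\|u-\Pi u\|,$$ where $$q=\frac{\sqrt{\kappa}-1}{\sqrt{\kappa}+1}$$ and $\kappa$ is the condition number of the operator $T=P_1+\cdots+P_n$ seen as a bounded, symmetric operator from $\mathcal V$ to itself.
   Context: Let $d\in\{2,3\}$ and let $\Omega\subset\mathbb R^d$ be a bounded polygonal (for $d=3$ polyhedral) domain. Let $A$ be a matrix-valued function on $\Omega$ with measurable entries and symmetric positive definite values such that, with constants $0<\delta\le M$, $\delta|\eta|^2\le \eta\cdot A(x)\eta\le M|\eta|^2$ for all $\eta\in\mathbb R^d$ and almost all $x\in\Omega$. Set $a(u,v)=\int_\Omega\nabla u\cdot A\nabla v\,\mathrm dx$ on $H_0^1(\Omega)$; this is an inner product, and $\|v\|=a(v,v)^{1/2}$ denotes the energy norm. $\|\cdot\|_0$ denotes the $L_2(\Omega)$-norm and $|\cdot|_1$ the $H^1(\Omega)$-seminorm $|v|_1=\|\nabla v\|_0$. $\mathcal T$ is a conforming triangulation of $\Omega$ into triangles ($d=2$) or tetrahedra ($d=3$),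 with shape regular elements (ratio of diameter to inradius bounded by a fixed constant), but not necessarily quasiuniform. $\mathcal S\subset H_0^1(\Omega)$ is the space of continuous functions that are linear on each element of $\mathcal T$ and vanish on $\partial\Omega$. $h$ is the elementwise constant function whose value on the interior of an element is its diameter. $x_1,\dots,x_n$ are all vertices (interior and boundary) of the elements of $\mathcal T$, $\varphi_1,\dots,\varphi_n$ are the corresponding continuous piecewise linear hat functions, so that the $\varphi_i$ with $x_i$ in the interior of $\Omega$ form a basis of $\mathcal S$; $\omega_i$ is the union of the elements with vertex $x_i$. $H_0^1(\omega_i)$ is understood as a subspace of $H_0^1(\Omega)$ via extension by zero. $\Pi:H_0^1(\Omega)\to\mathcal S$ is a bounded linear projection onto $\mathcal S$ (so $\Pi v=v$ for $v\in\mathcal S$) satisfying, for all $u\in H_0^1(\Omega)$, $|\Pi u|_1\le c_1|u|_1$ and $\|h^{-1}(u-\Pi u)\|_0\le c_2|u|_1$. It is local: there is a fixed number $m$ such that for every $i$ and every $v\in H_0^1(\omega_i)$ the function $\Pi v$ vanishes outside the union of the first $m$ shells of elements surrounding $x_i$ (the first shell gives $\omega_i$; each further shell adds all elements having a point in common with the previous union). $\mathcal V=\ker\Pi$, a closed subspace of $H_0^1(\Omega)$; $C$ is the $a$-orthogonal projection from $H_0^1(\Omega)$ onto $\mathcal V$, and $\mathcal W=\{v-Cv\,|\,v\in\mathcal S\}$. For $i=1,\dots,n$, $\mathcal V_i=\{v-\Pi v\,|\,v\in H_0^1(\omega_i)\}$, a closed subspace of $\mathcal V$, and $P_i$ is the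 $a$-orthogonal projection from $H_0^1(\Omega)$ onto $\mathcal V_i$, i.e. $P_iv\in\mathcal V_i$ and $a(P_iv,v_i)=a(v,v_i)$ for all $v_i\in\mathcal V_i$. Put $T=P_1+\cdots+P_n$. The bounded linear operators $F_\nu:H_0^1(\Omega)\to\mathcal V$ are defined by $F_0u=0$ and $F_{\nu+1}u=F_\nu u+T(u-F_\nu u)$. The space $\mathcal W_\ell$ is the span of the functions $\varphi_i-F_\nu\varphi_i$, $\nu=0,1,\dots,\ell$, for all $i$ such that $x_i$ lies in the interior of $\Omega$. $K_1,K_2>0$ are constants such that every $v\in\mathcal V$ has a decomposition $v=v_1+\cdots+v_n$ with $v_i\in\mathcal V_i$ and $\sum_i\|v_i\|^2\le K_1\|v\|^2$, and such that $\|v\|^2\le K_2\sum_i\|v_i\|^2$ for every $v\in\mathcal V$ and every decomposition $v=v_1+\cdots+v_n$ with $v_i\in\mathcal V_i$ (such constants exist in this setting). The condition number $\kappa$ is the ratio of the maximum to the minimum of the spectrum of $T$, regarded as an $a$-symmetric positive definite bounded operator from $\mathcal V$ (with inner product $a$) to itself; it satisfies $\kappa\le K_1K_2$. *)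

theory Defs
  imports "HOL-Analysis.Analysis"
begin

section \<open>The space of square integrable functions\<close>

text \<open>
  Elements of \<open>('a, 'b) L2\<close> are classes, modulo equality almost everywhere, of Lebesgue measurable,
  square integrable functions on the whole space. Functions on an open set \<open>\<Omega>\<close> are identified
  with their extension by zero.
\<close>

definition square_integrable :: "('a::euclidean_space \<Rightarrow> 'b::euclidean_space) \<Rightarrow> bool" where
  "square_integrable f \<longleftrightarrow>
     f \<in> borel_measurable lebesgue \<and> integrable lebesgue (\<lambda>x. (norm (f x))\<^sup>2)"

definition L2_rel :: "('a::euclidean_space \<Rightarrow> 'b::euclidean_space) \<Rightarrow> ('a \<Rightarrow> 'b) \<Rightarrow> bool" where
  "L2_rel f g \<longleftrightarrow> square_integrable f \<and> square_integrable g \<and> (AE x in lebesgue. f x = g x)"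

lemma square_integrable_measurable [measurable_dest]:
  "square_integrable f \<Longrightarrow> f \<in> borel_measurable lebesgue"
  by (simp add: square_integrable_def)

lemma square_integrable_zero: "square_integrable (\<lambda>x. 0)"
  by (simp add: square_integrable_def)

lemma square_integrable_scaleR:
  assumes "square_integrable f"
  shows "square_integrable (\<lambda>x. r *\<^sub>R f x)"
  using assms by (auto simp: square_integrable_def power_mult_distrib)

lemma square_integrable_add:
  assumes f: "square_integrable f" and g: "square_integrable g"
  shows "square_integrable (\<lambda>x. f x + g x)"
  unfolding square_integrable_def
proof
  have [measurable]: "f \<in> borel_measurable lebesgue" "g \<in> borel_measurable lebesgue"
    using f g by (auto simp: square_integrable_def)
  show "(\<lambda>x. f x + g x) \<in> borel_measurable lebesgue" by measurable
  show "integrable lebesgue (\<lambda>x. (norm (f x + g x))\<^sup>2)"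
  proof (rule Bochner_Integration.integrable_bound)
    show "integrable lebesgue (\<lambda>x. 2 * (norm (f x))\<^sup>2 + 2 * (norm (g x))\<^sup>2)"
      using f g by (auto simp: square_integrable_def)
    show "(\<lambda>x. (norm (f x + g x))\<^sup>2) \<in> borel_measurable lebesgue" by measurable
    have "(norm (a + b))\<^sup>2 \<le> 2 * (norm a)\<^sup>2 + 2 * (norm b)\<^sup>2" for a b :: 'b
    proof -
      have "(norm (a + b))\<^sup>2 \<le> (norm a + norm b)\<^sup>2"
        by (simp add: norm_triangle_ineq power_mono)
      also have "\<dots> \<le> 2 * (norm a)\<^sup>2 + 2 * (norm b)\<^sup>2"
        using sum_squares_bound[of "norm a" "norm b"] by (simp add: power2_sum)
      finally show ?thesis .
    qed
    then show "AE x in lebesgue. norm ((norm (f x + g x))\<^sup>2)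
        \<le> norm (2 * (norm (f x))\<^sup>2 + 2 * (norm (g x))\<^sup>2)"
      by (simp add: add_nonneg_nonneg)
  qed
qed

lemma square_integrable_minus: "square_integrable f \<Longrightarrow> square_integrable (\<lambda>x. - f x)"
  using square_integrable_scaleR[of f "-1"] by simp

lemma square_integrable_diff:
  "square_integrable f \<Longrightarrow> square_integrable g \<Longrightarrow> square_integrable (\<lambda>x. f x - g x)"
  using square_integrable_add[OF _ square_integrable_minus, of f g] by simp

lemma square_integrable_inner:
  assumes f: "square_integrable f" and g: "square_integrable g"
  shows "integrable lebesgue (\<lambda>x. f x \<bullet> g x)"
proof (rule Bochner_Integration.integrable_bound)
  have [measurable]: "f \<in> borel_measurable lebesgue" "g \<in> borel_measurable lebesgue"
    using f g by (auto simp: square_integrable_def)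
  show "(\<lambda>x. f x \<bullet> g x) \<in> borel_measurable lebesgue" by measurable
  show "integrable lebesgue (\<lambda>x. (norm (f x))\<^sup>2 + (norm (g x))\<^sup>2)"
    using f g by (auto simp: square_integrable_def)
  have "\<bar>a \<bullet> b\<bar> \<le> (norm a)\<^sup>2 + (norm b)\<^sup>2" for a b :: 'b
  proof -
    have "\<bar>a \<bullet> b\<bar> \<le> norm a * norm b" by (rule Cauchy_Schwarz_ineq2)
    moreover have "2 * (norm a * norm b) \<le> (norm a)\<^sup>2 + (norm b)\<^sup>2"
      using sum_squares_bound[of "norm a" "norm b"] by simp
    moreover have "0 \<le> norm a * norm b" by simp
    ultimately show ?thesis by linarith
  qed
  then show "AE x in lebesgue. norm (f x \<bullet> g x) \<le> norm ((norm (f x))\<^sup>2 + (norm (g x))\<^sup>2)"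
    by simp
qed

quotient_type (overloaded) ('a, 'b) L2 =
  "'a::euclidean_space \<Rightarrow> 'b::euclidean_space" / partial: L2_rel
  morphisms L2_fun L2_class
proof (rule part_equivpI)
  show "\<exists>f :: 'a \<Rightarrow> 'b. L2_rel f f"
    by (rule exI[of _ "\<lambda>x. 0"]) (simp add: L2_rel_def square_integrable_zero)
  show "symp (L2_rel :: ('a \<Rightarrow> 'b) \<Rightarrow> _)"
    by (auto simp: symp_def L2_rel_def elim: eventually_mono)
  show "transp (L2_rel :: ('a \<Rightarrow> 'b) \<Rightarrow> _)"
    by (auto simp: transp_def L2_rel_def elim: eventually_elim2)
qed

lemma square_integrable_L2_fun: "square_integrable (L2_fun u)"
  using Quotient3_rep_reflp[OF Quotient3_L2, of u] by (simp add: L2_rel_def)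

lemma L2_fun_L2_class:
  assumes "square_integrable f"
  shows "AE x in lebesgue. L2_fun (L2_class f) x = f x"
proof -
  have "L2_rel f f" using assms by (simp add: L2_rel_def)
  then have "L2_rel (L2_fun (L2_class f)) f"
    by (rule rep_abs_rsp_left[OF Quotient3_L2])
  then show ?thesis by (simp add: L2_rel_def)
qed

instantiation L2 :: (euclidean_space, euclidean_space) real_vector
begin

lift_definition zero_L2 :: "('a, 'b) L2" is "\<lambda>x. 0"
  by (simp add: L2_rel_def square_integrable_zero)

lift_definition plus_L2 :: "('a, 'b) L2 \<Rightarrow> ('a, 'b) L2 \<Rightarrow> ('a, 'b) L2" is "\<lambda>f g x. f x + g x"
  by (auto simp: L2_rel_def square_integrable_add elim: eventually_elim2)

lift_definition uminus_L2 :: "('a, 'b) L2 \<Rightarrow> ('a, 'b) L2" is "\<lambda>f x. - f x"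
  by (auto simp: L2_rel_def square_integrable_minus elim: eventually_mono)

lift_definition minus_L2 :: "('a, 'b) L2 \<Rightarrow> ('a, 'b) L2 \<Rightarrow> ('a, 'b) L2" is "\<lambda>f g x. f x - g x"
  by (auto simp: L2_rel_def square_integrable_diff elim: eventually_elim2)

lift_definition scaleR_L2 :: "real \<Rightarrow> ('a, 'b) L2 \<Rightarrow> ('a, 'b) L2" is "\<lambda>r f x. r *\<^sub>R f x"
  by (auto simp: L2_rel_def square_integrable_scaleR elim: eventually_mono)

instance
  by standard (transfer, force simp: L2_rel_def square_integrable_zero square_integrable_add
      square_integrable_minus square_integrable_diff square_integrable_scaleR algebra_simps)+

end

instantiation L2 :: (euclidean_space, euclidean_space) real_inner
begin

lift_definition inner_L2 :: "('a, 'b) L2 \<Rightarrow> ('a, 'b) L2 \<Rightarrow> real"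
  is "\<lambda>f g. LINT x|lebesgue. f x \<bullet> g x"
proof -
  fix f f' g g' :: "'a \<Rightarrow> 'b"
  assume "L2_rel f f'" "L2_rel g g'"
  then have *: "square_integrable f" "square_integrable f'" "square_integrable g"
      "square_integrable g'" "AE x in lebesgue. f x = f' x" "AE x in lebesgue. g x = g' x"
    by (auto simp: L2_rel_def)
  show "(LINT x|lebesgue. f x \<bullet> g x) = (LINT x|lebesgue. f' x \<bullet> g' x)"
  proof (rule integral_cong_AE)
    show "(\<lambda>x. f x \<bullet> g x) \<in> borel_measurable lebesgue" "(\<lambda>x. f' x \<bullet> g' x) \<in> borel_measurable lebesgue"
      using * by (auto intro!: borel_measurable_inner simp: square_integrable_def)
    show "AE x in lebesgue. f x \<bullet> g x = f' x \<bullet> g' x"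
      using *(5,6) by eventually_elim simp
  qed
qed

definition norm_L2 :: "('a, 'b) L2 \<Rightarrow> real" where
  "norm_L2 u = sqrt (u \<bullet> u)"

definition sgn_L2 :: "('a, 'b) L2 \<Rightarrow> ('a, 'b) L2" where
  "sgn_L2 u = u /\<^sub>R norm u"

definition dist_L2 :: "('a, 'b) L2 \<Rightarrow> ('a, 'b) L2 \<Rightarrow> real" where
  "dist_L2 u v = norm (u - v)"

definition uniformity_L2 :: "(('a, 'b) L2 \<times> ('a, 'b) L2) filter" where
  "uniformity_L2 = (INF e\<in>{0<..}. principal {(u, v). dist u v < e})"

definition open_L2 :: "('a, 'b) L2 set \<Rightarrow> bool" where
  "open_L2 U \<longleftrightarrow> (\<forall>u\<in>U. \<forall>\<^sub>F (u', v) in uniformity. u' = u \<longrightarrow> v \<in> U)"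

instance
proof
  fix u v w :: "('a, 'b) L2" and r :: real
  show "dist u v = norm (u - v)" "sgn u = u /\<^sub>R norm u" "norm u = sqrt (u \<bullet> u)"
    by (rule dist_L2_def sgn_L2_def norm_L2_def)+
  show "uniformity = (INF e\<in>{0<..}. principal {(u, v). dist (u :: ('a, 'b) L2) v < e})"
    by (rule uniformity_L2_def)
  show "open U \<longleftrightarrow> (\<forall>u\<in>U. \<forall>\<^sub>F (u', v) in uniformity. u' = u \<longrightarrow> v \<in> U)"
    for U :: "('a, 'b) L2 set"
    by (rule open_L2_def)
  show "u \<bullet> v = v \<bullet> u"
    by transfer (simp add: inner_commute)
  show "(u + v) \<bullet> w = u \<bullet> w + v \<bullet> w"
    by transfer (simp add: L2_rel_def inner_add_left square_integrable_inner)
  show "(r *\<^sub>R u) \<bullet> v = r * (u \<bullet> v)"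
    by transfer simp
  show "0 \<le> u \<bullet> u"
    by transfer (simp add: integral_nonneg_AE)
  show "u \<bullet> u = 0 \<longleftrightarrow> u = 0"
  proof transfer
    fix f :: "'a \<Rightarrow> 'b"
    assume "L2_rel f f"
    then have f: "square_integrable f" by (simp add: L2_rel_def)
    then have "(LINT x|lebesgue. f x \<bullet> f x) = 0 \<longleftrightarrow> (AE x in lebesgue. f x \<bullet> f x = 0)"
      by (intro integral_nonneg_eq_0_iff_AE square_integrable_inner) auto
    with f show "(LINT x|lebesgue. f x \<bullet> f x) = 0 \<longleftrightarrow> L2_rel f (\<lambda>x. 0)"
      by (simp add: L2_rel_def square_integrable_zero)
  qed
qed

end

text \<open>With the extension by zero, this says that \<open>u\<close> vanishes outside \<open>X\<close>.\<close>

definition vanishes_outside :: "('a::euclidean_space, 'b::euclidean_space) L2 \<Rightarrow> 'a set \<Rightarrow> bool" where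
  "vanishes_outside u X \<longleftrightarrow> (AE x in lebesgue. x \<notin> X \<longrightarrow> L2_fun u x = 0)"


section \<open>Sobolev spaces\<close>

definition partial_deriv :: "'n::finite \<Rightarrow> (real^'n \<Rightarrow> real) \<Rightarrow> real^'n \<Rightarrow> real" where
  "partial_deriv i f x = frechet_derivative f (at x) (axis i 1)"

primrec Ck :: "nat \<Rightarrow> (real^'n::finite \<Rightarrow> real) \<Rightarrow> bool" where
  "Ck 0 f \<longleftrightarrow> continuous_on UNIV f"
| "Ck (Suc k) f \<longleftrightarrow> (\<forall>x. f differentiable at x) \<and> (\<forall>i. Ck k (partial_deriv i f))"

definition test_function :: "(real^'n::finite) set \<Rightarrow> (real^'n \<Rightarrow> real) \<Rightarrow> bool" where
  "test_function \<Omega> \<phi> \<longleftrightarrow>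
     (\<forall>k. Ck k \<phi>) \<and> compact (closure {x. \<phi> x \<noteq> 0}) \<and> closure {x. \<phi> x \<noteq> 0} \<subseteq> \<Omega>"

definition weak_gradient ::
    "(real^'n::finite, real) L2 \<Rightarrow> (real^'n, real^'n) L2 \<Rightarrow> bool" where
  "weak_gradient u g \<longleftrightarrow>
     (\<forall>\<phi> i. test_function UNIV \<phi> \<longrightarrow>
        (LINT x|lebesgue. L2_fun u x * partial_deriv i \<phi> x)
          = - (LINT x|lebesgue. L2_fun g x $ i * \<phi> x))"

definition H1 :: "(real^'n::finite, real) L2 set" where
  "H1 = {u. \<exists>g. weak_gradient u g}"

definition grad :: "(real^'n::finite, real) L2 \<Rightarrow> (real^'n, real^'n) L2" where
  "grad u = (THE g. weak_gradient u g)"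

definition H1_norm :: "(real^'n::finite, real) L2 \<Rightarrow> real" where
  "H1_norm u = sqrt ((norm u)\<^sup>2 + (norm (grad u))\<^sup>2)"

definition H1_seminorm :: "(real^'n::finite, real) L2 \<Rightarrow> real" where
  "H1_seminorm u = norm (grad u)"

text \<open>
  \<open>H\<^sub>0\<^sup>1(\<Omega>)\<close> is the closure of the test functions on \<open>\<Omega>\<close>. Extension by zero of a test function
  preserves the norm, so the closure can be taken in \<open>H\<^sup>1\<close> of the whole space. In this way
  \<open>H\<^sub>0\<^sup>1(\<Omega>')\<close> is literally a subspace of \<open>H\<^sub>0\<^sup>1(\<Omega>)\<close> for open \<open>\<Omega>' \<subseteq> \<Omega>\<close>. Functions in
  \<open>H\<^sub>0\<^sup>1(\<Omega>)\<close> and their gradients vanish almost everywhere outside \<open>\<Omega>\<close>, hence their norms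
  over the whole space are those over \<open>\<Omega>\<close>.
\<close>

definition H01 :: "(real^'n::finite) set \<Rightarrow> (real^'n, real) L2 set" where
  "H01 \<Omega> = {u \<in> H1. \<forall>\<epsilon>>0. \<exists>\<phi>. test_function \<Omega> \<phi> \<and> H1_norm (u - L2_class \<phi>) < \<epsilon>}"


section \<open>The bilinear form\<close>

definition admissible_coefficient ::
    "(real^'n::finite) set \<Rightarrow> (real^'n \<Rightarrow> real^'n^'n) \<Rightarrow> real \<Rightarrow> real \<Rightarrow> bool" where
  "admissible_coefficient \<Omega> A \<delta> M \<longleftrightarrow>
     (\<forall>i j. (\<lambda>x. A x $ i $ j) \<in> borel_measurable (lebesgue_on \<Omega>)) \<and>
     (\<forall>x\<in>\<Omega>. transpose (A x) = A x \<and> (\<forall>\<eta>. \<eta> \<noteq> 0 \<longrightarrow> 0 < \<eta> \<bullet> (A x *v \<eta>))) \<and>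
     0 < \<delta> \<and> \<delta> \<le> M \<and>
     (AE x in lebesgue_on \<Omega>.
        \<forall>\<eta>. \<delta> * (norm \<eta>)\<^sup>2 \<le> \<eta> \<bullet> (A x *v \<eta>) \<and> \<eta> \<bullet> (A x *v \<eta>) \<le> M * (norm \<eta>)\<^sup>2)"

definition bilinear_form :: "(real^'n::finite) set \<Rightarrow> (real^'n \<Rightarrow> real^'n^'n) \<Rightarrow>
    (real^'n, real) L2 \<Rightarrow> (real^'n, real) L2 \<Rightarrow> real" where
  "bilinear_form \<Omega> A u v =
     (LINT x|lebesgue_on \<Omega>. L2_fun (grad u) x \<bullet> (A x *v L2_fun (grad v) x))"

definition energy_norm :: "('v \<Rightarrow> 'v \<Rightarrow> real) \<Rightarrow> 'v \<Rightarrow> real" where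
  "energy_norm a v = sqrt (a v v)"


section \<open>Triangulations and finite elements\<close>

definition polyhedral_domain :: "(real^'n::finite) set \<Rightarrow> bool" where
  "polyhedral_domain \<Omega> \<longleftrightarrow> open \<Omega> \<and> connected \<Omega> \<and> \<Omega> \<noteq> {} \<and> bounded \<Omega> \<and>
     (\<exists>\<F>. finite \<F> \<and> (\<forall>F\<in>\<F>. polytope F \<and> aff_dim F = int CARD('n) - 1) \<and> frontier \<Omega> = \<Union>\<F>)"

text \<open>
  The elements are closed simplices, and \<^const>\<open>triangulation\<close> expresses finiteness and
  conformity. The condition on the boundary holds automatically for \<open>\<Omega> = interior (closure \<Omega>)\<close>;
  it is needed only for domains with slits, where it says that the slits consist of faces of elements.
\<close>

definition triangulates :: "(real^'n::finite) set set \<Rightarrow> (real^'n) set \<Rightarrow> bool" where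
  "triangulates \<T> \<Omega> \<longleftrightarrow> triangulation \<T> \<and> (\<forall>K\<in>\<T>. int CARD('n) simplex K) \<and>
     \<Union>\<T> = closure \<Omega> \<and> (\<exists>\<F>. (\<forall>F\<in>\<F>. \<exists>K\<in>\<T>. F facet_of K) \<and> frontier \<Omega> = \<Union>\<F>)"

definition inradius :: "(real^'n::finite) set \<Rightarrow> real" where
  "inradius K = Sup {r. 0 \<le> r \<and> (\<exists>c. cball c r \<subseteq> K)}"

definition shape_regular :: "real \<Rightarrow> (real^'n::finite) set set \<Rightarrow> bool" where
  "shape_regular \<sigma> \<T> \<longleftrightarrow> (\<forall>K\<in>\<T>. diameter K \<le> \<sigma> * inradius K)"

text \<open>The value off the interiors of the elements is irrelevant.\<close>

definition mesh_size :: "(real^'n::finite) set set \<Rightarrow> real^'n \<Rightarrow> real" where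
  "mesh_size \<T> x =
     (if \<exists>K\<in>\<T>. x \<in> interior K then diameter (THE K. K \<in> \<T> \<and> x \<in> interior K) else 0)"

definition mesh_norm ::
    "(real^'n::finite) set set \<Rightarrow> (real^'n) set \<Rightarrow> (real^'n, real) L2 \<Rightarrow> real" where
  "mesh_norm \<T> \<Omega> v = sqrt (LINT x|lebesgue_on \<Omega>. (L2_fun v x / mesh_size \<T> x)\<^sup>2)"

definition vertices :: "(real^'n::finite) set set \<Rightarrow> (real^'n) set" where
  "vertices \<T> = {x. \<exists>K\<in>\<T>. x extreme_point_of K}"

definition patch :: "(real^'n::finite) set set \<Rightarrow> real^'n \<Rightarrow> (real^'n) set" where
  "patch \<T> x = \<Union>{K\<in>\<T>. x extreme_point_of K}"

text \<open>The union of the first \<open>m\<close> shells; by conformity, \<open>shells \<T> x 1 = patch \<T> x\<close> for vertices.\<close>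

primrec shells :: "(real^'n::finite) set set \<Rightarrow> real^'n \<Rightarrow> nat \<Rightarrow> (real^'n) set" where
  "shells \<T> x 0 = {x}"
| "shells \<T> x (Suc m) = \<Union>{K\<in>\<T>. K \<inter> shells \<T> x m \<noteq> {}}"

definition affine_function_on :: "(real^'n::finite) set \<Rightarrow> (real^'n \<Rightarrow> real) \<Rightarrow> bool" where
  "affine_function_on K f \<longleftrightarrow> (\<exists>b c. \<forall>x\<in>K. f x = b \<bullet> x + c)"

definition hat :: "(real^'n::finite) set set \<Rightarrow> real^'n \<Rightarrow> real^'n \<Rightarrow> real" where
  "hat \<T> x = (THE \<phi>. continuous_on (\<Union>\<T>) \<phi> \<and> (\<forall>K\<in>\<T>. affine_function_on K \<phi>) \<and>
     (\<forall>y\<in>vertices \<T>. \<phi> y = (if y = x then 1 else 0)) \<and> (\<forall>y. y \<notin> \<Union>\<T> \<longrightarrow> \<phi> y = 0))"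

definition fe_space :: "(real^'n::finite) set set \<Rightarrow> (real^'n) set \<Rightarrow> (real^'n, real) L2 set" where
  "fe_space \<T> \<Omega> = L2_class ` {f. continuous_on (closure \<Omega>) f \<and>
     (\<forall>K\<in>\<T>. affine_function_on K f) \<and> (\<forall>x. x \<notin> \<Omega> \<longrightarrow> f x = 0)}"

text \<open>
  \<open>H\<^sub>0\<^sup>1(\<omega>)\<close> for the patch \<open>\<omega>\<close> around \<open>x\<close>, a closed set. The intersection with \<open>\<Omega>\<close> matters only for
  domains with slits.
\<close>

definition patch_H01 ::
    "(real^'n::finite) set set \<Rightarrow> (real^'n) set \<Rightarrow> real^'n \<Rightarrow> (real^'n, real) L2 set" where
  "patch_H01 \<T> \<Omega> x = H01 (interior (patch \<T> x) \<inter> \<Omega>)"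


section \<open>Operators and subspaces\<close>

definition bounded_linear_on ::
    "'v::real_vector set \<Rightarrow> ('v \<Rightarrow> real) \<Rightarrow> ('w::real_vector \<Rightarrow> real) \<Rightarrow> ('v \<Rightarrow> 'w) \<Rightarrow> bool" where
  "bounded_linear_on X nX nY f \<longleftrightarrow>
     (\<forall>u\<in>X. \<forall>v\<in>X. f (u + v) = f u + f v) \<and> (\<forall>r. \<forall>u\<in>X. f (r *\<^sub>R u) = r *\<^sub>R f u) \<and>
     (\<exists>B. \<forall>u\<in>X. nY (f u) \<le> B * nX u)"

definition local_operator :: "(real^'n::finite) set set \<Rightarrow> (real^'n) set \<Rightarrow> nat \<Rightarrow>
    ((real^'n, real) L2 \<Rightarrow> (real^'n, real) L2) \<Rightarrow> bool" where
  "local_operator \<T> \<Omega> m Proj \<longleftrightarrow>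
     (\<forall>x\<in>vertices \<T>. \<forall>v\<in>patch_H01 \<T> \<Omega> x. vanishes_outside (Proj v) (shells \<T> x m))"

definition kernel_space :: "'v::real_vector set \<Rightarrow> ('v \<Rightarrow> 'v) \<Rightarrow> 'v set" where
  "kernel_space X Proj = {v \<in> X. Proj v = 0}"

definition local_space :: "(real^'n::finite) set set \<Rightarrow> (real^'n) set \<Rightarrow>
    ((real^'n, real) L2 \<Rightarrow> (real^'n, real) L2) \<Rightarrow> real^'n \<Rightarrow> (real^'n, real) L2 set" where
  "local_space \<T> \<Omega> Proj x = (\<lambda>v. v - Proj v) ` patch_H01 \<T> \<Omega> x"

definition orthogonal_projection ::
    "('v \<Rightarrow> 'v \<Rightarrow> real) \<Rightarrow> 'v set \<Rightarrow> 'v set \<Rightarrow> ('v \<Rightarrow> 'v) \<Rightarrow> bool" where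
  "orthogonal_projection a X V P \<longleftrightarrow> (\<forall>u\<in>X. P u \<in> V \<and> (\<forall>v\<in>V. a (P u) v = a u v))"

definition best_approximation ::
    "('v::real_vector \<Rightarrow> real) \<Rightarrow> 'v set \<Rightarrow> 'v \<Rightarrow> 'v \<Rightarrow> bool" where
  "best_approximation n W u w \<longleftrightarrow> w \<in> W \<and> (\<forall>z\<in>W. n (u - w) \<le> n (u - z))"

primrec correction :: "('v::real_vector \<Rightarrow> 'v) \<Rightarrow> nat \<Rightarrow> 'v \<Rightarrow> 'v" where
  "correction T 0 u = 0"
| "correction T (Suc \<nu>) u = correction T \<nu> u + T (u - correction T \<nu> u)"

definition W_space :: "('v::real_vector \<Rightarrow> 'v) \<Rightarrow> 'v set \<Rightarrow> 'v set" where
  "W_space C S = (\<lambda>v. v - C v) ` S"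

definition W_level :: "(real^'n::finite) set set \<Rightarrow> (real^'n) set \<Rightarrow>
    ((real^'n, real) L2 \<Rightarrow> (real^'n, real) L2) \<Rightarrow> nat \<Rightarrow> (real^'n, real) L2 set" where
  "W_level \<T> \<Omega> T l =
     span {L2_class (hat \<T> x) - correction T \<nu> (L2_class (hat \<T> x)) | \<nu> x.
             \<nu> \<le> l \<and> x \<in> vertices \<T> \<and> x \<in> \<Omega>}"

text \<open>
  The spectrum of an operator on the subspace \<open>V\<close> with the norm \<open>n\<close>: all \<open>\<mu>\<close> for which \<open>T - \<mu>\<close> has no
  bounded inverse from \<open>V\<close> to \<open>V\<close>. Only real \<open>\<mu>\<close> are considered, which loses nothing for symmetric
  bounded operators on Hilbert spaces. Their spectrum is compact, so that supremum and infimum in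
  the condition number are maximum and minimum.
\<close>

definition spectrum_on ::
    "'v::real_vector set \<Rightarrow> ('v \<Rightarrow> real) \<Rightarrow> ('v \<Rightarrow> 'v) \<Rightarrow> real set" where
  "spectrum_on V n T =
     {\<mu>. \<not> (bij_betw (\<lambda>v. T v - \<mu> *\<^sub>R v) V V \<and>
            (\<exists>B. \<forall>v\<in>V. n v \<le> B * n (T v - \<mu> *\<^sub>R v)))}"

definition condition_number ::
    "'v::real_vector set \<Rightarrow> ('v \<Rightarrow> real) \<Rightarrow> ('v \<Rightarrow> 'v) \<Rightarrow> real" where
  "condition_number V n T = Sup (spectrum_on V n T) / Inf (spectrum_on V n T)"

definition stable_decomposition :: "('v::real_vector \<Rightarrow> real) \<Rightarrow> 'v set \<Rightarrow> 'i set \<Rightarrow>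
    ('i \<Rightarrow> 'v set) \<Rightarrow> real \<Rightarrow> bool" where
  "stable_decomposition n V I Vs K \<longleftrightarrow>
     (\<forall>v\<in>V. \<exists>vs. (\<forall>i\<in>I. vs i \<in> Vs i) \<and> v = (\<Sum>i\<in>I. vs i) \<and> (\<Sum>i\<in>I. (n (vs i))\<^sup>2) \<le> K * (n v)\<^sup>2)"

definition bounded_superposition :: "('v::real_vector \<Rightarrow> real) \<Rightarrow> 'v set \<Rightarrow> 'i set \<Rightarrow>
    ('i \<Rightarrow> 'v set) \<Rightarrow> real \<Rightarrow> bool" where
  "bounded_superposition n V I Vs K \<longleftrightarrow>
     (\<forall>v\<in>V. \<forall>vs. (\<forall>i\<in>I. vs i \<in> Vs i) \<and> v = (\<Sum>i\<in>I. vs i) \<longrightarrow>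
        (n v)\<^sup>2 \<le> K * (\<Sum>i\<in>I. (n (vs i))\<^sup>2))"

end

theory Submission
  imports Defs
begin

text \<open>
  Since \<open>u - \<Pi> u\<close> lies in \<open>\<V> = ker \<Pi>\<close>, the best approximation of \<open>u\<close> in \<open>\<W>\<close> has the error \<open>C u\<close>. For
  \<open>s = \<Pi> u\<close> and weights \<open>\<alpha>\<^sub>\<nu>\<close> of sum one, the element \<open>\<Sum> \<alpha>\<^sub>\<nu> (s - F\<^sub>\<nu> s)\<close> of \<open>\<W>\<^sub>\<ell>\<close> differs from \<open>u\<close> by
  \<open>C u - p(T) C s\<close>, where \<open>p\<close> is a polynomial of degree at most \<open>\<ell>\<close> with \<open>p(0) = 1\<close> and
  \<open>C s = C u - (u - \<Pi> u)\<close>; Chebyshev polynomials make \<open>\<parallel>p(T)\<parallel>\<close> at most \<open>2 q\<^sup>\<ell> / (1 + q\<^sup>2\<^sup>\<ell>)\<close>.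

  The norm of \<open>T\<^sub>n(B)\<close> is bounded without a spectral theorem: \<open>1 - T\<^sub>n(x)\<^sup>2 = (1 - x\<^sup>2) U\<^sub>n\<^sub>-\<^sub>1(x)\<^sup>2\<close> exhibits
  \<open>\<parallel>v\<parallel>\<^sup>2 - \<parallel>T\<^sub>n(B) v\<parallel>\<^sup>2\<close> as nonnegative if \<open>\<parallel>B\<parallel> \<le> 1\<close>. The extremes of the spectrum of \<open>T\<close> are the extremes
  of its numerical range. That \<open>\<S>\<close> is a subspace of \<open>H\<^sub>0\<^sup>1(\<Omega>)\<close> is shown by soft thresholding, which
  moves the support into \<open>\<Omega>\<close>, followed by mollification.
\<close>

text \<open>All operators act on subspaces of \<open>L2\<close>, whose own inner product is not the
  energy form; hence form, carrier subspace and completeness are kept together in locales. The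
  weights have sum one because of p(0) = 1: the error of F_\<nu> s as an approximation of C s is (1
  - T)^\<nu> C s, and every power of 1 - T takes the value 1 at T = 0. The number q comes from the
  Joukowski map: the affine substitution that takes the spectral interval to [-1, 1] sends 0 to
  (\<kappa> + 1) / (\<kappa> - 1) = (q + 1/q) / 2, where the Chebyshev polynomial of degree n equals
  (q^n + q^(-n)) / 2. Its reciprocal is the factor in the estimate, which occurs twice because the
  norm of C s is split by the triangle inequality. The analytic obstacle is that the spaces are
  concrete: completeness of the energy norm has to come from Riesz-Fischer and Poincare, and finite
  element functions have to be exhibited as limits of test functions.\<close>

section \<open>Forms and symmetric operators on subspaces\<close>

text \<open>Definiteness is left to \<open>inner_on\<close>, because the Cauchy-Schwarz inequality
  is also applied to the possibly degenerate form \<open>a (S u) v\<close> of a positive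
  semidefinite operator.\<close>

locale semi_inner_on =
  fixes V :: "'v::real_vector set" and a :: "'v \<Rightarrow> 'v \<Rightarrow> real"
  assumes V: "subspace V"
    and sym: "\<And>u v. u \<in> V \<Longrightarrow> v \<in> V \<Longrightarrow> a u v = a v u"
    and add_l: "\<And>u v w. u \<in> V \<Longrightarrow> v \<in> V \<Longrightarrow> w \<in> V \<Longrightarrow> a (u + v) w = a u w + a v w"
    and scale_l: "\<And>r u v. u \<in> V \<Longrightarrow> v \<in> V \<Longrightarrow> a (r *\<^sub>R u) v = r * a u v"
    and nonneg: "\<And>v. v \<in> V \<Longrightarrow> 0 \<le> a v v"
begin

abbreviation nrm :: "'v \<Rightarrow> real" where "nrm \<equiv> energy_norm a"

lemma closed_ops [simp]:
  "0 \<in> V" "u \<in> V \<Longrightarrow> v \<in> V \<Longrightarrow> u + v \<in> V" "u \<in> V \<Longrightarrow> r *\<^sub>R u \<in> V"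
  "u \<in> V \<Longrightarrow> v \<in> V \<Longrightarrow> u - v \<in> V" "u \<in> V \<Longrightarrow> - u \<in> V"
  using V by (auto simp: subspace_0 subspace_add subspace_scale subspace_diff subspace_neg)

lemma add_r: "u \<in> V \<Longrightarrow> v \<in> V \<Longrightarrow> w \<in> V \<Longrightarrow> a w (u + v) = a w u + a w v"
  using add_l[of u v w] by (simp add: sym[of w])

lemma scale_r: "u \<in> V \<Longrightarrow> v \<in> V \<Longrightarrow> a u (r *\<^sub>R v) = r * a u v"
  using scale_l[of v u r] by (simp add: sym[of u])

lemma minus_l: "u \<in> V \<Longrightarrow> v \<in> V \<Longrightarrow> a (- u) v = - a u v"
  using scale_l[of u v "-1"] by simp

lemma minus_r: "u \<in> V \<Longrightarrow> v \<in> V \<Longrightarrow> a u (- v) = - a u v"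
  using scale_r[of u v "-1"] by simp

lemma diff_l: "u \<in> V \<Longrightarrow> v \<in> V \<Longrightarrow> w \<in> V \<Longrightarrow> a (u - v) w = a u w - a v w"
  using add_l[of u "- v" w] by (simp add: minus_l)

lemma diff_r: "u \<in> V \<Longrightarrow> v \<in> V \<Longrightarrow> w \<in> V \<Longrightarrow> a w (u - v) = a w u - a w v"
  using diff_l[of u v w] by (simp add: sym[of w])

lemma zero_l [simp]: "v \<in> V \<Longrightarrow> a 0 v = 0"
  using scale_l[of v v 0] by simp

lemmas bilin = add_l add_r diff_l diff_r scale_l scale_r minus_l minus_r

lemma sum_l: "(\<And>i. i \<in> I \<Longrightarrow> f i \<in> V) \<Longrightarrow> v \<in> V \<Longrightarrow> a (\<Sum>i\<in>I. f i) v = (\<Sum>i\<in>I. a (f i) v)"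
  by (induction I rule: infinite_finite_induct) (auto simp: add_l subspace_sum[OF V])

lemma Cauchy_Schwarz_sq:
  assumes u: "u \<in> V" and v: "v \<in> V"
  shows "(a u v)\<^sup>2 \<le> a u u * a v v"
proof -
  have *: "0 \<le> a u u + 2 * t * a u v + t\<^sup>2 * a v v" for t
    using nonneg[of "u + t *\<^sub>R v"] u v sym[of v u]
    by (simp add: bilin power2_eq_square algebra_simps)
  show ?thesis
  proof (cases "a v v = 0")
    case True
    have "a u v = 0"
    proof (rule ccontr)
      assume "a u v \<noteq> 0"
      \<comment> \<open>For \<open>a v v = 0\<close> the expression in \<open>*\<close> is affine in
        \<open>t\<close>; this \<open>t\<close> gives it the value -1.\<close>
      then show False
        using *[of "- (a u u + 1) / (2 * a u v)"] True by (simp add: field_simps)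
    qed
    then show ?thesis by (simp add: True)
  next
    case False
    then have "a v v > 0" using nonneg[OF v] by simp
    then show ?thesis
      using *[of "- a u v / a v v"] by (simp add: field_simps power2_eq_square)
  qed
qed

lemma nrm_nonneg [simp]: "v \<in> V \<Longrightarrow> 0 \<le> nrm v"
  by (simp add: energy_norm_def nonneg)

lemma nrm_sq: "v \<in> V \<Longrightarrow> (nrm v)\<^sup>2 = a v v"
  by (simp add: energy_norm_def nonneg)

lemma Cauchy_Schwarz: "u \<in> V \<Longrightarrow> v \<in> V \<Longrightarrow> \<bar>a u v\<bar> \<le> nrm u * nrm v"
  by (metis Cauchy_Schwarz_sq energy_norm_def real_sqrt_abs real_sqrt_le_iff real_sqrt_mult)

lemma nrm_scale: "v \<in> V \<Longrightarrow> nrm (r *\<^sub>R v) = \<bar>r\<bar> * nrm v"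
  by (simp add: energy_norm_def bilin real_sqrt_mult flip: mult.assoc)

lemma nrm_triangle:
  assumes "u \<in> V" "v \<in> V"
  shows "nrm (u + v) \<le> nrm u + nrm v"
proof (rule power2_le_imp_le)
  have "(nrm (u + v))\<^sup>2 = (nrm u)\<^sup>2 + 2 * a u v + (nrm v)\<^sup>2"
    using assms sym[of v u] by (simp add: nrm_sq bilin)
  also have "\<dots> \<le> (nrm u + nrm v)\<^sup>2"
    using Cauchy_Schwarz[of u v] assms by (simp add: power2_sum)
  finally show "(nrm (u + v))\<^sup>2 \<le> (nrm u + nrm v)\<^sup>2" .
qed (use assms in simp)

lemma nrm_uminus: "v \<in> V \<Longrightarrow> nrm (- v) = nrm v"
  using nrm_scale[of v "-1"] by simp

lemma nrm_commute: "u \<in> V \<Longrightarrow> v \<in> V \<Longrightarrow> nrm (u - v) = nrm (v - u)"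
  using nrm_uminus[of "u - v"] by simp

lemma nrm_zero [simp]: "nrm 0 = 0"
  by (simp add: energy_norm_def)

definition symmetric_operator :: "('v \<Rightarrow> 'v) \<Rightarrow> bool" where
  "symmetric_operator B \<longleftrightarrow> (\<forall>v\<in>V. B v \<in> V) \<and> (\<forall>u\<in>V. \<forall>v\<in>V. B (u + v) = B u + B v) \<and>
     (\<forall>r. \<forall>v\<in>V. B (r *\<^sub>R v) = r *\<^sub>R B v) \<and> (\<forall>u\<in>V. \<forall>v\<in>V. a (B u) v = a u (B v))"

lemma symmetric_operatorD:
  assumes "symmetric_operator B"
  shows "v \<in> V \<Longrightarrow> B v \<in> V" "u \<in> V \<Longrightarrow> v \<in> V \<Longrightarrow> B (u + v) = B u + B v"
    "v \<in> V \<Longrightarrow> B (r *\<^sub>R v) = r *\<^sub>R B v" "u \<in> V \<Longrightarrow> v \<in> V \<Longrightarrow> a (B u) v = a u (B v)"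
    "u \<in> V \<Longrightarrow> v \<in> V \<Longrightarrow> B (u - v) = B u - B v" "B 0 = 0" "v \<in> V \<Longrightarrow> B (- v) = - B v"
proof -
  note B = assms[unfolded symmetric_operator_def]
  show "v \<in> V \<Longrightarrow> B v \<in> V" and *: "u \<in> V \<Longrightarrow> v \<in> V \<Longrightarrow> B (u + v) = B u + B v"
    and **: "\<And>r v. v \<in> V \<Longrightarrow> B (r *\<^sub>R v) = r *\<^sub>R B v"
    and "u \<in> V \<Longrightarrow> v \<in> V \<Longrightarrow> a (B u) v = a u (B v)" for u v
    using B by auto
  show ***: "v \<in> V \<Longrightarrow> B (- v) = - B v" for v
    using **[of v "-1"] by simp
  show "u \<in> V \<Longrightarrow> v \<in> V \<Longrightarrow> B (u - v) = B u - B v"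
    using *[of u "- v"] by (simp add: ***)
  show "B 0 = 0"
    using **[of 0 0] by simp
qed

lemma symmetric_operator_affine:
  assumes "symmetric_operator B"
  shows "symmetric_operator (\<lambda>v. r *\<^sub>R B v + s *\<^sub>R v)"
  unfolding symmetric_operator_def using symmetric_operatorD[OF assms]
  by (auto simp: bilin algebra_simps)

text \<open>The Cauchy-Schwarz inequality of the form \<open>a (S u) v\<close> for the pair
  \<open>v\<close>, \<open>S v\<close> gives
  \<open>(a (S v) (S v))\<^sup>2 \<le> a (S v) v * a (S (S v)) (S v)\<close>. The last factor is at
  most \<open>c * a (S v) (S v)\<close>, and one factor cancels. This is S^2 <= c S without square
  roots of operators.\<close>

lemma psd_operator_bound:
  assumes S: "symmetric_operator S" and "0 \<le> c"
    and bounds: "\<And>v. v \<in> V \<Longrightarrow> 0 \<le> a (S v) v \<and> a (S v) v \<le> c * a v v"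
    and v: "v \<in> V"
  shows "a (S v) (S v) \<le> c * a (S v) v"
proof -
  note S' = symmetric_operatorD[OF S]
  interpret S: semi_inner_on V "\<lambda>u v. a (S u) v"
  proof
    show "subspace V" by (rule V)
    show "u \<in> V \<Longrightarrow> v \<in> V \<Longrightarrow> a (S u) v = a (S v) u" for u v
      using S' sym[of u "S v"] by auto
  qed (use S' bounds in \<open>auto simp: bilin\<close>)
  have "(a (S v) (S v))\<^sup>2 \<le> a (S v) v * a (S (S v)) (S v)"
    using S.Cauchy_Schwarz_sq[of v "S v"] v S' by simp
  also have "\<dots> \<le> a (S v) v * (c * a (S v) (S v))"
    using bounds[of v] bounds[of "S v"] v S' by (intro mult_left_mono) auto
  finally have *: "a (S v) (S v) * a (S v) (S v) \<le> (c * a (S v) v) * a (S v) (S v)"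
    by (simp add: power2_eq_square mult_ac)
  show ?thesis
  proof (cases "a (S v) (S v) = 0")
    case True
    then show ?thesis using bounds[of v] v \<open>0 \<le> c\<close> by simp
  next
    case False
    then have "0 < a (S v) (S v)" using nonneg[of "S v"] S' v by simp
    then show ?thesis using * by (rule mult_right_le_imp_le[rotated])
  qed
qed

text \<open>For S = B + c, whose form lies between 0 and 2 c, the inequality S^2 <= 2 c S expands to
  B^2 <= c^2. In this way bounds of the numerical range become norm bounds.\<close>

lemma symmetric_operator_bound:
  assumes B: "symmetric_operator B" and "0 \<le> c"
    and bounds: "\<And>v. v \<in> V \<Longrightarrow> \<bar>a (B v) v\<bar> \<le> c * a v v"
    and v: "v \<in> V"
  shows "nrm (B v) \<le> c * nrm v"
proof (rule power2_le_imp_le)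
  note B' = symmetric_operatorD[OF B]
  define S where "S = (\<lambda>v. 1 *\<^sub>R B v + c *\<^sub>R v)"
  have "symmetric_operator S" unfolding S_def by (rule symmetric_operator_affine[OF B])
  moreover have "0 \<le> a (S v) v \<and> a (S v) v \<le> (2 * c) * a v v" if "v \<in> V" for v
    using bounds[OF that] B' that by (simp add: S_def bilin abs_le_iff)
  ultimately have "a (S v) (S v) \<le> 2 * c * a (S v) v"
    using \<open>0 \<le> c\<close> v by (intro psd_operator_bound) auto
  then have "a (B v) (B v) \<le> c\<^sup>2 * a v v"
    using B'(1)[OF v] v sym[of v "B v"] by (simp add: S_def bilin power2_eq_square algebra_simps)
  then show "(nrm (B v))\<^sup>2 \<le> (c * nrm v)\<^sup>2"
    using B' v by (simp add: nrm_sq power_mult_distrib)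
qed (use v \<open>0 \<le> c\<close> in simp)

end

section \<open>Definite forms, completeness and the spectrum of symmetric operators\<close>

locale inner_on = semi_inner_on +
  assumes definite: "\<And>v. v \<in> V \<Longrightarrow> a v v = 0 \<Longrightarrow> v = 0"
begin

lemma nrm_eq_0: "v \<in> V \<Longrightarrow> nrm v = 0 \<longleftrightarrow> v = 0"
  using definite by (auto simp: energy_norm_def)

lemma inner_on_subspace: "subspace U \<Longrightarrow> U \<subseteq> V \<Longrightarrow> inner_on U a"
  by unfold_locales (auto simp: bilin sym nonneg definite subset_iff)

lemma eq_if_orthogonal:
  assumes "subspace U" "U \<subseteq> V" "x \<in> U" "y \<in> U" "\<And>v. v \<in> U \<Longrightarrow> a x v = a y v"
  shows "x = y"
proof -
  have "x - y \<in> U" using assms by (simp add: subspace_diff)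
  then have "a (x - y) (x - y) = 0"
    using assms(5)[of "x - y"] assms by (simp add: diff_l subset_iff)
  then show ?thesis using definite[of "x - y"] \<open>x - y \<in> U\<close> \<open>U \<subseteq> V\<close> by auto
qed

end

text \<open>Completeness refers to the energy norm, since \<open>'v\<close> is merely a real vector
  space; in the application the norm of its type is that of \<open>L2\<close>, a weaker one.\<close>

locale hilbert_on = inner_on +
  assumes complete: "\<And>X. (\<And>n. X n \<in> V) \<Longrightarrow>
      (\<And>e. 0 < e \<Longrightarrow> \<exists>N. \<forall>m\<ge>N. \<forall>n\<ge>N. energy_norm a (X m - X n) < e) \<Longrightarrow>
      \<exists>L\<in>V. (\<lambda>n. energy_norm a (X n - L)) \<longlonglongrightarrow> 0"
begin

text \<open>Richardson iteration: the form of \<open>G\<close> = 1 - R / M' lies between 0 and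
  \<rho> = 1 - c / M', so \<open>symmetric_operator_bound\<close> makes \<open>f\<close> a
  contraction, and its Banach fixed point solves the equation.\<close>

lemma coercive_operator_surj:
  assumes R: "symmetric_operator R" and c: "0 < c"
    and bounds: "\<And>v. v \<in> V \<Longrightarrow> c * a v v \<le> a (R v) v \<and> a (R v) v \<le> M * a v v"
    and b: "b \<in> V"
  shows "\<exists>v\<in>V. R v = b"
proof -
  note R' = symmetric_operatorD[OF R]
  \<comment> \<open>On the zero space the bounds do not force \<open>c \<le> M\<close>; with the
    maximum, \<open>M'\<close> is positive and \<rho> nonnegative in every case.\<close>
  define M' where "M' = max c M"
  have M': "0 < M'" "c \<le> M'" using c by (auto simp: M'_def)
  have boundM: "a (R v) v \<le> M' * a v v" if "v \<in> V" for v
    using bounds[OF that] mult_right_mono[of M M' "a v v"] nonneg[OF that] by (simp add: M'_def)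
  define \<rho> where "\<rho> = 1 - c / M'"
  have \<rho>: "0 \<le> \<rho>" "\<rho> < 1" using c M' by (auto simp: \<rho>_def)
  define G where "G = (\<lambda>v. (- (1 / M')) *\<^sub>R R v + 1 *\<^sub>R v)"
  have G: "symmetric_operator G" unfolding G_def by (rule symmetric_operator_affine[OF R])
  have "nrm (G v) \<le> \<rho> * nrm v" if v: "v \<in> V" for v
  proof (rule symmetric_operator_bound[OF G \<rho>(1) _ v])
    fix w assume w: "w \<in> V"
    have eq: "a (G w) w = a w w - a (R w) w / M'"
      using w R' by (simp add: G_def bilin)
    have "c * a w w / M' \<le> a (R w) w / M'" "a (R w) w / M' \<le> a w w"
      using bounds[OF w] boundM[OF w] M' by (auto simp: field_simps)
    then show "\<bar>a (G w) w\<bar> \<le> \<rho> * a w w"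
      unfolding eq using \<rho> nonneg[OF w] by (simp add: \<rho>_def abs_le_iff algebra_simps)
  qed
  note contraction = this
  \<comment> \<open>\<open>Metric_space\<close> asks for nonnegativity and symmetry of
    \<open>d\<close> on the whole type, where \<open>a\<close> is arbitrary; hence the default 0 off
    \<open>V\<close>.\<close>
  define d where "d = (\<lambda>x y. if x \<in> V \<and> y \<in> V then nrm (x - y) else 0)"
  interpret M: Metric_space V d
  proof
    fix x y z
    show "0 \<le> d x y" by (simp add: d_def)
    show "d x y = d y x" by (auto simp: d_def nrm_commute)
    show "x \<in> V \<Longrightarrow> y \<in> V \<Longrightarrow> d x y = 0 \<longleftrightarrow> x = y" by (simp add: d_def nrm_eq_0)
    show "x \<in> V \<Longrightarrow> y \<in> V \<Longrightarrow> z \<in> V \<Longrightarrow> d x z \<le> d x y + d y z"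
      using nrm_triangle[of "x - y" "y - z"] by (simp add: d_def)
  qed
  have "M.mcomplete"
    unfolding M.mcomplete_def
  proof (intro allI impI)
    fix X assume X: "M.MCauchy X"
    then have XV: "X n \<in> V" for n by (auto simp: M.MCauchy_def)
    have "\<exists>L\<in>V. (\<lambda>n. nrm (X n - L)) \<longlonglongrightarrow> 0"
    proof (rule complete[OF XV])
      fix e :: real assume "e > 0"
      then show "\<exists>N. \<forall>m\<ge>N. \<forall>n\<ge>N. nrm (X m - X n) < e"
        using X[unfolded M.MCauchy_def] XV unfolding d_def by simp
    qed
    then obtain L where "L \<in> V" "(\<lambda>n. nrm (X n - L)) \<longlonglongrightarrow> 0" by blast
    then have "limitin M.mtopology X L sequentially"
      unfolding M.limitin_metric_dist_null using XV by (simp add: d_def)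
    then show "\<exists>L. limitin M.mtopology X L sequentially" by blast
  qed
  moreover have "V \<noteq> {}" using closed_ops(1) by blast
  moreover define f where "f = (\<lambda>v. v + (1 / M') *\<^sub>R (b - R v))"
  have "f \<in> V \<rightarrow> V" using R' b by (auto simp: f_def)
  moreover have "d (f x) (f y) \<le> \<rho> * d x y" if "x \<in> V" "y \<in> V" for x y
  proof -
    have "f x - f y = G (x - y)"
      unfolding f_def G_def R'(5)[OF that] by (simp add: algebra_simps)
    then show ?thesis
      using contraction[of "x - y"] that \<open>f \<in> V \<rightarrow> V\<close> by (auto simp: d_def)
  qed
  ultimately obtain x where "x \<in> V" "f x = x"
    using M.Banach_fixedpoint_thm[of f \<rho>] \<rho> by metis
  then have "(1 / M') *\<^sub>R (b - R x) = 0" unfolding f_def by simp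
  then have "R x = b" using M' by simp
  then show ?thesis using \<open>x \<in> V\<close> by blast
qed


text \<open>The sign \<open>s\<close> treats points below (1) and above (-1) the numerical range
  together: R = s (T - \<mu>) is coercive, hence onto by \<open>coercive_operator_surj\<close>, and
  coercivity with Cauchy-Schwarz bounds its inverse by 1 / c.\<close>

lemma not_in_spectrum:
  assumes T: "symmetric_operator T" and s: "s = 1 \<or> s = -1" and c: "0 < c"
    and bounds: "\<And>v. v \<in> V \<Longrightarrow>
      c * a v v \<le> s * (a (T v) v - \<mu> * a v v) \<and> s * (a (T v) v - \<mu> * a v v) \<le> M * a v v"
  shows "\<mu> \<notin> spectrum_on V nrm T"
proof -
  note T' = symmetric_operatorD[OF T]
  define R where "R = (\<lambda>v. s *\<^sub>R T v + (- s * \<mu>) *\<^sub>R v)"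
  have R: "symmetric_operator R" unfolding R_def by (rule symmetric_operator_affine[OF T])
  note R' = symmetric_operatorD[OF R]
  have ss: "s * s = 1" using s by auto
  have R_eq: "R v = s *\<^sub>R (T v - \<mu> *\<^sub>R v)" for v by (simp add: R_def algebra_simps)
  have TR: "T v - \<mu> *\<^sub>R v = s *\<^sub>R R v" for v by (simp add: R_eq ss)
  have Rb: "c * a v v \<le> a (R v) v \<and> a (R v) v \<le> M * a v v" if "v \<in> V" for v
    using bounds[OF that] that T' by (simp add: R_eq bilin)
  have below: "nrm v \<le> (1 / c) * nrm (T v - \<mu> *\<^sub>R v)" if v: "v \<in> V" for v
  proof -
    have "c * (nrm v)\<^sup>2 \<le> a (R v) v" using Rb v by (simp add: nrm_sq)
    also have "\<dots> \<le> nrm (R v) * nrm v" using Cauchy_Schwarz[of "R v" v] R' v by auto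
    also have "nrm (R v) = nrm (T v - \<mu> *\<^sub>R v)"
      using s T' v unfolding R_eq by (subst nrm_scale) auto
    finally have *: "(c * nrm v) * nrm v \<le> nrm (T v - \<mu> *\<^sub>R v) * nrm v"
      by (simp add: power2_eq_square mult_ac)
    have "c * nrm v \<le> nrm (T v - \<mu> *\<^sub>R v)"
    proof (cases "nrm v = 0")
      case True
      then show ?thesis using T' v by simp
    next
      case False
      then have "0 < nrm v" using nrm_nonneg[OF v] by simp
      with * show ?thesis by simp
    qed
    then show ?thesis using c by (simp add: field_simps)
  qed
  have "bij_betw (\<lambda>v. T v - \<mu> *\<^sub>R v) V V"
    unfolding bij_betw_def
  proof
    show "inj_on (\<lambda>v. T v - \<mu> *\<^sub>R v) V"
    proof (rule inj_onI)
      fix x y assume xy: "x \<in> V" "y \<in> V" "T x - \<mu> *\<^sub>R x = T y - \<mu> *\<^sub>R y"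
      then have "T (x - y) - \<mu> *\<^sub>R (x - y) = 0"
        unfolding T'(5)[OF xy(1,2)] by (simp add: algebra_simps)
      then have "nrm (x - y) \<le> 0" using below[of "x - y"] xy by simp
      then have "nrm (x - y) = 0" using nrm_nonneg[of "x - y"] xy(1,2) by (simp add: antisym)
      then show "x = y" using xy by (simp add: nrm_eq_0)
    qed
    show "(\<lambda>v. T v - \<mu> *\<^sub>R v) ` V = V"
    proof (intro equalityI subsetI)
      fix b assume "b \<in> V"
      then obtain v where "v \<in> V" "R v = s *\<^sub>R b"
        using coercive_operator_surj[OF R c Rb, of "s *\<^sub>R b"] by auto
      then show "b \<in> (\<lambda>v. T v - \<mu> *\<^sub>R v) ` V" by (intro image_eqI[of _ _ v]) (simp_all add: TR ss)
    qed (use T' in auto)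
  qed
  then show ?thesis using below unfolding spectrum_on_def by blast
qed

text \<open>The endpoints of the numerical range are approximate eigenvalues.\<close>

lemma in_spectrum:
  assumes T: "symmetric_operator T" and s: "s = 1 \<or> s = -1"
    and bounds: "\<And>v. v \<in> V \<Longrightarrow>
      0 \<le> s * (a (T v) v - \<mu> * a v v) \<and> s * (a (T v) v - \<mu> * a v v) \<le> M * a v v"
    and inf: "\<And>e. 0 < e \<Longrightarrow> \<exists>v\<in>V. s * (a (T v) v - \<mu> * a v v) < e * a v v"
  shows "\<mu> \<in> spectrum_on V nrm T"
proof -
  note T' = symmetric_operatorD[OF T]
  define R where "R = (\<lambda>v. s *\<^sub>R T v + (- s * \<mu>) *\<^sub>R v)"
  have R: "symmetric_operator R" unfolding R_def by (rule symmetric_operator_affine[OF T])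
  note R' = symmetric_operatorD[OF R]
  have R_eq: "R v = s *\<^sub>R (T v - \<mu> *\<^sub>R v)" for v by (simp add: R_def algebra_simps)
  have aR: "a (R v) v = s * (a (T v) v - \<mu> * a v v)" if "v \<in> V" for v
    using that T' by (simp add: R_eq bilin)
  define M' where "M' = max M 0"
  have M': "a (R v) v \<le> M' * a v v" if "v \<in> V" for v
    using bounds[OF that] mult_right_mono[of M M' "a v v"] nonneg[OF that] aR[OF that]
    by (simp add: M'_def)
  have "\<not> (\<forall>v\<in>V. nrm v \<le> B * nrm (T v - \<mu> *\<^sub>R v))" for B
  proof
    assume B: "\<forall>v\<in>V. nrm v \<le> B * nrm (T v - \<mu> *\<^sub>R v)"
    \<comment> \<open>Chosen so that \<open>B\<^sup>2 * M' * e < 1\<close>: an inverse bounded by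
      \<open>B\<close> gives \<open>a v v \<le> B\<^sup>2 * a (R v) (R v) \<le> B\<^sup>2 * M' * a
      (R v) v\<close>, and this is less than \<open>a v v\<close> for the vector that
      \<open>inf\<close> provides.\<close>
    define e where "e = 1 / (B\<^sup>2 * M' + 1)"
    have pos: "0 < B\<^sup>2 * M' + 1" by (simp add: M'_def add_nonneg_pos)
    then have e: "0 < e" by (simp add: e_def)
    from inf[OF e] obtain v where v: "v \<in> V" and lt: "a (R v) v < e * a v v"
      using aR by auto
    have "0 \<le> a (R v) v" using bounds[OF v] aR[OF v] by simp
    then have avv: "0 < a v v"
      using lt e nonneg[OF v] by (smt (verit) mult_nonneg_nonneg zero_less_mult_pos)
    have "nrm v \<le> B * nrm (R v)"
      using B v s T' unfolding R_eq by (subst nrm_scale) auto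
    then have "(nrm v)\<^sup>2 \<le> (B * nrm (R v))\<^sup>2" using v by (intro power_mono) auto
    then have "a v v \<le> B\<^sup>2 * a (R v) (R v)" using v R' by (simp add: nrm_sq power_mult_distrib)
    also have "\<dots> \<le> B\<^sup>2 * (M' * a (R v) v)"
      using psd_operator_bound[OF R, of M' v] v M' bounds aR
      by (intro mult_left_mono) (auto simp: M'_def)
    also have "\<dots> \<le> B\<^sup>2 * (M' * (e * a v v))"
      using lt by (intro mult_left_mono) (auto simp: M'_def)
    also have "\<dots> = (B\<^sup>2 * M' * e) * a v v" by simp
    also have "\<dots> < 1 * a v v"
      using pos avv by (intro mult_strict_right_mono) (auto simp: e_def field_simps)
    finally show False by simp
  qed
  then show ?thesis unfolding spectrum_on_def by auto
qed

text \<open>The extremes of the Rayleigh quotient belong to the spectrum by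
  \<open>in_spectrum\<close>, and no point beyond them does by \<open>not_in_spectrum\<close>. So
  the infimum and supremum in \<open>condition_number\<close> are attained and are the optimal
  bounds of the form. On {0} the spectrum would be empty.\<close>

lemma spectrum_extremes:
  assumes T: "symmetric_operator T" and c: "0 < c" and nontrivial: "V \<noteq> {0}"
    and bounds: "\<And>v. v \<in> V \<Longrightarrow> c * a v v \<le> a (T v) v \<and> a (T v) v \<le> M * a v v"
  defines "lo \<equiv> Inf (spectrum_on V nrm T)" and "hi \<equiv> Sup (spectrum_on V nrm T)"
  shows "0 < lo" "lo \<le> hi" "v \<in> V \<Longrightarrow> lo * a v v \<le> a (T v) v \<and> a (T v) v \<le> hi * a v v"
proof -
  define Q where "Q = {a (T v) v / a v v |v. v \<in> V \<and> v \<noteq> 0}"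
  have pos: "0 < a v v" if "v \<in> V" "v \<noteq> 0" for v
    using that nonneg[of v] definite[of v] by (auto simp: less_le)
  obtain v0 where v0: "v0 \<in> V" "v0 \<noteq> 0" using nontrivial closed_ops(1) by blast
  have ne: "Q \<noteq> {}" using v0 by (auto simp: Q_def)
  have bb: "c \<le> x" "x \<le> M" if "x \<in> Q" for x
    using that bounds pos by (auto simp: Q_def field_simps)
  have bdd: "bdd_above Q" "bdd_below Q" using bb by (meson bdd_aboveI bdd_belowI)+
  define l where "l = Inf Q"
  define h where "h = Sup Q"
  have lc: "c \<le> l" using ne bb unfolding l_def by (intro cInf_greatest) auto
  have lh: "l * a v v \<le> a (T v) v \<and> a (T v) v \<le> h * a v v" if v: "v \<in> V" for v
  proof (cases "v = 0")
    case False
    then have "a (T v) v / a v v \<in> Q" using v by (auto simp: Q_def)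
    then have "l \<le> a (T v) v / a v v" "a (T v) v / a v v \<le> h"
      unfolding l_def h_def using bdd by (auto intro: cInf_lower cSup_upper)
    then show ?thesis using pos[OF v False] by (simp add: field_simps)
  qed (use symmetric_operatorD(6)[OF T] in simp)
  have "l \<in> spectrum_on V nrm T"
  proof (rule in_spectrum[OF T, of 1 l "h - l"])
    fix e :: real assume "0 < e"
    then obtain v where "v \<in> V" "v \<noteq> 0" "a (T v) v / a v v < l + e"
      using cInf_lessD[OF ne, of "l + e"] by (auto simp: l_def Q_def)
    then show "\<exists>v\<in>V. 1 * (a (T v) v - l * a v v) < e * a v v"
      using pos[of v] by (intro bexI[of _ v]) (auto simp: field_simps)
  qed (use lh in \<open>auto simp: algebra_simps\<close>)
  moreover have "h \<in> spectrum_on V nrm T"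
  proof (rule in_spectrum[OF T, of "-1" h "h - l"])
    fix e :: real assume "0 < e"
    then obtain v where "v \<in> V" "v \<noteq> 0" "h - e < a (T v) v / a v v"
      using less_cSupD[OF ne, of "h - e"] by (auto simp: h_def Q_def)
    then show "\<exists>v\<in>V. - 1 * (a (T v) v - h * a v v) < e * a v v"
      using pos[of v] by (intro bexI[of _ v]) (auto simp: field_simps)
  qed (use lh in \<open>auto simp: algebra_simps\<close>)
  moreover have "l \<le> \<mu> \<and> \<mu> \<le> h" if "\<mu> \<in> spectrum_on V nrm T" for \<mu>
  proof (rule ccontr)
    assume "\<not> (l \<le> \<mu> \<and> \<mu> \<le> h)"
    then consider "\<mu> < l" | "h < \<mu>" by linarith
    then have "\<mu> \<notin> spectrum_on V nrm T"
    proof cases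
      case 1
      then show ?thesis using lh
        by (intro not_in_spectrum[OF T, of 1 "l - \<mu>" \<mu> "h - \<mu>"]) (auto simp: algebra_simps)
    next
      case 2
      then show ?thesis using lh
        by (intro not_in_spectrum[OF T, of "-1" "\<mu> - h" \<mu> "\<mu> - l"]) (auto simp: algebra_simps)
    qed
    with that show False by simp
  qed
  ultimately have "lo = l" "hi = h"
    unfolding lo_def hi_def by (auto intro!: cInf_eq_minimum cSup_eq_maximum)
  then show "0 < lo" "lo \<le> hi" "v \<in> V \<Longrightarrow> lo * a v v \<le> a (T v) v \<and> a (T v) v \<le> hi * a v v"
    using lc c lh[of v] lh[OF v0(1)] pos[OF v0] by (auto intro: mult_right_le_imp_le order_trans)
qed

end

section \<open>Chebyshev polynomials of a symmetric operator\<close>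

text \<open>
  The pairs \<open>(T\<^sub>n(B) v, U\<^sub>n\<^sub>-\<^sub>1(B) v)\<close> of Chebyshev polynomials of the first and second kind.
\<close>

primrec chebyshev_pair :: "('v::real_vector \<Rightarrow> 'v) \<Rightarrow> nat \<Rightarrow> 'v \<Rightarrow> 'v \<times> 'v" where
  "chebyshev_pair B 0 v = (v, 0)"
| "chebyshev_pair B (Suc n) v = (let (x, y) = chebyshev_pair B n v in (B x - (y - B (B y)), B y + x))"

context semi_inner_on
begin

text \<open>The operator form of Pell's equation \<open>T\<^sub>n\<^sup>2 + (1 - x\<^sup>2) U\<^sub>n\<^sub>-\<^sub>1\<^sup>2 = 1\<close>.\<close>

lemma chebyshev_pair_energy:
  assumes B: "symmetric_operator B" and v: "v \<in> V"
  defines "x \<equiv> \<lambda>n. fst (chebyshev_pair B n v)" and "y \<equiv> \<lambda>n. snd (chebyshev_pair B n v)"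
  shows "x n \<in> V \<and> y n \<in> V \<and> a (x n) (x n) + a (y n) (y n) - a (B (y n)) (B (y n)) = a v v"
proof (induction n)
  case 0
  then show ?case using v symmetric_operatorD(6)[OF B] by (simp add: x_def y_def)
next
  case (Suc n)
  note B' = symmetric_operatorD[OF B]
  define p where "p = x n"
  define r where "r = y n"
  have p: "p \<in> V" and r: "r \<in> V" using Suc by (auto simp: p_def r_def)
  \<comment> \<open>The addition theorems of cosine and sine in algebraic form: T_(n+1) = x T_n - (1
    - x^2) U_(n-1) and U_n = x U_(n-1) + T_n.\<close>
  have step: "x (Suc n) = B p - (r - B (B r))" "y (Suc n) = B r + p"
    by (simp_all add: x_def y_def p_def r_def split_def Let_def)
  note BV = B'(1)[OF p] B'(1)[OF B'(1)[OF p]] B'(1)[OF r] B'(1)[OF B'(1)[OF r]]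
    B'(1)[OF B'(1)[OF B'(1)[OF r]]]
  have s: "a p (B r) = a (B p) r" "a r (B p) = a (B p) r" "a (B r) p = a (B p) r"
     "a (B (B r)) r = a (B r) (B r)"  "a r (B (B r)) = a (B r) (B r)"
     "a (B p) (B (B r)) = a (B (B r)) (B p)"
    using B'(4)[OF p r] B'(4)[OF BV(3) r] sym[OF r BV(1)] sym[OF BV(3) p] sym[OF r BV(4)]
      sym[OF BV(1) BV(4)] by simp_all
  show ?case
    unfolding step using Suc p r BV
    by (simp add: p_def[symmetric] r_def[symmetric] bilin B'(2) s)
qed

text \<open>With |B| <= 1 the contribution of the second component to
  \<open>chebyshev_pair_energy\<close>, a(y, y) - a(B y, B y), is nonnegative; dropping it leaves
  the bound.\<close>

lemma chebyshev_pair_bound: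
  assumes B: "symmetric_operator B" and v: "v \<in> V"
    and bounds: "\<And>v. v \<in> V \<Longrightarrow> \<bar>a (B v) v\<bar> \<le> a v v"
  shows "nrm (fst (chebyshev_pair B n v)) \<le> nrm v"
proof -
  define x y where "x = fst (chebyshev_pair B n v)" and "y = snd (chebyshev_pair B n v)"
  have *: "x \<in> V" "y \<in> V" "a x x + a y y - a (B y) (B y) = a v v"
    using chebyshev_pair_energy[OF B v, of n] by (auto simp: x_def y_def)
  have "nrm (B y) \<le> nrm y"
    using symmetric_operator_bound[OF B _ _ *(2), of 1] bounds by simp
  then have "(nrm (B y))\<^sup>2 \<le> (nrm y)\<^sup>2"
    using * symmetric_operatorD(1)[OF B] by (intro power_mono) auto
  then have "(nrm x)\<^sup>2 \<le> (nrm v)\<^sup>2"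
    using * symmetric_operatorD(1)[OF B] v by (simp add: nrm_sq)
  then show ?thesis using v by (auto simp: x_def[symmetric] intro: power2_le_imp_le)
qed

text \<open>Elimination of the second component. The scalars \<open>\<tau>\<close> of
  \<open>chebyshev_acceleration\<close> obey the same recurrence, which is how the value of the
  polynomial at a point outside [-1, 1] is tracked.\<close>

lemma chebyshev_pair_recurrence:
  assumes B: "symmetric_operator B" and v: "v \<in> V"
  shows "fst (chebyshev_pair B (Suc (Suc n)) v) =
    2 *\<^sub>R B (fst (chebyshev_pair B (Suc n) v)) - fst (chebyshev_pair B n v)"
proof -
  note B' = symmetric_operatorD[OF B]
  define x y where "x = fst (chebyshev_pair B n v)" and "y = snd (chebyshev_pair B n v)"
  have "x \<in> V" "y \<in> V"
    using chebyshev_pair_energy[OF B v, of n] by (auto simp: x_def y_def)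
  moreover have "chebyshev_pair B n v = (x, y)" by (simp add: x_def y_def)
  ultimately show ?thesis
    using B'(1) by (simp add: B'(2,5) algebra_simps scaleR_2)
qed

end

definition affine_combination_powers ::
    "('v::real_vector \<Rightarrow> 'v) \<Rightarrow> nat \<Rightarrow> real \<Rightarrow> 'v \<Rightarrow> 'v \<Rightarrow> bool" where
  "affine_combination_powers G n s v z \<longleftrightarrow>
     (\<exists>\<alpha>. z = (\<Sum>\<nu>\<le>n. \<alpha> \<nu> *\<^sub>R (G ^^ \<nu>) v) \<and> (\<Sum>\<nu>\<le>n. \<alpha> \<nu>) = s)"

lemma affine_combination_powers_0: "affine_combination_powers G n 1 v v"
  unfolding affine_combination_powers_def
proof (intro exI conjI)
  show "v = (\<Sum>\<nu>\<le>n. (if \<nu> = 0 then 1 else 0) *\<^sub>R (G ^^ \<nu>) v)"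
    by (subst sum.remove[of _ 0]) (auto intro!: sum.neutral)
  show "(\<Sum>\<nu>\<le>n. if \<nu> = 0 then 1 else 0) = (1::real)" by simp
qed

lemma affine_combination_powers_linear:
  assumes "affine_combination_powers G n s v z" "affine_combination_powers G n s' v z'"
  shows "affine_combination_powers G n (r * s + r' * s') v (r *\<^sub>R z + r' *\<^sub>R z')"
proof -
  from assms obtain \<alpha> \<alpha>' where
    "z = (\<Sum>\<nu>\<le>n. \<alpha> \<nu> *\<^sub>R (G ^^ \<nu>) v)" "(\<Sum>\<nu>\<le>n. \<alpha> \<nu>) = s"
    "z' = (\<Sum>\<nu>\<le>n. \<alpha>' \<nu> *\<^sub>R (G ^^ \<nu>) v)" "(\<Sum>\<nu>\<le>n. \<alpha>' \<nu>) = s'"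
    unfolding affine_combination_powers_def by auto
  then show ?thesis
    unfolding affine_combination_powers_def
    by (intro exI[of _ "\<lambda>\<nu>. r * \<alpha> \<nu> + r' * \<alpha>' \<nu>"])
      (auto simp: sum.distrib scaleR_sum_right sum_distrib_left scaleR_add_left)
qed

lemma affine_combination_powers_Suc:
  assumes "affine_combination_powers G n s v z"
  shows "affine_combination_powers G (Suc n) s v z"
proof -
  from assms obtain \<alpha> where "z = (\<Sum>\<nu>\<le>n. \<alpha> \<nu> *\<^sub>R (G ^^ \<nu>) v)" "(\<Sum>\<nu>\<le>n. \<alpha> \<nu>) = s"
    unfolding affine_combination_powers_def by auto
  then show ?thesis
    unfolding affine_combination_powers_def
    by (intro exI[of _ "\<lambda>\<nu>. if \<nu> \<le> n then \<alpha> \<nu> else 0"]) simp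
qed

context semi_inner_on
begin

lemma funpow_closed: "symmetric_operator G \<Longrightarrow> v \<in> V \<Longrightarrow> (G ^^ n) v \<in> V"
  by (induction n) (auto simp: symmetric_operatorD)

lemma symmetric_operator_sum:
  assumes G: "symmetric_operator G" and "\<And>i. i \<in> I \<Longrightarrow> f i \<in> V"
  shows "G (\<Sum>i\<in>I. \<alpha> i *\<^sub>R f i) = (\<Sum>i\<in>I. \<alpha> i *\<^sub>R G (f i))"
  using assms(2)
  by (induction I rule: infinite_finite_induct)
    (auto simp: symmetric_operatorD[OF G] subspace_sum[OF V])

text \<open>Multiplying p by its variable shifts the coefficients by one place and keeps their
  sum.\<close>

lemma affine_combination_powers_apply:
  assumes G: "symmetric_operator G" and v: "v \<in> V"
    and z: "affine_combination_powers G n s v z"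
  shows "affine_combination_powers G (Suc n) s v (G z)"
proof -
  from z obtain \<alpha> where z: "z = (\<Sum>\<nu>\<le>n. \<alpha> \<nu> *\<^sub>R (G ^^ \<nu>) v)" "(\<Sum>\<nu>\<le>n. \<alpha> \<nu>) = s"
    unfolding affine_combination_powers_def by auto
  have "G z = (\<Sum>\<nu>\<le>n. \<alpha> \<nu> *\<^sub>R (G ^^ Suc \<nu>) v)"
    unfolding z(1) by (subst symmetric_operator_sum[OF G]) (auto simp: funpow_closed[OF G v])
  also have "\<dots> = (\<Sum>\<nu>\<le>Suc n. (case \<nu> of 0 \<Rightarrow> 0 | Suc \<nu> \<Rightarrow> \<alpha> \<nu>) *\<^sub>R (G ^^ \<nu>) v)"
    by (subst sum.atMost_Suc_shift) simp
  finally show ?thesis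
    unfolding affine_combination_powers_def
    by (intro exI[of _ "case_nat 0 \<alpha>"] conjI) (auto simp: z(2) sum.atMost_Suc_shift simp del: sum.atMost_Suc)
qed

end

context hilbert_on
begin

text \<open>The polynomial is T_n(\<beta> - 2 t / (hi - lo)) / T_n(\<beta>). For t between the
  extremes of the spectrum the argument stays in [-1, 1], where |T_n| <= 1; at t = 0 it equals
  \<beta> > 1, and normalisation divides by the large number T_n(\<beta>).\<close>

theorem chebyshev_acceleration:
  assumes T: "symmetric_operator T" and c: "0 < c" and nontrivial: "V \<noteq> {0}"
    and bounds: "\<And>v. v \<in> V \<Longrightarrow> c * a v v \<le> a (T v) v \<and> a (T v) v \<le> M * a v v"
    and v: "v \<in> V"
  defines "q \<equiv> (sqrt (condition_number V nrm T) - 1) / (sqrt (condition_number V nrm T) + 1)"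
  shows "0 \<le> q" "\<exists>z. affine_combination_powers (\<lambda>v. v - T v) n 1 v z \<and>
    nrm z \<le> 2 * q ^ n / (1 + q ^ (2 * n)) * nrm v"
proof -
  define lo hi where "lo = Inf (spectrum_on V nrm T)" and "hi = Sup (spectrum_on V nrm T)"
  have lo: "0 < lo" "lo \<le> hi"
    and lohi: "\<And>v. v \<in> V \<Longrightarrow> lo * a v v \<le> a (T v) v \<and> a (T v) v \<le> hi * a v v"
    using spectrum_extremes[OF T c nontrivial bounds] unfolding lo_def hi_def by auto
  define \<kappa> where "\<kappa> = hi / lo"
  have q: "q = (sqrt \<kappa> - 1) / (sqrt \<kappa> + 1)"
    by (simp add: q_def condition_number_def \<kappa>_def lo_def hi_def)
  have \<kappa>: "1 \<le> \<kappa>" using lo by (simp add: \<kappa>_def)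
  then have "1 \<le> sqrt \<kappa>" by simp
  then show "0 \<le> q" unfolding q by simp
  define G where "G = (\<lambda>v. v - T v)"
  have "G = (\<lambda>v. (- 1) *\<^sub>R T v + 1 *\<^sub>R v)" by (auto simp: G_def)
  then have G: "symmetric_operator G" using symmetric_operator_affine[OF T, of "- 1" 1] by simp
  show "\<exists>z. affine_combination_powers (\<lambda>v. v - T v) n 1 v z \<and>
    nrm z \<le> 2 * q ^ n / (1 + q ^ (2 * n)) * nrm v"
  proof (cases "lo = hi")
    \<comment> \<open>Equal extremes leave no interval to rescale: here \<open>T\<close> is
      \<open>lo\<close> times the identity, and 1 - t / lo already annihilates
      \<open>v\<close>.\<close>
    case True
    then have "q = 0" using lo by (simp add: q \<kappa>_def)
    show ?thesis
    proof (cases n)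
      case 0
      \<comment> \<open>Although \<open>q = 0\<close>, the factor is 1 in degree 0 because
        \<open>0 ^ 0 = 1\<close>, and \<open>z = v\<close> will do.\<close>
      then show ?thesis using affine_combination_powers_0[of _ n v] by auto
    next
      case (Suc m)
      have "nrm (1 *\<^sub>R T v + (- lo) *\<^sub>R v) \<le> 0 * nrm v"
        using lohi True symmetric_operatorD(1)[OF T] v
        by (intro symmetric_operator_bound symmetric_operator_affine[OF T]) (auto simp: bilin)
      then have "nrm (T v - lo *\<^sub>R v) = 0"
        using nrm_nonneg[of "T v - lo *\<^sub>R v"] symmetric_operatorD(1)[OF T v] v by (simp add: antisym)
      then have Tv: "T v = lo *\<^sub>R v"
        using symmetric_operatorD(1)[OF T] v by (simp add: nrm_eq_0)
      \<comment> \<open>These weights write 1 - T / lo as a combination of G = 1 - T and the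
        identity.\<close>
      have "affine_combination_powers G (Suc m) ((1 / lo) * 1 + (1 - 1 / lo) * 1) v
          ((1 / lo) *\<^sub>R G v + (1 - 1 / lo) *\<^sub>R v)"
        by (intro affine_combination_powers_linear affine_combination_powers_apply[OF G v]
            affine_combination_powers_0)
      moreover have "(1 / lo) *\<^sub>R G v + (1 - 1 / lo) *\<^sub>R v = 0"
        using lo by (simp add: G_def Tv algebra_simps)
      ultimately show ?thesis using Suc \<open>q = 0\<close> unfolding G_def by (intro exI[of _ 0]) simp
    qed
  next
    case False
    then have lt: "lo < hi" using lo by simp
    then have "1 < \<kappa>" using lo by (simp add: \<kappa>_def)
    then have s1: "1 < sqrt \<kappa>" by simp
    then have qpos: "0 < q" unfolding q by (intro divide_pos_pos) linarith+
    define \<beta> where "\<beta> = (hi + lo) / (hi - lo)"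
    have "\<beta> = (\<kappa> + 1) / (\<kappa> - 1)" using lo lt by (simp add: \<beta>_def \<kappa>_def field_simps)
    also have "\<dots> = ((sqrt \<kappa>)\<^sup>2 + 1) / ((sqrt \<kappa>)\<^sup>2 - 1)" using \<kappa> by simp
    also have "\<dots> = (q + 1 / q) / 2"
    proof -
      have "(sqrt \<kappa>)\<^sup>2 - 1 \<noteq> 0" "sqrt \<kappa> + 1 \<noteq> 0" "sqrt \<kappa> - 1 \<noteq> 0"
        using \<open>1 < \<kappa>\<close> s1 by (simp, linarith+)
      then show ?thesis unfolding q by (simp add: divide_simps) (simp add: algebra_simps power2_eq_square)
    qed
    finally have \<beta>: "\<beta> = (q + 1 / q) / 2" .
    define B where "B = (\<lambda>v. (- 2 / (hi - lo)) *\<^sub>R T v + \<beta> *\<^sub>R v)"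
    have B: "symmetric_operator B" unfolding B_def by (rule symmetric_operator_affine[OF T])
    have Bb: "\<bar>a (B v) v\<bar> \<le> a v v" if v: "v \<in> V" for v
    proof -
      have "a (B v) v = ((hi + lo) * a v v - 2 * a (T v) v) / (hi - lo)"
        using v symmetric_operatorD(1)[OF T v] by (simp add: B_def \<beta>_def bilin diff_divide_distrib)
      moreover have "\<bar>(hi + lo) * a v v - 2 * a (T v) v\<bar> \<le> (hi - lo) * a v v"
        unfolding abs_le_iff using lohi[OF v] by (simp add: algebra_simps)
      ultimately show ?thesis using lt by (simp add: divide_le_eq mult.commute)
    qed
    \<comment> \<open>Written in \<open>G\<close>, the coefficients of \<open>B\<close> have the sum
      \<beta>, so applying \<open>B\<close> multiplies the value at 1 by \<beta>.\<close>
    have BG: "B z = (2 / (hi - lo)) *\<^sub>R G z + (\<beta> - 2 / (hi - lo)) *\<^sub>R z" for z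
      by (simp add: B_def G_def algebra_simps)
    have apply_B: "affine_combination_powers G (Suc n) (\<beta> * s) v (B z)"
      if "affine_combination_powers G n s v z" for n s z
    proof -
      have "affine_combination_powers G (Suc n) (2 / (hi - lo) * s + (\<beta> - 2 / (hi - lo)) * s) v (B z)"
        unfolding BG by (intro affine_combination_powers_linear affine_combination_powers_apply[OF G v]
            affine_combination_powers_Suc that)
      then show ?thesis by (simp add: algebra_simps)
    qed
    \<comment> \<open>This is T_n(\<beta>), by the identity T_n((q + 1/q) / 2) = (q^n + q^(-n)) /
      2.\<close>
    define \<tau> where "\<tau> = (\<lambda>n. (q ^ n + 1 / q ^ n) / 2)"
    have \<tau>_rec: "\<tau> (Suc (Suc n)) = 2 * \<beta> * \<tau> (Suc n) - \<tau> n" for n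
      using qpos by (simp add: \<tau>_def \<beta> field_simps)
    \<comment> \<open>Two consecutive degrees are carried along for the three-term
      recurrence.\<close>
    have "affine_combination_powers G n (\<tau> n) v (fst (chebyshev_pair B n v)) \<and>
      affine_combination_powers G (Suc n) (\<tau> (Suc n)) v (fst (chebyshev_pair B (Suc n) v))" for n
    proof (induction n)
      case 0
      have "\<tau> 0 = 1" "\<tau> (Suc 0) = \<beta> * 1" using qpos by (auto simp: \<tau>_def \<beta>)
      then show ?case
        using apply_B[OF affine_combination_powers_0] affine_combination_powers_0[of G 0 v]
        by (simp add: symmetric_operatorD(6)[OF B])
    next
      case (Suc n)
      have "affine_combination_powers G (Suc (Suc n)) (2 * (\<beta> * \<tau> (Suc n)) + (- 1) * \<tau> n) v
        (2 *\<^sub>R B (fst (chebyshev_pair B (Suc n) v)) + (- 1) *\<^sub>R fst (chebyshev_pair B n v))"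
        using Suc by (intro affine_combination_powers_linear apply_B) (auto intro: affine_combination_powers_Suc)
      then show ?case
        using Suc unfolding \<tau>_rec chebyshev_pair_recurrence[OF B v] by (simp add: mult.assoc)
    qed
    then have *: "affine_combination_powers G n (\<tau> n) v (fst (chebyshev_pair B n v))" by blast
    have \<tau>: "0 < \<tau> n" "1 / \<tau> n = 2 * q ^ n / (1 + q ^ (2 * n))"
      using qpos by (auto simp: \<tau>_def add_pos_pos field_simps power_mult power2_eq_square
          simp flip: power_mult_distrib power_add mult_2)
    define z where "z = (1 / \<tau> n) *\<^sub>R fst (chebyshev_pair B n v)"
    have "affine_combination_powers G n (1 / \<tau> n * \<tau> n + 0 * \<tau> n) v
        ((1 / \<tau> n) *\<^sub>R fst (chebyshev_pair B n v) + 0 *\<^sub>R fst (chebyshev_pair B n v))"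
      by (intro affine_combination_powers_linear *)
    then have "affine_combination_powers G n 1 v z" using \<tau>(1) by (simp add: z_def)
    moreover have "nrm z \<le> 1 / \<tau> n * nrm v"
      using chebyshev_pair_bound[OF B v Bb, of n] chebyshev_pair_energy[OF B v, of n] \<tau>(1)
      unfolding z_def by (subst nrm_scale) (auto simp: divide_simps)
    ultimately show ?thesis using \<tau>(2) unfolding G_def by auto
  qed
qed

end

section \<open>The abstract error estimate\<close>

context inner_on
begin

lemma orthogonal_projection_eq:
  assumes P: "orthogonal_projection a V U P" and U: "subspace U" "U \<subseteq> V"
    and "u \<in> V" "p \<in> U" "\<And>v. v \<in> U \<Longrightarrow> a p v = a u v"
  shows "P u = p"
  by (rule eq_if_orthogonal[OF U]) (use assms in \<open>auto simp: orthogonal_projection_def\<close>)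

text \<open>An element of \<open>U\<close> is determined by its \<open>a\<close>-products with
  \<open>U\<close>, so linearity and the identity on \<open>U\<close> follow from the defining
  property of the projection.\<close>

lemma orthogonal_projection_linear:
  assumes P: "orthogonal_projection a V U P" and U: "subspace U" "U \<subseteq> V"
  shows "u \<in> V \<Longrightarrow> v \<in> V \<Longrightarrow> P (u + v) = P u + P v" "u \<in> V \<Longrightarrow> P (r *\<^sub>R u) = r *\<^sub>R P u"
    "u \<in> V \<Longrightarrow> v \<in> V \<Longrightarrow> P (u - v) = P u - P v" "u \<in> U \<Longrightarrow> P u = u" "u \<in> V \<Longrightarrow> P u \<in> U"
    "u \<in> V \<Longrightarrow> v \<in> V \<Longrightarrow> a (P u) v = a (P u) (P v)"
proof -
  have in_U: "P u \<in> U" and orth: "\<And>v. v \<in> U \<Longrightarrow> a (P u) v = a u v" if "u \<in> V" for u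
    using P that by (auto simp: orthogonal_projection_def)
  have in_V: "P u \<in> V" if "u \<in> V" for u using in_U[OF that] U(2) by blast
  have UV: "x \<in> V" if "x \<in> U" for x using that U(2) by blast
  show "P (u + v) = P u + P v" if "u \<in> V" "v \<in> V"
    by (rule orthogonal_projection_eq[OF P U])
      (use that in_U in_V UV orth U(1) in \<open>auto simp: subspace_add bilin\<close>)
  show "P (u - v) = P u - P v" if "u \<in> V" "v \<in> V"
    by (rule orthogonal_projection_eq[OF P U])
      (use that in_U in_V UV orth U(1) in \<open>auto simp: subspace_diff bilin\<close>)
  show "P (r *\<^sub>R u) = r *\<^sub>R P u" if "u \<in> V"
    by (rule orthogonal_projection_eq[OF P U])
      (use that in_U in_V UV orth U(1) in \<open>auto simp: subspace_scale bilin\<close>)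
  show "P u = u" if "u \<in> U"
    by (rule orthogonal_projection_eq[OF P U]) (use that UV in auto)
  show "P u \<in> U" if "u \<in> V" using in_U[OF that] .
  show "a (P u) v = a (P u) (P v)" if "u \<in> V" "v \<in> V"
    using orth[OF that(2) in_U[OF that(1)]] sym[OF in_V[OF that(2)] in_V[OF that(1)]]
      sym[OF that(2) in_V[OF that(1)]] by simp
qed

text \<open>Orthogonality to the larger space includes orthogonality to the smaller one. The
  consequence T C = T lets an iteration that starts from \<open>s\<close> see only
  \<open>C s\<close>.\<close>

lemma orthogonal_projection_nested:
  assumes P: "orthogonal_projection a V U P" and U: "subspace U"
    and C: "orthogonal_projection a V W C" and W: "W \<subseteq> V" "U \<subseteq> W" and u: "u \<in> V"
  shows "P (C u) = P u"
proof (rule orthogonal_projection_eq[OF P U])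
  show "U \<subseteq> V" using W by blast
  show "C u \<in> V" using C u W(1) by (auto simp: orthogonal_projection_def)
  show "P u \<in> U" using P u by (simp add: orthogonal_projection_def)
  show "a (P u) v = a (C u) v" if "v \<in> U" for v
    using that P C u W(2) by (auto simp: orthogonal_projection_def)
qed

end

text \<open>The abstract form of the method: \<open>V\<close> plays the role of \<open>H\<^sub>0\<^sup>1(\<Omega>)\<close>.\<close>

locale projected_decomposition = hilbert_on V a for V :: "'v::real_vector set" and a +
  fixes S :: "'v set" and Proj C :: "'v \<Rightarrow> 'v" and I :: "'i set" and U :: "'i \<Rightarrow> 'v set"
    and P :: "'i \<Rightarrow> 'v \<Rightarrow> 'v" and K1 K2 :: real
  assumes S_subset: "S \<subseteq> V"
    and Proj_add: "\<And>u v. u \<in> V \<Longrightarrow> v \<in> V \<Longrightarrow> Proj (u + v) = Proj u + Proj v"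
    and Proj_scaleR: "\<And>r u. u \<in> V \<Longrightarrow> Proj (r *\<^sub>R u) = r *\<^sub>R Proj u"
    and Proj_in: "\<And>u. u \<in> V \<Longrightarrow> Proj u \<in> S" and Proj_id: "\<And>u. u \<in> S \<Longrightarrow> Proj u = u"
    and Proj_bounded: "\<exists>B. \<forall>u\<in>V. nrm (Proj u) \<le> B * nrm u"
    and C: "orthogonal_projection a V (kernel_space V Proj) C"
    and U_subspace: "\<And>i. i \<in> I \<Longrightarrow> subspace (U i)"
    and U_subset: "\<And>i. i \<in> I \<Longrightarrow> U i \<subseteq> kernel_space V Proj"
    and P: "\<And>i. i \<in> I \<Longrightarrow> orthogonal_projection a V (U i) (P i)"
    and K1: "0 < K1" "stable_decomposition nrm (kernel_space V Proj) I U K1"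
    and K2: "0 < K2" "bounded_superposition nrm (kernel_space V Proj) I U K2"
begin

definition kern :: "'v set" where "kern = kernel_space V Proj"
definition T :: "'v \<Rightarrow> 'v" where "T v = (\<Sum>i\<in>I. P i v)"

lemma kern_subset: "kern \<subseteq> V"
  by (auto simp: kern_def kernel_space_def)

lemma Proj_V: "u \<in> V \<Longrightarrow> Proj u \<in> V"
  using Proj_in S_subset by blast

lemma Proj_diff: "u \<in> V \<Longrightarrow> v \<in> V \<Longrightarrow> Proj (u - v) = Proj u - Proj v"
  using Proj_add[of u "(- 1) *\<^sub>R v"] Proj_scaleR[of v "- 1"] by simp

lemma subspace_kern: "subspace kern"
  using Proj_scaleR[of 0 0] V
  by (auto simp: kern_def kernel_space_def subspace_def Proj_add Proj_scaleR)

lemma diff_Proj_kern: "u \<in> V \<Longrightarrow> u - Proj u \<in> kern"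
  using Proj_V Proj_in Proj_id by (simp add: kern_def kernel_space_def Proj_diff)

text \<open>The kernel is closed: if kernel elements X_n tend to L, then Proj L = - Proj (X_n - L),
  which tends to 0 since the projection is bounded in the energy norm.\<close>

lemma hilbert_on_kern: "hilbert_on kern a"
proof -
  interpret K: inner_on kern a by (rule inner_on_subspace[OF subspace_kern kern_subset])
  show ?thesis
  proof
    fix X :: "nat \<Rightarrow> 'v" assume X: "\<And>n. X n \<in> kern" and cauchy: "\<And>e. 0 < e \<Longrightarrow> \<exists>N. \<forall>m\<ge>N. \<forall>n\<ge>N. nrm (X m - X n) < e"
    have XV: "X n \<in> V" for n using X kern_subset by blast
    have "\<exists>L\<in>V. (\<lambda>n. nrm (X n - L)) \<longlonglongrightarrow> 0" by (rule complete[OF XV]) (rule cauchy)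
    then obtain L where L: "L \<in> V" "(\<lambda>n. nrm (X n - L)) \<longlonglongrightarrow> 0" by blast
    obtain B where B: "\<forall>u\<in>V. nrm (Proj u) \<le> B * nrm u" using Proj_bounded by blast
    have "nrm (Proj L) \<le> B * nrm (X n - L)" for n
    proof -
      have "Proj (X n - L) = - Proj L"
        using X[of n] L(1) XV[of n] by (simp add: Proj_diff kern_def kernel_space_def)
      then show ?thesis using B[rule_format, of "X n - L"] XV[of n] L(1) nrm_uminus[OF Proj_V[OF L(1)]] by simp
    qed
    moreover have "(\<lambda>n. B * nrm (X n - L)) \<longlonglongrightarrow> 0" using tendsto_mult_right_zero[OF L(2)] .
    ultimately have "nrm (Proj L) \<le> 0" by (intro LIMSEQ_le_const[of _ 0]) auto
    then have "Proj L = 0"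
      using nrm_nonneg[OF Proj_V[OF L(1)]] nrm_eq_0[OF Proj_V[OF L(1)]] by simp
    then have "L \<in> kern" using L(1) by (simp add: kern_def kernel_space_def)
    then show "\<exists>L\<in>kern. (\<lambda>n. nrm (X n - L)) \<longlonglongrightarrow> 0" using L(2) by blast
  qed
qed

sublocale K: hilbert_on kern a
  by (rule hilbert_on_kern)

lemma U_kern: "i \<in> I \<Longrightarrow> U i \<subseteq> kern"
  using U_subset by (simp add: kern_def)

lemma U_V: "i \<in> I \<Longrightarrow> U i \<subseteq> V"
  using U_kern kern_subset by blast

lemmas C_linear = orthogonal_projection_linear[OF C[folded kern_def] subspace_kern kern_subset]
lemma P_linear:
  assumes "i \<in> I"
  shows "u \<in> V \<Longrightarrow> v \<in> V \<Longrightarrow> P i (u + v) = P i u + P i v" "u \<in> V \<Longrightarrow> P i (r *\<^sub>R u) = r *\<^sub>R P i u"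
    "u \<in> V \<Longrightarrow> v \<in> V \<Longrightarrow> P i (u - v) = P i u - P i v" "u \<in> V \<Longrightarrow> P i u \<in> U i"
    "u \<in> V \<Longrightarrow> v \<in> V \<Longrightarrow> a (P i u) v = a (P i u) (P i v)"
  using orthogonal_projection_linear[OF P[OF assms] U_subspace[OF assms] U_V[OF assms]] by auto

lemma T_linear:
  "u \<in> V \<Longrightarrow> v \<in> V \<Longrightarrow> T (u + v) = T u + T v" "u \<in> V \<Longrightarrow> T (r *\<^sub>R u) = r *\<^sub>R T u"
  "u \<in> V \<Longrightarrow> v \<in> V \<Longrightarrow> T (u - v) = T u - T v" "u \<in> V \<Longrightarrow> T u \<in> kern" "u \<in> V \<Longrightarrow> T (C u) = T u"
proof -
  show "T (u + v) = T u + T v" if "u \<in> V" "v \<in> V"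
    unfolding T_def sum.distrib[symmetric] by (rule sum.cong) (use that P_linear(1) in auto)
  show "T (u - v) = T u - T v" if "u \<in> V" "v \<in> V"
    unfolding T_def sum_subtractf[symmetric] by (rule sum.cong) (use that P_linear(3) in auto)
  show "T (r *\<^sub>R u) = r *\<^sub>R T u" if "u \<in> V"
    unfolding T_def scaleR_sum_right by (rule sum.cong) (use that P_linear(2) in auto)
  show "T u \<in> kern" if "u \<in> V"
    unfolding T_def by (rule subspace_sum[OF subspace_kern]) (use that P_linear(4) U_kern in blast)
  show "T (C u) = T u" if "u \<in> V"
    unfolding T_def
    by (rule sum.cong) (use that orthogonal_projection_nested[OF P U_subspace C[folded kern_def] kern_subset U_kern] in auto)
qed

lemma P_V: "i \<in> I \<Longrightarrow> u \<in> V \<Longrightarrow> P i u \<in> V"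
  using P_linear(4) U_V by blast

lemma form_T: "u \<in> V \<Longrightarrow> v \<in> V \<Longrightarrow> a (T u) v = (\<Sum>i\<in>I. a (P i u) (P i v))"
  unfolding T_def by (subst sum_l) (auto simp: P_V P_linear(5))

lemma T_symmetric: "K.symmetric_operator T"
  unfolding K.symmetric_operator_def
proof (intro conjI ballI allI)
  fix u v assume uv: "u \<in> kern" "v \<in> kern"
  then have V: "u \<in> V" "v \<in> V" using kern_subset by auto
  show "a (T u) v = a u (T v)"
    using form_T[OF V] form_T[OF V(2,1)] sym[OF V(1), of "T v"] T_linear(4)[OF V(2)] kern_subset
    by (auto simp: sym[OF P_V[OF _ V(2)] P_V[OF _ V(1)]])
qed (use T_linear subsetD[OF kern_subset] in auto)

text \<open>Lower bound: for a stable decomposition, a(v, v) is the sum of the a(v_i, P_i v), and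
  Cauchy-Schwarz bounds its square by \<open>K1 * a v v * a (T v) v\<close>. Upper bound:
  \<open>T v\<close> is decomposed into the P_i v, whose squared norms add up to
  \<open>a (T v) v\<close>; this bounds the squared norm of \<open>T v\<close>, and Cauchy-Schwarz
  for \<open>T v\<close> and \<open>v\<close> finishes.\<close>

lemma T_bounds:
  assumes v: "v \<in> kern"
  shows "1 / K1 * a v v \<le> a (T v) v \<and> a (T v) v \<le> K2 * a v v"
proof
  have vV: "v \<in> V" using v kern_subset by blast
  have TV: "T v \<in> V" using T_linear(4)[OF vV] kern_subset by blast
  have nn: "0 \<le> nrm v" using vV by simp
  have Tv: "a (T v) v = (\<Sum>i\<in>I. (nrm (P i v))\<^sup>2)"
    unfolding form_T[OF vV vV] by (rule sum.cong) (simp_all add: nrm_sq P_V vV)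
  have Tv_nonneg: "0 \<le> a (T v) v" unfolding Tv by (intro sum_nonneg) auto
  show "1 / K1 * a v v \<le> a (T v) v"
  proof -
    from K1(2) v obtain vs where vs: "\<And>i. i \<in> I \<Longrightarrow> vs i \<in> U i" "v = (\<Sum>i\<in>I. vs i)"
      "(\<Sum>i\<in>I. (nrm (vs i))\<^sup>2) \<le> K1 * (nrm v)\<^sup>2"
      unfolding stable_decomposition_def kern_def[symmetric] by blast
    have vsV: "vs i \<in> V" if "i \<in> I" for i using vs(1)[OF that] U_V[OF that] by blast
    have "a v v = (\<Sum>i\<in>I. a (vs i) v)"
      by (subst (1) vs(2)) (rule sum_l[OF vsV vV])
    also have "\<dots> = (\<Sum>i\<in>I. a (vs i) (P i v))"
    proof (rule sum.cong)
      fix i assume i: "i \<in> I"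
      have "a (P i v) (vs i) = a v (vs i)"
        using P[OF i] vV vs(1)[OF i] by (simp add: orthogonal_projection_def)
      then show "a (vs i) v = a (vs i) (P i v)"
        using sym[OF vV vsV[OF i]] sym[OF P_V[OF i vV] vsV[OF i]] by simp
    qed simp
    also have "\<dots> \<le> (\<Sum>i\<in>I. nrm (vs i) * nrm (P i v))"
      using Cauchy_Schwarz[OF vsV P_V[OF _ vV]] by (intro sum_mono) (auto simp: abs_le_iff)
    finally have "(a v v)\<^sup>2 \<le> (\<Sum>i\<in>I. nrm (vs i) * nrm (P i v))\<^sup>2"
      using nonneg[OF vV] by (intro power_mono) auto
    also have "\<dots> \<le> (\<Sum>i\<in>I. (nrm (vs i))\<^sup>2) * (\<Sum>i\<in>I. (nrm (P i v))\<^sup>2)"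
      by (rule Cauchy_Schwarz_ineq_sum)
    also have "\<dots> \<le> (K1 * a v v) * a (T v) v"
      using vs(3) Tv_nonneg unfolding Tv[symmetric] nrm_sq[OF vV] by (rule mult_right_mono)
    finally have le: "a v v * a v v \<le> (K1 * a (T v) v) * a v v" by (simp add: power2_eq_square mult_ac)
    have "a v v \<le> K1 * a (T v) v"
    proof (cases "a v v = 0")
      case True
      then show ?thesis using Tv_nonneg K1(1) by simp
    next
      case False
      then have "0 < a v v" using nonneg[OF vV] by simp
      with le show ?thesis by (rule mult_right_le_imp_le)
    qed
    then show ?thesis using K1(1) by (simp add: field_simps)
  qed
  show "a (T v) v \<le> K2 * a v v"
  proof -
    have "(nrm (T v))\<^sup>2 \<le> K2 * (\<Sum>i\<in>I. (nrm (P i v))\<^sup>2)"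
      using K2(2)[unfolded bounded_superposition_def, folded kern_def, rule_format, of "T v" "\<lambda>i. P i v"]
        T_linear(4)[OF vV] P_linear(4)[OF _ vV] by (simp add: T_def)
    then have *: "(nrm (T v))\<^sup>2 \<le> K2 * a (T v) v" by (simp add: Tv)
    have "(a (T v) v)\<^sup>2 \<le> a (T v) (T v) * a v v" by (rule Cauchy_Schwarz_sq[OF TV vV])
    also have "\<dots> \<le> (K2 * a (T v) v) * a v v"
      using * nonneg[OF vV] unfolding nrm_sq[OF TV] by (rule mult_right_mono)
    finally have le: "a (T v) v * a (T v) v \<le> (K2 * a v v) * a (T v) v" by (simp add: power2_eq_square mult_ac)
    show ?thesis
    proof (cases "a (T v) v = 0")
      case True
      then show ?thesis using nonneg[OF vV] K2(1) by simp
    next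
      case False
      then have "0 < a (T v) v" using Tv_nonneg by simp
      with le show ?thesis by (rule mult_right_le_imp_le)
    qed
  qed
qed

section \<open>The correction iteration and its error\<close>

lemma correction_kern: "s \<in> V \<Longrightarrow> correction T n s \<in> kern"
proof (induction n)
  case (Suc n)
  then have "s - correction T n s \<in> V" using kern_subset by auto
  then show ?case using Suc T_linear(4) by (simp add: subspace_add[OF subspace_kern])
qed (simp add: subspace_0[OF subspace_kern])

lemma correction_linear:
  "u \<in> V \<Longrightarrow> v \<in> V \<Longrightarrow> correction T n (u + v) = correction T n u + correction T n v"
  "u \<in> V \<Longrightarrow> correction T n (r *\<^sub>R u) = r *\<^sub>R correction T n u"
proof -
  have cV: "correction T n u \<in> V" if "u \<in> V" for n u
    using correction_kern[OF that] kern_subset by blast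
  show "correction T n (u + v) = correction T n u + correction T n v" if uv: "u \<in> V" "v \<in> V"
  proof (induction n)
    case (Suc n)
    have "T (u + v - (correction T n u + correction T n v)) = T ((u - correction T n u) + (v - correction T n v))"
      by (simp add: algebra_simps)
    also have "\<dots> = T (u - correction T n u) + T (v - correction T n v)"
      using uv cV by (intro T_linear(1)) simp_all
    finally show ?case using Suc by simp
  qed simp
  show "correction T n (r *\<^sub>R u) = r *\<^sub>R correction T n u" if u: "u \<in> V"
  proof (induction n)
    case (Suc n)
    have "T (r *\<^sub>R u - r *\<^sub>R correction T n u) = r *\<^sub>R T (u - correction T n u)"
      using T_linear(2)[of "u - correction T n u" r] u cV by (simp add: scaleR_diff_right)
    then show ?case using Suc by (simp add: scaleR_add_right)
  qed simp
qed

text \<open>All F_\<nu> s lie in the kernel, which \<open>C\<close> fixes, and T C = T; thus T (s -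
  F_\<nu> s) = T (C s - F_\<nu> s). The method is a Richardson iteration for \<open>C s\<close> that
  never evaluates \<open>C s\<close>.\<close>

lemma correction_error:
  assumes s: "s \<in> V"
  shows "C s - correction T n s = ((\<lambda>v. v - T v) ^^ n) (C s)"
proof (induction n)
  case (Suc n)
  define r where "r = correction T n s"
  have r: "r \<in> kern" "r \<in> V" using correction_kern[OF s] kern_subset by (auto simp: r_def)
  have "T (s - r) = T (C (s - r))" using s r by (simp add: T_linear(5))
  also have "C (s - r) = C s - r" using s r by (simp add: C_linear)
  finally have "C s - correction T (Suc n) s = (C s - r) - T (C s - r)" by (simp add: r_def)
  then show ?case using Suc by (simp add: r_def)
qed simp

text \<open>\<open>Wl\<close> is described by containing \<open>s - correction T \<nu> s\<close> for
  all \<open>s\<close> in \<open>S\<close>; passing from the hat functions to all of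
  \<open>S\<close> is left to the concrete setting.\<close>

theorem error_estimate:
  fixes l :: nat
  defines "\<kappa> \<equiv> condition_number kern nrm T"
  defines "q \<equiv> (sqrt \<kappa> - 1) / (sqrt \<kappa> + 1)"
  assumes u: "u \<in> V" and w: "best_approximation nrm (W_space C S) u w"
    and Wl: "subspace Wl" "\<And>s \<nu>. s \<in> S \<Longrightarrow> \<nu> \<le> l \<Longrightarrow> s - correction T \<nu> s \<in> Wl"
    and wl: "best_approximation nrm Wl u wl"
  shows "nrm (u - wl) \<le> (1 + 2 * q ^ l / (1 + q ^ (2 * l))) * nrm (u - w)
      + 2 * q ^ l / (1 + q ^ (2 * l)) * nrm (u - Proj u)"
proof -
  define c where "c = 2 * q ^ l / (1 + q ^ (2 * l))"
  define s where "s = Proj u"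
  have s: "s \<in> S" "s \<in> V" using Proj_in[OF u] S_subset by (auto simp: s_def)
  have us: "u - s \<in> kern" unfolding s_def by (rule diff_Proj_kern[OF u])
  obtain s' where s': "s' \<in> S" "w = s' - C s'" using w by (auto simp: best_approximation_def W_space_def)
  have s'V: "s' \<in> V" using s'(1) S_subset by blast
  have CV: "C v \<in> V" "C v \<in> kern" if "v \<in> V" for v using C_linear(5)[OF that] kern_subset by auto
  have wV: "w \<in> V" using s' s'V CV by simp
  \<comment> \<open>\<open>w = s' - C s'\<close> is orthogonal to the kernel, so the squared norm of
    \<open>C u\<close> equals \<open>a (u - w) (C u)\<close>.\<close>
  have Cu_le: "nrm (C u) \<le> nrm (u - w)"
  proof -
    have orth: "a (C v) x = a v x" if "v \<in> V" "x \<in> kern" for v x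
      using C that by (simp add: orthogonal_projection_def kern_def)
    have "a w (C u) = 0"
      using orth[OF s'V CV(2)[OF u]] by (simp add: s'(2) diff_l s'V CV u)
    then have "(nrm (C u))\<^sup>2 = a (u - w) (C u)"
      using orth[OF u CV(2)[OF u]] by (simp add: nrm_sq diff_l u wV CV)
    also have "\<dots> \<le> nrm (u - w) * nrm (C u)"
      using Cauchy_Schwarz[of "u - w" "C u"] u wV CV by (auto simp: abs_le_iff)
    finally have le: "nrm (C u) * nrm (C u) \<le> nrm (u - w) * nrm (C u)" by (simp add: power2_eq_square)
    show ?thesis
    proof (cases "nrm (C u) = 0")
      case True
      then show ?thesis using u wV by simp
    next
      case False
      then have "0 < nrm (C u)" using nrm_nonneg[OF CV(1)[OF u]] by simp
      with le show ?thesis by (rule mult_right_le_imp_le)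
    qed
  qed
  show ?thesis
  proof (cases "kern = {0}")
    case True \<comment> \<open>The spectrum is empty, and \<open>\<kappa>\<close> is meaningless.\<close>
    then have "u = s" using us by simp
    \<comment> \<open>Index 0 is enough: \<open>correction T 0 s = 0\<close>, so \<open>Wl\<close>
      contains \<open>s\<close> itself.\<close>
    have "u \<in> Wl" using Wl(2)[OF s(1), of 0] \<open>u = s\<close> by simp
    then have "nrm (u - wl) \<le> 0" using wl by (force simp: best_approximation_def)
    moreover have "C u = 0" using CV(2)[OF u] True by blast
    then have "u - C u \<in> W_space C S" using \<open>u = s\<close> s(1) unfolding W_space_def by blast
    then have "nrm (u - w) \<le> 0" using w \<open>C u = 0\<close> by (force simp: best_approximation_def)
    then have "nrm (u - w) = 0" using nrm_nonneg[of "u - w"] u wV by (simp add: antisym)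
    moreover have "u - Proj u = 0" using \<open>u = s\<close> by (simp add: s_def)
    ultimately show ?thesis by simp
  next
    case False
    have K1': "0 < 1 / K1" using K1 by simp
    note chebyshev = K.chebyshev_acceleration[OF T_symmetric K1' False T_bounds]
    have "0 \<le> q"
      unfolding q_def \<kappa>_def by (rule chebyshev(1)) (assumption, rule CV(2)[OF s(2)])
    then have c: "0 \<le> c" unfolding c_def by (intro divide_nonneg_nonneg) auto
    have "\<exists>z. affine_combination_powers (\<lambda>v. v - T v) l 1 (C s) z \<and> nrm z \<le> c * nrm (C s)"
      unfolding c_def q_def \<kappa>_def by (rule chebyshev(2)) (assumption, rule CV(2)[OF s(2)])
    then obtain z where z: "affine_combination_powers (\<lambda>v. v - T v) l 1 (C s) z" "nrm z \<le> c * nrm (C s)"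
      by blast
    then obtain \<alpha> where \<alpha>: "z = (\<Sum>\<nu>\<le>l. \<alpha> \<nu> *\<^sub>R ((\<lambda>v. v - T v) ^^ \<nu>) (C s))" "(\<Sum>\<nu>\<le>l. \<alpha> \<nu>) = 1"
      unfolding affine_combination_powers_def by blast
    have zV: "z \<in> V"
    proof -
      have "((\<lambda>v. v - T v) ^^ \<nu>) (C s) \<in> V" for \<nu>
        using correction_error[OF s(2), of \<nu>] CV(1)[OF s(2)] correction_kern[OF s(2), of \<nu>] kern_subset
        by (metis closed_ops(4) subsetD)
      then show ?thesis unfolding \<alpha>(1) by (intro subspace_sum[OF V]) simp
    qed
    have "(\<Sum>\<nu>\<le>l. \<alpha> \<nu> *\<^sub>R (s - correction T \<nu> s)) \<in> Wl"
      by (intro subspace_sum[OF Wl(1)] subspace_scale[OF Wl(1)] Wl(2) s(1)) simp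
    \<comment> \<open>Because the weights sum to one, the fixed part \<open>s - C s\<close> appears
      exactly once.\<close>
    also have "(\<Sum>\<nu>\<le>l. \<alpha> \<nu> *\<^sub>R (s - correction T \<nu> s)) = (s - C s) + z"
    proof -
      have eq: "s - correction T \<nu> s = (s - C s) + ((\<lambda>v. v - T v) ^^ \<nu>) (C s)" for \<nu>
        using correction_error[OF s(2), of \<nu>] by (simp add: algebra_simps)
      show ?thesis
        unfolding eq scaleR_add_right sum.distrib scaleR_sum_left[symmetric] \<alpha> by simp
    qed
    finally have "nrm (u - wl) \<le> nrm (u - ((s - C s) + z))"
      using wl by (simp add: best_approximation_def)
    \<comment> \<open>\<open>C\<close> fixes the kernel element \<open>u - s\<close>.\<close>
    also have Cs: "C s = C u - (u - s)"
      using C_linear(3)[OF u s(2)] C_linear(4)[OF us] by (simp add: algebra_simps)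
    have "u - ((s - C s) + z) = C u - z" by (simp add: Cs)
    also have "nrm (C u - z) \<le> nrm (C u) + nrm z"
      using nrm_triangle[of "C u" "- z"] nrm_uminus[OF zV] CV(1)[OF u] zV by simp
    also have "nrm z \<le> c * (nrm (C u) + nrm (u - s))"
    proof -
      have usV: "u - s \<in> V" using us kern_subset by blast
      have "nrm (C s) \<le> nrm (C u) + nrm (u - s)"
        using nrm_triangle[OF CV(1)[OF u] closed_ops(5)[OF usV]] nrm_uminus[OF usV]
        unfolding Cs diff_conv_add_uminus[of "C u" "u - s"] by linarith
      then show ?thesis using z(2) mult_left_mono[OF _ c] by (meson order_trans)
    qed
    also have "nrm (C u) + c * (nrm (C u) + nrm (u - s)) = (1 + c) * nrm (C u) + c * nrm (u - s)"
      by (simp add: algebra_simps)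
    also have "\<dots> \<le> (1 + c) * nrm (u - w) + c * nrm (u - s)"
      using Cu_le c by (intro add_mono mult_left_mono) auto
    finally show ?thesis by (simp add: c_def s_def)
  qed
qed

end

section \<open>Test functions\<close>

lemma partial_deriv_eq: "(f has_derivative f') (at x) \<Longrightarrow> partial_deriv i f x = f' (axis i 1)"
  by (simp add: partial_deriv_def flip: frechet_derivative_at)

lemma has_derivative_partial_deriv:
  fixes f :: "real^'n::finite \<Rightarrow> real"
  assumes "f differentiable at x"
  shows "(f has_derivative (\<lambda>h. (\<chi> i. partial_deriv i f x) \<bullet> h)) (at x)"
proof -
  have D: "(f has_derivative frechet_derivative f (at x)) (at x)"
    using assms by (simp add: frechet_derivative_works)
  then interpret bounded_linear "frechet_derivative f (at x)" by (rule has_derivative_bounded_linear)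
  have "frechet_derivative f (at x) h = (\<chi> i. partial_deriv i f x) \<bullet> h" for h
  proof -
    have "h = (\<Sum>i\<in>UNIV. h $ i *\<^sub>R axis i 1)"
      using basis_expansion[of h] by (simp add: scalar_mult_eq_scaleR)
    then have "frechet_derivative f (at x) h = frechet_derivative f (at x) (\<Sum>i\<in>UNIV. h $ i *\<^sub>R axis i 1)"
      by simp
    also have "\<dots> = (\<Sum>i\<in>UNIV. h $ i * partial_deriv i f x)"
      by (simp add: sum scaleR partial_deriv_def)
    finally show ?thesis by (simp add: inner_vec_def mult.commute)
  qed
  then have "frechet_derivative f (at x) = (\<lambda>h. (\<chi> i. partial_deriv i f x) \<bullet> h)" by auto
  then show ?thesis using D by simp
qed

lemma Ck_Suc_imp: "Ck (Suc k) f \<Longrightarrow> Ck k f"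
proof (induction k arbitrary: f)
  case 0
  then show ?case
    by (auto simp: continuous_on_eq_continuous_at intro: differentiable_imp_continuous_within)
qed auto

lemma Ck_const: "Ck k (\<lambda>x :: real^'n::finite. c)"
proof (induction k arbitrary: c)
  case (Suc k)
  have "partial_deriv i (\<lambda>x :: real^'n. c) = (\<lambda>x. 0)" for i
    by (rule ext, subst partial_deriv_eq[OF has_derivative_const]) simp
  then show ?case using Suc by simp
qed simp

lemma Ck_add: "Ck k f \<Longrightarrow> Ck k g \<Longrightarrow> Ck k (\<lambda>x. f x + g x)"
proof (induction k arbitrary: f g)
  case (Suc k)
  then have fg: "f differentiable at x" "g differentiable at x" for x by auto
  have "partial_deriv i (\<lambda>x. f x + g x) = (\<lambda>x. partial_deriv i f x + partial_deriv i g x)" for i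
    by (rule ext, subst partial_deriv_eq[OF has_derivative_add[OF fg[THEN has_derivative_partial_deriv]]])
      (simp add: inner_axis)
  then show ?case using Suc fg by auto
qed (simp add: continuous_on_add)

lemma partial_deriv_mult:
  assumes "f differentiable at x" "g differentiable at x"
  shows "partial_deriv i (\<lambda>x. f x * g x) x = f x * partial_deriv i g x + partial_deriv i f x * g x"
  by (subst partial_deriv_eq[OF has_derivative_mult[OF assms[THEN has_derivative_partial_deriv]]])
    (simp add: inner_axis)

lemma Ck_mult: "Ck k f \<Longrightarrow> Ck k g \<Longrightarrow> Ck k (\<lambda>x. f x * g x)"
proof (induction k arbitrary: f g)
  case (Suc k)
  then have fg: "f differentiable at x" "g differentiable at x" for x by auto
  have "partial_deriv i (\<lambda>x. f x * g x) =
      (\<lambda>x. f x * partial_deriv i g x + partial_deriv i f x * g x)" for i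
    by (rule ext) (rule partial_deriv_mult[OF fg])
  moreover have "Ck k f" "Ck k g" using Suc.prems by (auto intro: Ck_Suc_imp)
  ultimately show ?case using Suc fg by (auto intro!: Ck_add)
qed (simp add: continuous_on_mult)

lemma Ck_uminus: "Ck k f \<Longrightarrow> Ck k (\<lambda>x. - f x)"
  using Ck_mult[OF Ck_const[of k "-1"], of f] by simp

lemma Ck_prod: "(\<And>i. i \<in> I \<Longrightarrow> Ck k (f i)) \<Longrightarrow> Ck k (\<lambda>x. \<Prod>i\<in>I. f i x)"
  by (induction I rule: infinite_finite_induct) (auto simp: Ck_const Ck_mult)

text \<open>Convolutions pair a function with reflected mollifiers; the sign produced here cancels
  the one of integration by parts.\<close>

lemma partial_deriv_reflect:
  assumes "f differentiable at (y - x)"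
  shows "partial_deriv i (\<lambda>x. f (y - x)) x = - partial_deriv i f (y - x)"
    "(\<lambda>x. f (y - x)) differentiable at x"
proof -
  have D: "((\<lambda>x. f (y - x)) has_derivative (\<lambda>h. (\<chi> i. partial_deriv i f (y - x)) \<bullet> (- h))) (at x)"
    by (rule has_derivative_compose[where f = "\<lambda>x. y - x" and g = f])
      (auto intro!: derivative_eq_intros has_derivative_partial_deriv assms)
  show "partial_deriv i (\<lambda>x. f (y - x)) x = - partial_deriv i f (y - x)"
    by (subst partial_deriv_eq[OF D]) (simp add: inner_axis)
  show "(\<lambda>x. f (y - x)) differentiable at x" using D by (rule differentiableI)
qed

lemma Ck_reflect: "Ck k f \<Longrightarrow> Ck k (\<lambda>x. f (y - x))"
proof (induction k arbitrary: f)
  case 0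
  then show ?case by (auto intro!: continuous_on_compose2[of UNIV f] continuous_intros)
next
  case (Suc k)
  then have f: "f differentiable at x" for x by auto
  have "partial_deriv i (\<lambda>x. f (y - x)) = (\<lambda>x. - partial_deriv i f (y - x))" for i
    using partial_deriv_reflect(1)[OF f] by auto
  then show ?case
    using Suc f partial_deriv_reflect(2)[OF f] by (auto intro!: Ck_uminus)
qed

lemma partial_deriv_coord:
  assumes "(g has_real_derivative g') (at (b * x $ i + c))"
  shows "partial_deriv j (\<lambda>x. g (b * x $ i + c)) x = (if i = j then b * g' else 0)"
    "(\<lambda>x. g (b * x $ i + c)) differentiable at x"
proof -
  have D: "((\<lambda>x. g (b * x $ i + c)) has_derivative (\<lambda>h. g' * (b * h $ i))) (at x)"
    by (rule has_derivative_compose[where f = "\<lambda>x. b * x $ i + c" and g = g])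
      (use assms in \<open>auto intro!: derivative_eq_intros bounded_linear_imp_has_derivative
        bounded_linear_vec_nth simp: has_field_derivative_def\<close>)
  show "partial_deriv j (\<lambda>x. g (b * x $ i + c)) x = (if i = j then b * g' else 0)"
    by (subst partial_deriv_eq[OF D]) (simp add: axis_def)
  show "(\<lambda>x. g (b * x $ i + c)) differentiable at x" using D by (rule differentiableI)
qed

section \<open>Smooth bumps built from exp (-1/s)\<close>

text \<open>The derivatives of \<open>smooth_tail 0\<close> are linear combinations of the functions \<open>smooth_tail k\<close>.\<close>

definition smooth_tail :: "nat \<Rightarrow> real \<Rightarrow> real" where
  "smooth_tail k s = (if 0 < s then inverse s ^ k / exp (inverse s) else 0)"

lemma tendsto_smooth_tail: "(smooth_tail k \<longlongrightarrow> 0) (at 0)"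
proof -
  have "((\<lambda>s. inverse s ^ k / exp (inverse s)) \<longlongrightarrow> (0::real)) (at_right 0)"
    by (rule filterlim_compose[OF tendsto_power_div_exp_0 filterlim_inverse_at_top_right])
  then have "(smooth_tail k \<longlongrightarrow> 0) (at_right 0)"
    by (rule tendsto_cong[THEN iffD1, rotated])
      (auto simp: smooth_tail_def eventually_at_right_less intro: eventually_at_rightI[of 0 1])
  moreover have "(smooth_tail k \<longlongrightarrow> 0) (at_left 0)"
    by (rule tendsto_cong[THEN iffD1, OF _ tendsto_const])
      (auto simp: smooth_tail_def intro: eventually_at_leftI[of "-1"])
  ultimately show ?thesis by (simp add: filterlim_split_at)
qed

lemma DERIV_smooth_tail:
  "(smooth_tail k has_real_derivative (smooth_tail (Suc (Suc k)) s - real k * smooth_tail (Suc k) s)) (at s)"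
proof -
  consider "0 < s" | "s < 0" | "s = 0" by linarith
  then show ?thesis
  proof cases
    case 1
    have eq: "smooth_tail k t = exp (- inverse t - real k * ln t)" if "0 < t" for k t
      using that by (simp add: smooth_tail_def exp_diff exp_of_nat_mult exp_minus power_inverse divide_inverse)
    have "smooth_tail (Suc k) s = smooth_tail k s / s" "smooth_tail (Suc (Suc k)) s = smooth_tail k s / s\<^sup>2"
      using 1 by (auto simp: smooth_tail_def divide_inverse power2_eq_square)
    then have "((\<lambda>s. exp (- inverse s - real k * ln s)) has_real_derivative
        (smooth_tail (Suc (Suc k)) s - real k * smooth_tail (Suc k) s)) (at s)"
      using 1 by (auto intro!: derivative_eq_intros simp: eq divide_inverse power2_eq_square algebra_simps)
    then show ?thesis
      by (rule has_field_derivative_transform_within_open[where S = "{0<..}"])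
        (use 1 in \<open>auto simp: eq\<close>)
  next
    case 2
    have "((\<lambda>s. 0) has_real_derivative (smooth_tail (Suc (Suc k)) s - real k * smooth_tail (Suc k) s)) (at s)"
      using 2 by (auto simp: smooth_tail_def)
    then show ?thesis
      by (rule has_field_derivative_transform_within_open[where S = "{..<0}"])
        (use 2 in \<open>auto simp: smooth_tail_def\<close>)
  next
    case 3
    \<comment> \<open>The difference quotient of \<open>smooth_tail k\<close> at 0 is
      \<open>smooth_tail (Suc k)\<close>, which tends to 0.\<close>
    have "((\<lambda>h. (smooth_tail k (0 + h) - smooth_tail k 0) / h) \<longlongrightarrow> 0) (at 0)"
      by (rule tendsto_cong[THEN iffD1, OF _ tendsto_smooth_tail[of "Suc k"]])
        (auto simp: smooth_tail_def eventually_at_filter divide_simps)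
    then show ?thesis using 3 by (simp add: DERIV_def smooth_tail_def)
  qed
qed

lemma Ck_smooth_tail: "Ck n (\<lambda>x. smooth_tail k (b * x $ i + c))"
proof (induction n arbitrary: k)
  case 0
  have "continuous_on UNIV (smooth_tail k)"
    using DERIV_isCont[OF DERIV_smooth_tail] by (auto simp: continuous_on_eq_continuous_at)
  then show ?case by (auto intro!: continuous_on_compose2[of UNIV "smooth_tail k"] continuous_intros)
next
  case (Suc n)
  have "partial_deriv j (\<lambda>x. smooth_tail k (b * x $ i + c)) =
     (\<lambda>x. (if i = j then b else 0) * (smooth_tail (Suc (Suc k)) (b * x $ i + c) +
        (- real k) * smooth_tail (Suc k) (b * x $ i + c)))" for j
    by (auto simp: partial_deriv_coord(1)[OF DERIV_smooth_tail])
  moreover have "Ck n (\<lambda>x. (if i = j then b else 0) * (smooth_tail (Suc (Suc k)) (b * x $ i + c) +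
        (- real k) * smooth_tail (Suc k) (b * x $ i + c)))" for j
    using Suc by (intro Ck_mult Ck_add Ck_const)
  ultimately show ?case
    using partial_deriv_coord(2)[OF DERIV_smooth_tail, of k] unfolding Ck.simps by auto
qed

text \<open>Dilating the distances to the faces by \<open>N\<close> makes the bumps tend to the
  indicator of the open box while they stay between 0 and 1, as dominated convergence
  requires.\<close>

definition box_bump :: "real \<Rightarrow> real^'n \<Rightarrow> real^'n \<Rightarrow> real^'n::finite \<Rightarrow> real" where
  "box_bump N a b x = (\<Prod>i\<in>UNIV. smooth_tail 0 (N * (x $ i - a $ i)) * smooth_tail 0 (N * (b $ i - x $ i)))"

lemma smooth_tail_0_bounds: "0 \<le> smooth_tail 0 s" "smooth_tail 0 s \<le> 1"
  by (auto simp: smooth_tail_def)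

lemma box_bump_bounds: "0 \<le> box_bump N a b x" "box_bump N a b x \<le> 1"
  by (auto simp: box_bump_def smooth_tail_0_bounds intro!: prod_nonneg prod_le_1 mult_le_one mult_nonneg_nonneg)

lemma box_bump_nonzero: "0 < N \<Longrightarrow> box_bump N a b x \<noteq> 0 \<longleftrightarrow> x \<in> box a b"
  by (auto simp: box_bump_def smooth_tail_def mem_box_cart zero_less_mult_iff)

lemma test_function_box_bump:
  assumes "0 < N" "cbox a b \<subseteq> \<Omega>"
  shows "test_function \<Omega> (box_bump N a b)"
  unfolding test_function_def
proof (intro conjI allI)
  have "{x. box_bump N a b x \<noteq> 0} = box a b" using box_bump_nonzero[OF assms(1)] by auto
  then have "closure {x. box_bump N a b x \<noteq> 0} \<subseteq> cbox a b"
    by (metis box_subset_cbox closed_cbox closure_minimal)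
  then show "compact (closure {x. box_bump N a b x \<noteq> 0})" "closure {x. box_bump N a b x \<noteq> 0} \<subseteq> \<Omega>"
    using assms(2) bounded_subset[OF bounded_cbox] unfolding compact_eq_bounded_closed by auto
  fix k
  have "box_bump N a b = (\<lambda>x. \<Prod>i\<in>UNIV. smooth_tail 0 (N * x $ i + (- N * a $ i)) *
      smooth_tail 0 (- N * x $ i + N * b $ i))"
    by (simp add: box_bump_def fun_eq_iff algebra_simps)
  then show "Ck k (box_bump N a b)" using Ck_smooth_tail[of k 0]
    by (simp only:) (intro Ck_prod Ck_mult; assumption)
qed

lemma tendsto_smooth_tail_0:
  "(\<lambda>n. smooth_tail 0 (real (Suc n) * s)) \<longlonglongrightarrow> (if 0 < s then 1 else 0)"
proof (cases "0 < s")
  case True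
  have "(\<lambda>n. 1 / exp (inverse (real (Suc n)) * inverse s)) \<longlonglongrightarrow> 1 / exp (0 * inverse s)"
    by (intro tendsto_intros LIMSEQ_inverse_real_of_nat) simp
  then show ?thesis using True by (simp add: smooth_tail_def zero_less_mult_iff)
next
  case False
  then show ?thesis by (simp add: smooth_tail_def zero_less_mult_iff)
qed

lemma tendsto_box_bump:
  "(\<lambda>n. box_bump (real (Suc n)) a b x) \<longlonglongrightarrow> indicator (box a b) x"
proof -
  have "(\<lambda>n. box_bump (real (Suc n)) a b x) \<longlonglongrightarrow>
    (\<Prod>i\<in>UNIV. (if 0 < x $ i - a $ i then 1 else 0) * (if 0 < b $ i - x $ i then 1 else 0))"
    unfolding box_bump_def by (intro tendsto_prod tendsto_mult tendsto_smooth_tail_0)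
  also have "(\<Prod>i\<in>UNIV. (if 0 < x $ i - a $ i then 1 else 0) * (if 0 < b $ i - x $ i then 1 else 0)) =
      (indicator (box a b) x :: real)"
    by (auto simp: indicator_def mem_box_cart)
  finally show ?thesis .
qed

section \<open>Algebra and bounds of test functions\<close>

lemma test_functionD:
  assumes "test_function \<Omega> \<phi>"
  shows "Ck k \<phi>" "\<phi> differentiable at x" "continuous_on S \<phi>"
proof -
  show C: "Ck k \<phi>" for k using assms by (simp add: test_function_def)
  show "\<phi> differentiable at x" using C[of 1] by simp
  show "continuous_on S \<phi>" using C[of 0] continuous_on_subset by auto
qed

lemma test_function_mono: "test_function \<Omega> \<phi> \<Longrightarrow> \<Omega> \<subseteq> \<Omega>' \<Longrightarrow> test_function \<Omega>' \<phi>"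
  by (auto simp: test_function_def)

lemma test_functionI_support:
  assumes "\<And>k. Ck k f" "{x. f x \<noteq> 0} \<subseteq> K" "compact K" "K \<subseteq> \<Omega>"
  shows "test_function \<Omega> f"
proof -
  have "closure {x. f x \<noteq> 0} \<subseteq> K"
    using assms by (simp add: closure_minimal compact_imp_closed)
  then show ?thesis
    using assms bounded_subset[OF compact_imp_bounded[OF assms(3)]]
    unfolding test_function_def compact_eq_bounded_closed by auto
qed

lemma partial_deriv_zero_outside:
  assumes "x \<notin> closure {x. f x \<noteq> 0}"
  shows "partial_deriv i f x = 0"
proof -
  have "(f has_derivative (\<lambda>h. 0)) (at x)"
    by (rule has_derivative_transform_within_open[OF has_derivative_const[of 0], of "- closure {x. f x \<noteq> 0}"])
      (use assms closure_subset[of "{x. f x \<noteq> 0}"] in auto)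
  then show ?thesis by (simp add: partial_deriv_eq)
qed

lemma test_function_partial_deriv:
  assumes "test_function \<Omega> \<phi>"
  shows "test_function \<Omega> (partial_deriv i \<phi>)"
proof (rule test_functionI_support)
  show "Ck k (partial_deriv i \<phi>)" for k
    using test_functionD(1)[OF assms, of "Suc k"] by simp
  show "{x. partial_deriv i \<phi> x \<noteq> 0} \<subseteq> closure {x. \<phi> x \<noteq> 0}"
    using partial_deriv_zero_outside by auto
qed (use assms in \<open>auto simp: test_function_def\<close>)

lemma test_function_mult:
  assumes "test_function \<Omega> \<phi>" "\<And>k. Ck k f"
  shows "test_function \<Omega> (\<lambda>x. f x * \<phi> x)"
  by (rule test_functionI_support[of _ "closure {x. \<phi> x \<noteq> 0}"])
    (use assms closure_subset[of "{x. \<phi> x \<noteq> 0}"] in \<open>auto simp: test_function_def intro: Ck_mult\<close>)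

lemma test_function_cmult: "test_function \<Omega> \<phi> \<Longrightarrow> test_function \<Omega> (\<lambda>x. c * \<phi> x)"
  by (rule test_function_mult) (auto intro: Ck_const)

lemma test_function_add:
  assumes "test_function \<Omega> \<phi>" "test_function \<Omega> \<psi>"
  shows "test_function \<Omega> (\<lambda>x. \<phi> x + \<psi> x)"
  by (rule test_functionI_support[of _ "closure {x. \<phi> x \<noteq> 0} \<union> closure {x. \<psi> x \<noteq> 0}"])
    (use assms closure_subset[of "{x. \<phi> x \<noteq> 0}"] closure_subset[of "{x. \<psi> x \<noteq> 0}"]
      in \<open>force simp: test_function_def intro: Ck_add\<close>)+

lemma test_function_zero: "test_function \<Omega> (\<lambda>x. 0)"
  by (rule test_functionI_support[of _ "{}"]) (auto intro: Ck_const)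

lemma test_function_zero_outside: "test_function \<Omega> \<phi> \<Longrightarrow> x \<notin> \<Omega> \<Longrightarrow> \<phi> x = 0"
  using closure_subset[of "{x. \<phi> x \<noteq> 0}"] by (auto simp: test_function_def)

lemma test_function_bounded:
  assumes "test_function \<Omega> \<phi>"
  obtains B where "0 \<le> B" "\<And>x. \<bar>\<phi> x\<bar> \<le> B"
proof -
  have "bounded (\<phi> ` closure {x. \<phi> x \<noteq> 0})"
    using assms test_functionD(3)[OF assms]
    by (auto simp: test_function_def intro!: compact_imp_bounded compact_continuous_image)
  then obtain B where B: "\<forall>x\<in>closure {x. \<phi> x \<noteq> 0}. \<bar>\<phi> x\<bar> \<le> B"
    by (auto simp: bounded_iff)
  have "\<bar>\<phi> x\<bar> \<le> max 0 B" for x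
    using B closure_subset[of "{x. \<phi> x \<noteq> 0}"] by (cases "\<phi> x = 0") (auto simp: subset_iff le_max_iff_disj)
  then show ?thesis using that[of "max 0 B"] by simp
qed

lemma test_function_lipschitz:
  assumes "test_function \<Omega> (\<phi> :: real^'n::finite \<Rightarrow> real)"
  obtains L where "0 \<le> L" "\<And>x y. \<bar>\<phi> x - \<phi> y\<bar> \<le> L * norm (x - y)"
proof -
  have "\<exists>B. 0 \<le> B \<and> (\<forall>x. \<bar>partial_deriv i \<phi> x\<bar> \<le> B)" for i
    using test_function_bounded[OF test_function_partial_deriv[OF assms]] by metis
  then obtain B where B: "\<And>i. 0 \<le> B i" "\<And>i x. \<bar>partial_deriv i \<phi> x\<bar> \<le> B i" by metis
  define L where "L = (\<Sum>i\<in>UNIV. B i)"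
  have nb: "norm (\<chi> i. partial_deriv i \<phi> x) \<le> L" for x
    using norm_le_l1_cart[of "\<chi> i. partial_deriv i \<phi> x"] sum_mono[of UNIV "\<lambda>i. \<bar>partial_deriv i \<phi> x\<bar>" B] B(2)
    unfolding L_def by simp
  have "norm (\<phi> x - \<phi> y) \<le> L * norm (x - y)" for x y
  proof (rule differentiable_bound[of UNIV \<phi> "\<lambda>x h. (\<chi> i. partial_deriv i \<phi> x) \<bullet> h"])
    fix x
    show "(\<phi> has_derivative (\<lambda>h. (\<chi> i. partial_deriv i \<phi> x) \<bullet> h)) (at x within UNIV)"
      using has_derivative_partial_deriv[OF test_functionD(2)[OF assms]] by simp
    show "onorm (\<lambda>h. (\<chi> i. partial_deriv i \<phi> x) \<bullet> h) \<le> L"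
    proof (rule onorm_bound)
      show "0 \<le> L" using B by (simp add: L_def sum_nonneg)
      show "norm ((\<chi> i. partial_deriv i \<phi> x) \<bullet> h) \<le> L * norm h" for h
        using Cauchy_Schwarz_ineq2[of "\<chi> i. partial_deriv i \<phi> x" h] mult_right_mono[OF nb[of x], of "norm h"]
        by simp
    qed
  qed auto
  then show ?thesis using that[of L] B by (simp add: L_def sum_nonneg)
qed

section \<open>Lipschitz functions and integration by parts\<close>

text \<open>The sign \<open>c\<close> covers translations, used for difference quotients, and
  reflections, used for convolutions; the Jacobian has modulus 1 in both cases.\<close>

lemma lebesgue_reflect_translate:
  fixes t :: "'a::euclidean_space"
  assumes "c = 1 \<or> c = -1"
  shows "lebesgue = distr lebesgue lebesgue (\<lambda>x. t + c *\<^sub>R x)"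
    "(\<lambda>x. t + c *\<^sub>R x) \<in> lebesgue \<rightarrow>\<^sub>M lebesgue"
proof -
  have T: "(\<lambda>x. t + (\<Sum>j\<in>Basis. (c * (x \<bullet> j)) *\<^sub>R j)) = (\<lambda>x. t + c *\<^sub>R x)"
    by (simp add: euclidean_representation flip: scaleR_scaleR scaleR_sum_right)
  have "c \<noteq> 0" using assms by auto
  then show m: "(\<lambda>x. t + c *\<^sub>R x) \<in> lebesgue \<rightarrow>\<^sub>M lebesgue"
    using lebesgue_affine_measurable[of "\<lambda>_. c" t] unfolding T by simp
  have "(\<Prod>j\<in>(Basis :: 'a set). \<bar>c\<bar>) = 1" using assms by auto
  then show "lebesgue = distr lebesgue lebesgue (\<lambda>x. t + c *\<^sub>R x)"
    using lebesgue_affine_euclidean[of "\<lambda>_. c" t] \<open>c \<noteq> 0\<close> unfolding T by (simp add: density_1)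
qed

lemma
  fixes f :: "'a::euclidean_space \<Rightarrow> 'b::{banach, second_countable_topology}"
  assumes c: "c = 1 \<or> c = -1" and f: "f \<in> borel_measurable lebesgue"
  shows integral_lebesgue_reflect_translate: "(LINT x|lebesgue. f (t + c *\<^sub>R x)) = (LINT x|lebesgue. f x)"
    and measurable_lebesgue_reflect_translate: "(\<lambda>x. f (t + c *\<^sub>R x)) \<in> borel_measurable lebesgue"
proof -
  note T = lebesgue_reflect_translate[OF c, of t]
  show "(\<lambda>x. f (t + c *\<^sub>R x)) \<in> borel_measurable lebesgue"
    using measurable_compose[OF T(2) f] .
  show "(LINT x|lebesgue. f (t + c *\<^sub>R x)) = (LINT x|lebesgue. f x)"
    by (subst (2) T(1)) (rule integral_distr[OF T(2) f, symmetric])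
qed

lemma integrable_bounded_support:
  fixes f :: "'a::euclidean_space \<Rightarrow> 'b::{banach, second_countable_topology}"
  assumes "f \<in> borel_measurable lebesgue" "\<And>x. norm (f x) \<le> B" "bounded {x. f x \<noteq> 0}"
  shows "integrable lebesgue f"
proof -
  obtain R where R: "\<And>x. f x \<noteq> 0 \<Longrightarrow> norm x \<le> R" using assms(3) by (auto simp: bounded_iff)
  show ?thesis
  proof (rule Bochner_Integration.integrable_bound[of _ "\<lambda>x. B * indicator (cball 0 R) x :: real"])
    show "integrable lebesgue (\<lambda>x. B * indicator (cball 0 R) x :: real)"
      by (intro integrable_mult_right integrable_real_indicator)
        (auto simp: emeasure_bounded_finite simp flip: infinity_ennreal_def)
    show "AE x in lebesgue. norm (f x) \<le> norm (B * indicator (cball 0 R) x :: real)"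
    proof (rule AE_I2)
      fix x
      have "0 \<le> B" using assms(2)[of x] norm_ge_zero order_trans by blast
      then show "norm (f x) \<le> norm (B * indicator (cball 0 R) x :: real)"
        using assms(2)[of x] R[of x] by (cases "f x = 0") auto
    qed
  qed (rule assms)
qed

text \<open>The Lipschitz bound dominates the difference quotients and thereby guarantees that the
  pointwise gradient is the weak one, which differentiability almost everywhere alone does not. As
  \<open>g\<close> is determined only almost everywhere, boundedness and bounded support are
  demanded of the chosen representative. Test functions and finite element functions both belong to
  the class.\<close>

definition lipschitz_gradient :: "(real^'n::finite \<Rightarrow> real) \<Rightarrow> (real^'n \<Rightarrow> real^'n) \<Rightarrow> bool" where
  "lipschitz_gradient f g \<longleftrightarrow> (\<exists>L\<ge>0. \<forall>x y. \<bar>f x - f y\<bar> \<le> L * norm (x - y)) \<and> bounded {x. f x \<noteq> 0} \<and>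
     g \<in> borel_measurable lebesgue \<and> bounded (range g) \<and> bounded {x. g x \<noteq> 0} \<and>
     (AE x in lebesgue. (f has_derivative (\<lambda>h. g x \<bullet> h)) (at x))"

lemma lipschitz_gradient_continuous: "lipschitz_gradient f g \<Longrightarrow> continuous_on S f"
proof -
  assume "lipschitz_gradient f g"
  then obtain L where "L \<ge> 0" "\<And>x y. \<bar>f x - f y\<bar> \<le> L * norm (x - y)"
    by (auto simp: lipschitz_gradient_def)
  then have "L-lipschitz_on S f" by (auto simp: lipschitz_on_def dist_norm)
  then show "continuous_on S f" by (rule lipschitz_on_continuous_on)
qed

lemma continuous_bounded_support_bounded:
  fixes f :: "'a::euclidean_space \<Rightarrow> real"
  assumes "continuous_on UNIV f" "bounded {x. f x \<noteq> 0}"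
  obtains B where "0 \<le> B" "\<And>x. \<bar>f x\<bar> \<le> B"
proof -
  have "compact (f ` closure {x. f x \<noteq> 0})"
    using assms by (intro compact_continuous_image continuous_on_subset[OF assms(1)]) auto
  then obtain B where B: "\<forall>x\<in>closure {x. f x \<noteq> 0}. \<bar>f x\<bar> \<le> B"
    using compact_imp_bounded by (force simp: bounded_iff)
  have "\<bar>f x\<bar> \<le> max 0 B" for x
    using B closure_subset[of "{x. f x \<noteq> 0}"] by (cases "f x = 0") (auto simp: subset_iff le_max_iff_disj)
  then show ?thesis using that[of "max 0 B"] by simp
qed

lemma lipschitz_gradientE:
  assumes "lipschitz_gradient f g"
  obtains L B R where "0 \<le> L" "0 \<le> B" "\<And>x y. \<bar>f x - f y\<bar> \<le> L * norm (x - y)" "\<And>x. \<bar>f x\<bar> \<le> B"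
    "\<And>x. norm (g x) \<le> B" "\<And>x. f x \<noteq> 0 \<Longrightarrow> norm x \<le> R" "\<And>x. g x \<noteq> 0 \<Longrightarrow> norm x \<le> R"
proof -
  note f = assms[unfolded lipschitz_gradient_def]
  obtain L where L: "0 \<le> L" "\<And>x y. \<bar>f x - f y\<bar> \<le> L * norm (x - y)" using f by auto
  obtain B1 where B1: "0 \<le> B1" "\<And>x. \<bar>f x\<bar> \<le> B1"
    using continuous_bounded_support_bounded[OF lipschitz_gradient_continuous[OF assms]] f by auto
  obtain B2 where B2: "\<And>x. norm (g x) \<le> B2" using f by (auto simp: bounded_iff)
  obtain R1 where R1: "\<And>x. f x \<noteq> 0 \<Longrightarrow> norm x \<le> R1" using f by (auto simp: bounded_iff)
  obtain R2 where R2: "\<And>x. g x \<noteq> 0 \<Longrightarrow> norm x \<le> R2" using f by (auto simp: bounded_iff)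
  show ?thesis
  proof (rule that[OF L(1) _ L(2), of "max B1 B2" "max R1 R2"])
    show "\<bar>f x\<bar> \<le> max B1 B2" "norm (g x) \<le> max B1 B2" for x
      using B1(2)[of x] B2[of x] by auto
    show "f x \<noteq> 0 \<Longrightarrow> norm x \<le> max R1 R2" "g x \<noteq> 0 \<Longrightarrow> norm x \<le> max R1 R2" for x
      using R1[of x] R2[of x] by auto
  qed (use B1 in auto)
qed

lemma lipschitz_gradient_measurable:
  assumes "lipschitz_gradient f g"
  shows "f \<in> borel_measurable lebesgue" "g \<in> borel_measurable lebesgue"
proof -
  have "f \<in> borel_measurable borel"
    using lipschitz_gradient_continuous[OF assms] by (rule borel_measurable_continuous_onI)
  then show "f \<in> borel_measurable lebesgue" by (intro measurable_completion) simp
qed (use assms in \<open>simp add: lipschitz_gradient_def\<close>)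

text \<open>Difference quotients have integral zero by translation invariance.\<close>

lemma lipschitz_gradient_integral_zero:
  assumes fg: "lipschitz_gradient f g"
  shows "(LINT x|lebesgue. g x $ i) = 0"
proof -
  obtain L B R where L: "0 \<le> L" "\<And>x y. \<bar>f x - f y\<bar> \<le> L * norm (x - y)"
    and B: "\<And>x. \<bar>f x\<bar> \<le> B" and R: "\<And>x. f x \<noteq> 0 \<Longrightarrow> norm x \<le> R"
    using lipschitz_gradientE[OF fg] by metis
  note m = lipschitz_gradient_measurable[OF fg]
  let ?e = "axis i 1 :: real^'a"
  have ne: "norm ?e = 1" by (simp add: norm_axis_1)
  \<comment> \<open>Steps of length at most 1 keep all difference quotients supported in the ball of
    radius \<open>R + 1\<close>, where \<open>L\<close> dominates them.\<close>
  define h where "h = (\<lambda>n. inverse (real (Suc n)))"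
  have h: "0 < h n" "h n \<le> 1" for n by (auto simp: h_def inverse_le_1_iff)
  define s where "s = (\<lambda>n x. (f (h n *\<^sub>R ?e + 1 *\<^sub>R x) - f x) / h n)"
  have mt: "(\<lambda>x. f (h n *\<^sub>R ?e + 1 *\<^sub>R x)) \<in> borel_measurable lebesgue" for n
    by (rule measurable_lebesgue_reflect_translate[OF _ m(1)]) simp
  have "(LINT x|lebesgue. s n x) = 0" for n
  proof -
    have i1: "integrable lebesgue f"
      using fg B m by (intro integrable_bounded_support) (auto simp: lipschitz_gradient_def)
    have "norm x \<le> R + 1" if "f (h n *\<^sub>R ?e + 1 *\<^sub>R x) \<noteq> 0" for x
      using R[OF that] norm_triangle_ineq4[of "h n *\<^sub>R ?e + 1 *\<^sub>R x" "h n *\<^sub>R ?e"] h[of n] ne by simp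
    then have "integrable lebesgue (\<lambda>x. f (h n *\<^sub>R ?e + 1 *\<^sub>R x))"
      using B mt by (intro integrable_bounded_support[of _ B]) (auto simp: bounded_iff intro!: exI[of _ "R + 1"])
    then show ?thesis
      using i1 integral_lebesgue_reflect_translate[OF _ m(1), of 1 "h n *\<^sub>R ?e"] by (simp add: s_def)
  qed
  moreover have "(\<lambda>n. LINT x|lebesgue. s n x) \<longlonglongrightarrow> (LINT x|lebesgue. g x $ i)"
  proof (rule integral_dominated_convergence[where w = "\<lambda>x. L * indicator (cball 0 (R + 1)) x"])
    show "(\<lambda>x. g x $ i) \<in> borel_measurable lebesgue"
      using m(2) by (rule measurable_compose) simp
    show "s n \<in> borel_measurable lebesgue" for n
      unfolding s_def using mt m(1) by measurable
    show "integrable lebesgue (\<lambda>x. L * indicator (cball 0 (R + 1)) x :: real)"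
      by (intro integrable_mult_right integrable_real_indicator)
        (auto simp: emeasure_bounded_finite simp flip: infinity_ennreal_def)
    show "AE x in lebesgue. (\<lambda>n. s n x) \<longlonglongrightarrow> g x $ i"
    proof -
      have "(\<lambda>n. s n x) \<longlonglongrightarrow> g x $ i" if D: "(f has_derivative (\<lambda>h. g x \<bullet> h)) (at x)" for x
      proof -
        have "((\<lambda>t. f (t *\<^sub>R ?e + x)) has_derivative (\<lambda>t. g x \<bullet> (t *\<^sub>R ?e))) (at 0)"
          by (rule has_derivative_compose[where f = "\<lambda>t. t *\<^sub>R ?e + x" and g = f])
            (use D in \<open>auto intro!: derivative_eq_intros\<close>)
        then have "((\<lambda>t. f (t *\<^sub>R ?e + x)) has_real_derivative g x $ i) (at 0)"
          by (simp add: has_field_derivative_def inner_axis mult_commute_abs)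
        then have "((\<lambda>t. (f (t *\<^sub>R ?e + x) - f x) / t) \<longlongrightarrow> g x $ i) (at 0)"
          by (simp add: DERIV_def)
        moreover have "filterlim h (at 0) sequentially"
          unfolding filterlim_at using LIMSEQ_inverse_real_of_nat h by (auto simp: h_def)
        ultimately show ?thesis
          unfolding s_def by (auto dest: filterlim_compose)
      qed
      then show ?thesis using fg by (auto simp: lipschitz_gradient_def elim: eventually_mono)
    qed
    show "AE x in lebesgue. norm (s n x) \<le> L * indicator (cball 0 (R + 1)) x" for n
    proof (rule AE_I2)
      fix x
      show "norm (s n x) \<le> L * indicator (cball 0 (R + 1)) x"
      proof (cases "norm x \<le> R + 1")
        case True
        have "\<bar>f (h n *\<^sub>R ?e + x) - f x\<bar> \<le> L * h n"
          using L(2)[of "h n *\<^sub>R ?e + x" x] h[of n] ne by simp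
        then show ?thesis using True h[of n] by (simp add: s_def divide_le_eq)
      next
        case False
        have "norm x \<le> norm (h n *\<^sub>R ?e + x) + 1"
          using norm_triangle_ineq4[of "h n *\<^sub>R ?e + x" "h n *\<^sub>R ?e"] h[of n] ne by simp
        then have "f x = 0" "f (h n *\<^sub>R ?e + x) = 0"
          using R[of x] R[of "h n *\<^sub>R ?e + x"] False by force+
        then show ?thesis using False by (simp add: s_def)
      qed
    qed
  qed
  ultimately show ?thesis by (simp add: LIMSEQ_const_iff)
qed

lemma lipschitz_gradient_mult:
  assumes 1: "lipschitz_gradient f g" and 2: "lipschitz_gradient f' g'"
  shows "lipschitz_gradient (\<lambda>x. f x * f' x) (\<lambda>x. f x *\<^sub>R g' x + f' x *\<^sub>R g x)"
proof -
  obtain L B R where L: "0 \<le> L" "0 \<le> B" "\<And>x y. \<bar>f x - f y\<bar> \<le> L * norm (x - y)" "\<And>x. \<bar>f x\<bar> \<le> B"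
    "\<And>x. norm (g x) \<le> B" "\<And>x. f x \<noteq> 0 \<Longrightarrow> norm x \<le> R" "\<And>x. g x \<noteq> 0 \<Longrightarrow> norm x \<le> R"
    using lipschitz_gradientE[OF 1] by metis
  obtain L' B' R' where L': "0 \<le> L'" "0 \<le> B'" "\<And>x y. \<bar>f' x - f' y\<bar> \<le> L' * norm (x - y)" "\<And>x. \<bar>f' x\<bar> \<le> B'"
    "\<And>x. norm (g' x) \<le> B'" "\<And>x. f' x \<noteq> 0 \<Longrightarrow> norm x \<le> R'" "\<And>x. g' x \<noteq> 0 \<Longrightarrow> norm x \<le> R'"
    using lipschitz_gradientE[OF 2] by metis
  note [measurable] = lipschitz_gradient_measurable[OF 1] lipschitz_gradient_measurable[OF 2]
  show ?thesis
    unfolding lipschitz_gradient_def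
  proof (intro conjI)
    have "\<bar>f x * f' x - f y * f' y\<bar> \<le> (B * L' + L * B') * norm (x - y)" for x y
    proof -
      have "f x * f' x - f y * f' y = f x * (f' x - f' y) + (f x - f y) * f' y" by (simp add: algebra_simps)
      also have "\<bar>\<dots>\<bar> \<le> \<bar>f x\<bar> * \<bar>f' x - f' y\<bar> + \<bar>f x - f y\<bar> * \<bar>f' y\<bar>"
        using abs_triangle_ineq by (simp flip: abs_mult)
      also have "\<dots> \<le> B * (L' * norm (x - y)) + (L * norm (x - y)) * B'"
        using L L' by (intro add_mono mult_mono) auto
      finally show ?thesis by (simp add: algebra_simps)
    qed
    then show "\<exists>L\<ge>0. \<forall>x y. \<bar>f x * f' x - f y * f' y\<bar> \<le> L * norm (x - y)"
      using L L' by (intro exI[of _ "B * L' + L * B'"]) auto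
    show "bounded {x. f x * f' x \<noteq> 0}"
      using L by (auto simp: bounded_iff intro!: exI[of _ R])
    show "(\<lambda>x. f x *\<^sub>R g' x + f' x *\<^sub>R g x) \<in> borel_measurable lebesgue" by measurable
    have "norm (f x *\<^sub>R g' x + f' x *\<^sub>R g x) \<le> B * B' + B' * B" for x
      using L L' by (intro order_trans[OF norm_triangle_ineq] add_mono) (auto intro!: mult_mono)
    then show "bounded (range (\<lambda>x. f x *\<^sub>R g' x + f' x *\<^sub>R g x))"
      unfolding bounded_iff by blast
    show "bounded {x. f x *\<^sub>R g' x + f' x *\<^sub>R g x \<noteq> 0}"
      unfolding bounded_iff
    proof (intro exI[of _ R] ballI)
      fix x assume "x \<in> {x. f x *\<^sub>R g' x + f' x *\<^sub>R g x \<noteq> 0}"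
      then have "f x \<noteq> 0 \<or> g x \<noteq> 0" by auto
      then show "norm x \<le> R" using L by auto
    qed
    have "AE x in lebesgue. (f has_derivative (\<lambda>h. g x \<bullet> h)) (at x)"
      "AE x in lebesgue. (f' has_derivative (\<lambda>h. g' x \<bullet> h)) (at x)"
      using 1 2 by (auto simp: lipschitz_gradient_def)
    then show "AE x in lebesgue. ((\<lambda>x. f x * f' x) has_derivative
        (\<lambda>h. (f x *\<^sub>R g' x + f' x *\<^sub>R g x) \<bullet> h)) (at x)"
    proof eventually_elim
      case (elim x)
      show ?case
        by (rule has_derivative_eq_rhs[OF has_derivative_mult[OF elim]])
          (auto simp: inner_add_left algebra_simps)
    qed
  qed
qed

lemma test_function_lipschitz_gradient:
  assumes "test_function \<Omega> \<phi>"
  shows "lipschitz_gradient \<phi> (\<lambda>x. \<chi> i. partial_deriv i \<phi> x)"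
  unfolding lipschitz_gradient_def
proof (intro conjI)
  note p = test_function_partial_deriv[OF assms]
  show "\<exists>L\<ge>0. \<forall>x y. \<bar>\<phi> x - \<phi> y\<bar> \<le> L * norm (x - y)"
    using test_function_lipschitz[OF assms] by metis
  show "bounded {x. \<phi> x \<noteq> 0}"
    using assms bounded_subset[OF compact_imp_bounded closure_subset] by (auto simp: test_function_def)
  have "continuous_on UNIV (\<lambda>x. \<chi> i. partial_deriv i \<phi> x)"
    using test_functionD(3)[OF p] by (intro continuous_on_vec_lambda)
  then show "(\<lambda>x. \<chi> i. partial_deriv i \<phi> x) \<in> borel_measurable lebesgue"
    by (intro measurable_completion) (simp add: borel_measurable_continuous_onI)
  have "\<exists>B. 0 \<le> B \<and> (\<forall>x. \<bar>partial_deriv i \<phi> x\<bar> \<le> B)" for i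
    using test_function_bounded[OF p] by metis
  then obtain B where B: "\<And>i. 0 \<le> B i" "\<And>i x. \<bar>partial_deriv i \<phi> x\<bar> \<le> B i" by metis
  have "norm (\<chi> i. partial_deriv i \<phi> x) \<le> (\<Sum>i\<in>UNIV. B i)" for x
    using norm_le_l1_cart[of "\<chi> i. partial_deriv i \<phi> x"] sum_mono[of UNIV "\<lambda>i. \<bar>partial_deriv i \<phi> x\<bar>" B] B(2)
    by simp
  then show "bounded (range (\<lambda>x. \<chi> i. partial_deriv i \<phi> x))" unfolding bounded_iff by blast
  have "{x. (\<chi> i. partial_deriv i \<phi> x) \<noteq> 0} \<subseteq> closure {x. \<phi> x \<noteq> 0}"
    using partial_deriv_zero_outside by (force simp: vec_eq_iff)
  then show "bounded {x. (\<chi> i. partial_deriv i \<phi> x) \<noteq> 0}"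
    using assms bounded_subset compact_imp_bounded unfolding test_function_def by blast
  show "AE x in lebesgue. (\<phi> has_derivative (\<lambda>h. (\<chi> i. partial_deriv i \<phi> x) \<bullet> h)) (at x)"
    by (rule AE_I2) (rule has_derivative_partial_deriv[OF test_functionD(2)[OF assms]])
qed

lemma lipschitz_gradient_square_integrable:
  assumes "lipschitz_gradient f g"
  shows "square_integrable f" "square_integrable g"
proof -
  note m[measurable] = lipschitz_gradient_measurable[OF assms]
  obtain B where B: "0 \<le> B" "\<And>x. \<bar>f x\<bar> \<le> B" "\<And>x. norm (g x) \<le> B"
    using lipschitz_gradientE[OF assms] by metis
  have "integrable lebesgue (\<lambda>x. (norm (f x))\<^sup>2)"
    using assms B by (intro integrable_bounded_support[of _ "B\<^sup>2"])
      (auto simp: lipschitz_gradient_def abs_le_square_iff[symmetric])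
  then show "square_integrable f" using m by (simp add: square_integrable_def)
  have "integrable lebesgue (\<lambda>x. (norm (g x))\<^sup>2)"
    using assms B by (intro integrable_bounded_support[of _ "B\<^sup>2"])
      (auto simp: lipschitz_gradient_def abs_le_square_iff[symmetric])
  then show "square_integrable g" using m by (simp add: square_integrable_def)
qed

text \<open>\<open>f * \<phi>\<close> is in the same class by
  \<open>lipschitz_gradient_mult\<close>, so its i-th derivative has integral zero; the Leibniz rule
  splits this integral into the two sides.\<close>

lemma lipschitz_gradient_by_parts:
  assumes fg: "lipschitz_gradient f g" and \<phi>: "test_function UNIV \<phi>"
  shows "(LINT x|lebesgue. f x * partial_deriv i \<phi> x) = - (LINT x|lebesgue. g x $ i * \<phi> x)"
proof -
  note \<phi>' = test_function_lipschitz_gradient[OF \<phi>]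
  note \<phi>'' = test_function_lipschitz_gradient[OF test_function_partial_deriv[OF \<phi>]]
  have i1: "integrable lebesgue (\<lambda>x. f x \<bullet> partial_deriv i \<phi> x)"
    using fg \<phi>'' by (intro square_integrable_inner lipschitz_gradient_square_integrable(1))
  have "integrable lebesgue (\<lambda>x. g x \<bullet> (\<phi> x *\<^sub>R axis i 1))"
  proof (rule square_integrable_inner)
    have "square_integrable \<phi>" using \<phi>' by (rule lipschitz_gradient_square_integrable)
    then show "square_integrable (\<lambda>x. \<phi> x *\<^sub>R (axis i 1 :: real^'a))"
      by (auto simp: square_integrable_def power_mult_distrib norm_axis_1)
  qed (rule lipschitz_gradient_square_integrable[OF fg])
  then have i2: "integrable lebesgue (\<lambda>x. \<phi> x * g x $ i)" by (simp add: inner_axis)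
  have "0 = (LINT x|lebesgue. (f x *\<^sub>R (\<chi> i. partial_deriv i \<phi> x) + \<phi> x *\<^sub>R g x) $ i)"
    by (rule lipschitz_gradient_integral_zero[OF lipschitz_gradient_mult[OF fg \<phi>'], symmetric])
  also have "\<dots> = (LINT x|lebesgue. f x * partial_deriv i \<phi> x) + (LINT x|lebesgue. \<phi> x * g x $ i)"
    using i1 i2 by simp
  finally show ?thesis by (simp add: mult.commute)
qed

text \<open>Open boxes form an intersection-stable generator of the Borel sets, and the sets over
  which \<open>f\<close> integrates to zero form a Dynkin system. So all set integrals vanish, and
  uniqueness of densities compares \<open>f\<close> with 0.\<close>

lemma zero_box_integrals_imp_AE_zero_borel:
  fixes f :: "'a::euclidean_space \<Rightarrow> real"
  assumes f: "integrable lborel f" and zero: "\<And>a b. (LINT x:box a b|lborel. f x) = 0"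
  shows "AE x in lborel. f x = 0"
proof -
  have si: "set_integrable lborel A f" if "A \<in> sets borel" for A
    using f that integrable_mult_indicator[of A lborel f] by (simp add: set_integrable_def)
  \<comment> \<open>The whole space is not a box; its integral is a limit over growing
    boxes.\<close>
  have total: "(LINT x|lborel. f x) = 0"
  proof -
    have "(\<lambda>n. LINT x:box (- (real n *\<^sub>R One)) (real n *\<^sub>R One)|lborel. f x) \<longlonglongrightarrow> (LINT x|lborel. f x)"
      unfolding set_lebesgue_integral_def
    proof (rule integral_dominated_convergence[where w = "\<lambda>x. \<bar>f x\<bar>"])
      show "AE x in lborel. (\<lambda>n. indicat_real (box (- (real n *\<^sub>R One)) (real n *\<^sub>R One)) x *\<^sub>R f x) \<longlonglongrightarrow> f x"
      proof (rule AE_I2, rule tendsto_eventually)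
        fix x :: 'a
        obtain n0 where n0: "x \<in> box (- (real n0 *\<^sub>R One)) (real n0 *\<^sub>R One)"
          using UN_box_eq_UNIV by blast
        have "x \<in> box (- (real n *\<^sub>R One)) (real n *\<^sub>R One)" if "n0 \<le> n" for n
          using n0 that by (force simp: mem_box)
        then show "\<forall>\<^sub>F n in sequentially. indicat_real (box (- (real n *\<^sub>R One)) (real n *\<^sub>R One)) x *\<^sub>R f x = f x"
          by (auto simp: eventually_sequentially intro!: exI[of _ n0])
      qed
    qed (use f in \<open>auto split: split_indicator\<close>)
    then show ?thesis by (simp add: zero LIMSEQ_const_iff)
  qed
  have "(LINT x:A|lborel. f x) = 0" if "A \<in> sets borel" for A
  proof -
    have "Int_stable (range (\<lambda>(a, b). box a b :: 'a set))"
      by (auto simp: Int_stable_def box_Int_box)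
    moreover have "range (\<lambda>(a, b). box a b :: 'a set) \<subseteq> Pow UNIV" by simp
    moreover have "A \<in> sigma_sets UNIV (range (\<lambda>(a, b). box a b :: 'a set))"
      using that by (simp add: borel_eq_box)
    ultimately show ?thesis
    proof (induction rule: sigma_sets_induct_disjoint)
      case (compl A)
      then have A: "A \<in> sets borel" by (simp add: borel_eq_box)
      have "(LINT x:A \<union> (UNIV - A)|lborel. f x) = (LINT x:A|lborel. f x) + (LINT x:UNIV - A|lborel. f x)"
        using A by (intro set_integral_Un si) auto
      then show ?case using compl total by (simp add: set_lebesgue_integral_def)
    next
      case (union A)
      then have A: "A i \<in> sets borel" for i by (auto simp: borel_eq_box)
      have "(LINT x:(\<Union>i. A i)|lborel. f x) = (\<Sum>i. LINT x:A i|lborel. f x)"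
        using A union(1) by (intro lebesgue_integral_countable_add si) (auto simp: disjoint_family_on_def)
      then show ?case using union by simp
    qed (use zero in \<open>auto simp: set_lebesgue_integral_def\<close>)
  qed
  then show ?thesis
    using density_unique_real[OF f, of "\<lambda>x. 0"] by simp
qed

text \<open>A Borel representative, cut off by growing boxes, reduces local integrability to the
  integrable case, since the intersection of two boxes is again a box.\<close>

lemma zero_box_integrals_imp_AE_zero:
  fixes f :: "'a::euclidean_space \<Rightarrow> real"
  assumes f: "f \<in> borel_measurable lebesgue"
    and int: "\<And>a b. integrable lebesgue (\<lambda>x. indicator (box a b) x * f x)"
    and zero: "\<And>a b. (LINT x|lebesgue. indicator (box a b) x * f x) = 0"
  shows "AE x in lebesgue. f x = 0"
proof -
  obtain g where g: "g \<in> borel_measurable lborel" "AE x in lborel. f x = g x"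
    using completion_ex_borel_measurable_real[OF f] by auto
  have fg: "AE x in lebesgue. f x = g x" using g(2) by (rule AE_completion)
  have [measurable]: "f \<in> borel_measurable lebesgue" "g \<in> borel_measurable lebesgue"
    "box a b \<in> sets lebesgue" for a b :: 'a
    using f g by (auto intro: measurable_completion)
  have int': "integrable lborel (\<lambda>x. indicator (box a b) x * g x)" for a b
  proof -
    have "integrable lebesgue (\<lambda>x. indicator (box a b) x * g x)"
      using int[of a b] by (rule integrable_cong_AE_imp)
        (use fg in \<open>auto elim: eventually_mono\<close>)
    then show ?thesis using g by (subst (asm) integrable_completion) auto
  qed
  have zero': "(LINT x|lborel. indicator (box a b) x * g x) = 0" for a b
  proof -
    have "(LINT x|lborel. indicator (box a b) x * g x) = (LINT x|lebesgue. indicator (box a b) x * g x)"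
      using g by (subst integral_completion) auto
    also have "\<dots> = (LINT x|lebesgue. indicator (box a b) x * f x)"
      by (rule integral_cong_AE)
        (use fg in \<open>auto elim: eventually_mono\<close>)
    finally show ?thesis using zero by simp
  qed
  have "AE x in lborel. \<forall>n. indicator (box (- (real n *\<^sub>R One)) (real n *\<^sub>R One)) x * g x = 0"
    unfolding AE_all_countable
  proof (intro allI zero_box_integrals_imp_AE_zero_borel int')
    fix n :: nat and a b :: 'a
    obtain c d where cd: "box a b \<inter> box (- (real n *\<^sub>R One)) (real n *\<^sub>R One) = box c d"
      by (simp add: box_Int_box)
    show "(LINT x:box a b|lborel. indicator (box (- (real n *\<^sub>R One)) (real n *\<^sub>R One)) x * g x) = 0"
      using zero'[of c d] unfolding cd[symmetric]
      by (simp add: set_lebesgue_integral_def indicator_inter_arith mult.assoc)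
  qed
  then have "AE x in lborel. g x = 0"
  proof eventually_elim
    case (elim x)
    obtain n where "x \<in> box (- (real n *\<^sub>R One)) (real n *\<^sub>R One)" using UN_box_eq_UNIV by blast
    then show ?case using elim[rule_format, of n] by simp
  qed
  then have "AE x in lebesgue. g x = 0" by (rule AE_completion)
  with fg show ?thesis by eventually_elim simp
qed

section \<open>Completeness of the space of square integrable functions\<close>

lemma inner_L2_eq: "u \<bullet> v = (LINT x|lebesgue. L2_fun u x \<bullet> L2_fun v x)"
  by (simp add: inner_L2_def)

lemma norm_L2_sq: "(norm (u :: ('a::euclidean_space, 'b::euclidean_space) L2))\<^sup>2 =
    (LINT x|lebesgue. (norm (L2_fun u x))\<^sup>2)"
  by (simp add: inner_L2_eq power2_norm_eq_inner)

lemma L2_class_L2_fun [simp]: "L2_class (L2_fun u) = u"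
  by (rule Quotient3_abs_rep[OF Quotient3_L2])

lemma L2_class_eqI: "square_integrable f \<Longrightarrow> square_integrable g \<Longrightarrow> AE x in lebesgue. f x = g x \<Longrightarrow>
    L2_class f = L2_class g"
  by (rule Quotient3_rel_abs[OF Quotient3_L2]) (simp add: L2_rel_def)

lemma L2_class_add: "square_integrable f \<Longrightarrow> square_integrable g \<Longrightarrow>
    L2_class (\<lambda>x. f x + g x) = L2_class f + L2_class g"
  by (rule plus_L2.abs_eq[symmetric]) (simp_all add: L2_rel_def)

lemma L2_class_diff: "square_integrable f \<Longrightarrow> square_integrable g \<Longrightarrow>
    L2_class (\<lambda>x. f x - g x) = L2_class f - L2_class g"
  by (rule minus_L2.abs_eq[symmetric]) (simp_all add: L2_rel_def)

lemma L2_class_scaleR: "square_integrable f \<Longrightarrow> L2_class (\<lambda>x. r *\<^sub>R f x) = r *\<^sub>R L2_class f"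
  by (rule scaleR_L2.abs_eq[symmetric]) (simp_all add: L2_rel_def)

lemma L2_class_zero: "L2_class (\<lambda>x. 0) = 0"
  by (simp add: zero_L2_def)

lemma L2_fun_add: "AE x in lebesgue. L2_fun (u + v) x = L2_fun u x + L2_fun v x"
  using L2_fun_L2_class[OF square_integrable_add[OF square_integrable_L2_fun square_integrable_L2_fun]]
  by (simp add: L2_class_add square_integrable_L2_fun)

lemma L2_fun_diff: "AE x in lebesgue. L2_fun (u - v) x = L2_fun u x - L2_fun v x"
  using L2_fun_L2_class[OF square_integrable_diff[OF square_integrable_L2_fun square_integrable_L2_fun]]
  by (simp add: L2_class_diff square_integrable_L2_fun)

lemma L2_fun_scaleR: "AE x in lebesgue. L2_fun (r *\<^sub>R u) x = r *\<^sub>R L2_fun u x"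
  using L2_fun_L2_class[OF square_integrable_scaleR[OF square_integrable_L2_fun]]
  by (simp add: L2_class_scaleR square_integrable_L2_fun)

lemma L2_fun_measurable [measurable]: "L2_fun u \<in> borel_measurable lebesgue"
  by (rule square_integrable_measurable[OF square_integrable_L2_fun])

lemma inner_L2_class:
  assumes "square_integrable f"
  shows "u \<bullet> L2_class f = (LINT x|lebesgue. L2_fun u x \<bullet> f x)"
proof -
  note [measurable] = square_integrable_measurable[OF assms]
    square_integrable_measurable[OF square_integrable_L2_fun]
  show ?thesis
    unfolding inner_L2_eq
    by (rule integral_cong_AE) (use L2_fun_L2_class[OF assms] in \<open>auto elim: eventually_mono\<close>)
qed

lemma norm_L2_class_sq:
  assumes "square_integrable f"
  shows "(norm (L2_class f))\<^sup>2 = (LINT x|lebesgue. (norm (f x))\<^sup>2)"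
proof -
  note [measurable] = square_integrable_measurable[OF assms]
    square_integrable_measurable[OF square_integrable_L2_fun]
  show ?thesis
    unfolding norm_L2_sq
    by (rule integral_cong_AE) (use L2_fun_L2_class[OF assms] in \<open>auto elim: eventually_mono\<close>)
qed

lemma nn_integral_L2: "(\<integral>\<^sup>+x. ennreal ((norm (L2_fun u x))\<^sup>2) \<partial>lebesgue) = ennreal ((norm u)\<^sup>2)"
  unfolding norm_L2_sq
  by (rule nn_integral_eq_integral) (use square_integrable_L2_fun in \<open>auto simp: square_integrable_def\<close>)

text \<open>
  Riesz--Fischer: a rapidly converging subsequence converges almost everywhere, and Fatou's lemma
  identifies its limit in norm.
\<close>

lemma L2_Cauchy_convergent:
  fixes X :: "nat \<Rightarrow> ('a::euclidean_space, 'b::euclidean_space) L2"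
  assumes "Cauchy X"
  shows "convergent X"
proof -
  have "\<exists>M. \<forall>m\<ge>M. \<forall>n\<ge>M. norm (X m - X n) < (1 / 4) ^ k" for k :: nat
    using CauchyD[OF assms, of "(1 / 4) ^ k"] by simp
  then obtain M where M: "\<And>k m n. M k \<le> m \<Longrightarrow> M k \<le> n \<Longrightarrow> norm (X m - X n) < (1 / 4) ^ k"
    by metis
  \<comment> \<open>Partial sums make every later index pass all earlier thresholds.\<close>
  define r where "r = (\<lambda>k. \<Sum>i\<le>k. M i)"
  have r: "M k \<le> r j" if "k \<le> j" for k j
    using member_le_sum[of k "{..j}" M] that by (simp add: r_def)
  define f where "f = (\<lambda>k. L2_fun (X (r k)))"
  have f_meas[measurable]: "f k \<in> borel_measurable lebesgue" for k by (simp add: f_def)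
  have diff: "(\<integral>\<^sup>+x. ennreal ((norm (f j x - f k x))\<^sup>2) \<partial>lebesgue) \<le> ennreal ((1 / 16) ^ k)" if "k \<le> j" for k j
  proof -
    have "(\<integral>\<^sup>+x. ennreal ((norm (f j x - f k x))\<^sup>2) \<partial>lebesgue) =
        (\<integral>\<^sup>+x. ennreal ((norm (L2_fun (X (r j) - X (r k)) x))\<^sup>2) \<partial>lebesgue)"
      by (rule nn_integral_cong_AE) (use L2_fun_diff[of "X (r j)" "X (r k)"] in \<open>auto simp: f_def elim: eventually_mono\<close>)
    also have "\<dots> = ennreal ((norm (X (r j) - X (r k)))\<^sup>2)" by (rule nn_integral_L2)
    also have "\<dots> \<le> ennreal (((1 / 4) ^ k)\<^sup>2)"
      using M[OF r[OF that] r[OF order_refl]] by (intro ennreal_leI power_mono) auto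
    also have "((1 / 4) ^ k)\<^sup>2 = (1 / 16 :: real) ^ k"
      by (simp add: power2_eq_square flip: power_mult_distrib)
    finally show ?thesis .
  qed
  \<comment> \<open>The weight \<open>4 ^ k\<close> serves two ends: the integrals of the terms are
    still at most \<open>(1 / 4) ^ k\<close>, so \<open>S\<close> is finite almost everywhere, and
    finiteness forces increments of order \<open>(1 / 2) ^ k\<close>.\<close>
  define S where "S = (\<lambda>x. \<Sum>k. ennreal (4 ^ k * (norm (f (Suc k) x - f k x))\<^sup>2))"
  have "(\<integral>\<^sup>+x. S x \<partial>lebesgue) = (\<Sum>k. \<integral>\<^sup>+x. ennreal (4 ^ k * (norm (f (Suc k) x - f k x))\<^sup>2) \<partial>lebesgue)"
    unfolding S_def by (rule nn_integral_suminf) measurable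
  also have "\<dots> \<le> (\<Sum>k. ennreal ((1 / 4) ^ k))"
  proof (intro suminf_le summableI)
    fix k
    have "(\<integral>\<^sup>+x. ennreal (4 ^ k * (norm (f (Suc k) x - f k x))\<^sup>2) \<partial>lebesgue) =
        ennreal (4 ^ k) * (\<integral>\<^sup>+x. ennreal ((norm (f (Suc k) x - f k x))\<^sup>2) \<partial>lebesgue)"
      by (subst nn_integral_cmult[symmetric]) (auto simp: ennreal_mult)
    also have "\<dots> \<le> ennreal (4 ^ k) * ennreal ((1 / 16) ^ k)"
      by (intro mult_left_mono diff) auto
    also have "\<dots> = ennreal ((1 / 4) ^ k)"
      by (simp add: ennreal_mult[symmetric] power_mult_distrib[symmetric])
    finally show "(\<integral>\<^sup>+x. ennreal (4 ^ k * (norm (f (Suc k) x - f k x))\<^sup>2) \<partial>lebesgue) \<le> ennreal ((1 / 4) ^ k)" .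
  qed
  also have "\<dots> < \<infinity>"
    by (subst suminf_ennreal2) (auto intro!: summable_geometric)
  finally have "AE x in lebesgue. S x \<noteq> \<infinity>"
    by (intro nn_integral_noteq_infinite) (auto simp: S_def)
  then have conv: "AE x in lebesgue. convergent (\<lambda>k. f k x)"
  proof eventually_elim
    case (elim x)
    then obtain C where C: "0 \<le> C" "S x = ennreal C" by (cases "S x") auto
    have le: "norm (f (Suc k) x - f k x) \<le> sqrt C * (1 / 2) ^ k" for k
    proof -
      have "ennreal (4 ^ k * (norm (f (Suc k) x - f k x))\<^sup>2) \<le> S x"
        unfolding S_def by (rule order_trans[OF _ sum_le_suminf[of _ "{k}"]]) auto
      then have "4 ^ k * (norm (f (Suc k) x - f k x))\<^sup>2 \<le> C" using C by (simp add: ennreal_le_iff)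
      moreover have "(4::real) ^ k = (2 ^ k)\<^sup>2" by (simp add: power2_eq_square flip: power_mult_distrib)
      ultimately have "(2 ^ k * norm (f (Suc k) x - f k x))\<^sup>2 \<le> C" by (simp add: power_mult_distrib)
      then have "2 ^ k * norm (f (Suc k) x - f k x) \<le> sqrt C" by (rule real_le_rsqrt)
      then show ?thesis by (simp add: field_simps power_one_over)
    qed
    have "summable (\<lambda>k. f (Suc k) x - f k x)"
      by (rule summable_comparison_test[of _ "\<lambda>k. sqrt C * (1 / 2) ^ k"])
        (use le in \<open>auto intro!: summable_mult summable_geometric\<close>)
    then have "convergent (\<lambda>n. \<Sum>k<n. f (Suc k) x - f k x)"
      by (simp add: summable_iff_convergent)
    then have "convergent (\<lambda>n. (f n x - f 0 x) + f 0 x)"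
      unfolding sum_lessThan_telescope[of "\<lambda>k. f k x"] by (intro convergent_add convergent_const)
    then show ?case by simp
  qed
  define F where "F = (\<lambda>x. lim (\<lambda>k. f k x))"
  have F_meas[measurable]: "F \<in> borel_measurable lebesgue"
    unfolding F_def by (rule borel_measurable_lim_metric) simp
  have close: "(\<integral>\<^sup>+x. ennreal ((norm (F x - f k x))\<^sup>2) \<partial>lebesgue) \<le> ennreal ((1 / 16) ^ k)" for k
  proof -
    have "(\<integral>\<^sup>+x. ennreal ((norm (F x - f k x))\<^sup>2) \<partial>lebesgue) =
        (\<integral>\<^sup>+x. liminf (\<lambda>j. ennreal ((norm (f j x - f k x))\<^sup>2)) \<partial>lebesgue)"
    proof (rule nn_integral_cong_AE)
      show "AE x in lebesgue. ennreal ((norm (F x - f k x))\<^sup>2) = liminf (\<lambda>j. ennreal ((norm (f j x - f k x))\<^sup>2))"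
        using conv
      proof eventually_elim
        case (elim x)
        then have "(\<lambda>j. f j x) \<longlonglongrightarrow> F x" unfolding F_def by (simp add: convergent_LIMSEQ_iff)
        then have "(\<lambda>j. ennreal ((norm (f j x - f k x))\<^sup>2)) \<longlonglongrightarrow> ennreal ((norm (F x - f k x))\<^sup>2)"
          by (intro tendsto_ennrealI tendsto_intros)
        then show ?case by (rule lim_imp_Liminf[OF sequentially_bot, symmetric])
      qed
    qed
    also have "\<dots> \<le> liminf (\<lambda>j. \<integral>\<^sup>+x. ennreal ((norm (f j x - f k x))\<^sup>2) \<partial>lebesgue)"
      by (rule nn_integral_liminf) measurable
    also have "\<dots> \<le> liminf (\<lambda>j. ennreal ((1 / 16) ^ k))"
      by (rule Liminf_mono) (use diff in \<open>auto simp: eventually_sequentially\<close>)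
    finally show ?thesis by (simp add: Liminf_const)
  qed
  have sq: "square_integrable (\<lambda>x. F x - f k x)" for k
    unfolding square_integrable_def
  proof
    show "integrable lebesgue (\<lambda>x. (norm (F x - f k x))\<^sup>2)"
      using close[of k] by (intro integrableI_nonneg) (auto intro: le_less_trans)
  qed measurable
  have "square_integrable (\<lambda>x. (F x - f 0 x) + f 0 x)"
    by (intro square_integrable_add sq) (simp add: f_def square_integrable_L2_fun)
  then have sqF: "square_integrable F" by simp
  define L where "L = L2_class F"
  have near: "norm (L - X (r k)) \<le> (1 / 4) ^ k" for k
  proof -
    have "L - X (r k) = L2_class (\<lambda>x. F x - f k x)"
      unfolding L_def f_def by (subst L2_class_diff) (auto simp: sqF square_integrable_L2_fun)
    then have "(norm (L - X (r k)))\<^sup>2 = (LINT x|lebesgue. (norm (F x - f k x))\<^sup>2)"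
      by (simp add: norm_L2_class_sq[OF sq])
    moreover have "ennreal (LINT x|lebesgue. (norm (F x - f k x))\<^sup>2) \<le> ennreal ((1 / 16) ^ k)"
      using close[of k] sq[of k] by (subst nn_integral_eq_integral[symmetric]) (auto simp: square_integrable_def)
    ultimately have "(norm (L - X (r k)))\<^sup>2 \<le> (1 / 16) ^ k" by simp
    also have "(1 / 16 :: real) ^ k = ((1 / 4) ^ k)\<^sup>2"
      by (simp add: power2_eq_square flip: power_mult_distrib)
    finally show ?thesis by (rule power2_le_imp_le) simp
  qed
  have "X \<longlonglongrightarrow> L"
  proof (rule LIMSEQ_I)
    fix e :: real assume "0 < e"
    then obtain k where k: "(1 / 4 :: real) ^ k < e / 2"
      using real_arch_pow_inv[of "e / 2" "1 / 4"] by auto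
    have "norm (X n - L) < e" if "M k \<le> n" for n
    proof -
      have "norm (X n - L) \<le> norm (X n - X (r k)) + norm (L - X (r k))"
        using norm_triangle_ineq[of "X n - X (r k)" "X (r k) - L"] by (simp add: norm_minus_commute)
      then show ?thesis using M[OF that r[OF order_refl]] near[of k] k by linarith
    qed
    then show "\<exists>n0. \<forall>n\<ge>n0. norm (X n - L) < e" by blast
  qed
  then show ?thesis by (rule convergentI)
qed

section \<open>Weak gradients and Sobolev spaces\<close>

lemma square_integrable_test_function:
  assumes "test_function \<Omega> \<phi>"
  shows "square_integrable \<phi>" "square_integrable (\<lambda>x. \<phi> x *\<^sub>R axis i 1)"
    "square_integrable (\<lambda>x. \<chi> i. partial_deriv i \<phi> x)"
proof -
  show *: "square_integrable \<phi>" and "square_integrable (\<lambda>x. \<chi> i. partial_deriv i \<phi> x)"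
    by (rule lipschitz_gradient_square_integrable[OF test_function_lipschitz_gradient[OF assms]])+
  then show "square_integrable (\<lambda>x. \<phi> x *\<^sub>R axis i 1)"
    by (auto simp: square_integrable_def power_mult_distrib norm_axis_1)
qed

text \<open>As pairings with fixed elements of \<open>L2\<close>, the defining identities are linear
  and continuous in \<open>u\<close> and \<open>g\<close>, from which linearity and closedness of
  the weak gradient follow at once.\<close>

lemma weak_gradient_iff_inner:
  "weak_gradient u g \<longleftrightarrow> (\<forall>\<phi> i. test_function UNIV \<phi> \<longrightarrow>
     u \<bullet> L2_class (partial_deriv i \<phi>) = - (g \<bullet> L2_class (\<lambda>x. \<phi> x *\<^sub>R axis i 1)))"
  unfolding weak_gradient_def
  by (intro all_cong1 imp_cong refl)
    (simp add: inner_L2_class[OF square_integrable_test_function(1)[OF test_function_partial_deriv]]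
      inner_L2_class[OF square_integrable_test_function(2)] inner_axis mult.commute)

lemma weak_gradient_zero: "weak_gradient 0 0"
  by (simp add: weak_gradient_iff_inner)

lemma weak_gradient_add: "weak_gradient u g \<Longrightarrow> weak_gradient v h \<Longrightarrow> weak_gradient (u + v) (g + h)"
  by (simp add: weak_gradient_iff_inner inner_add_left)

lemma weak_gradient_scaleR: "weak_gradient u g \<Longrightarrow> weak_gradient (r *\<^sub>R u) (r *\<^sub>R g)"
  by (simp add: weak_gradient_iff_inner)

lemma weak_gradient_diff: "weak_gradient u g \<Longrightarrow> weak_gradient v h \<Longrightarrow> weak_gradient (u - v) (g - h)"
  by (simp add: weak_gradient_iff_inner inner_diff_left)

lemma weak_gradient_limit:
  assumes "\<And>n. weak_gradient (u n) (g n)" "u \<longlonglongrightarrow> v" "g \<longlonglongrightarrow> h"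
  shows "weak_gradient v h"
  unfolding weak_gradient_iff_inner
proof (intro allI impI)
  fix \<phi> :: "real^'a \<Rightarrow> real" and i
  assume \<phi>: "test_function UNIV \<phi>"
  have "(\<lambda>n. u n \<bullet> L2_class (partial_deriv i \<phi>)) \<longlonglongrightarrow> v \<bullet> L2_class (partial_deriv i \<phi>)"
    by (intro tendsto_intros assms)
  moreover have "(\<lambda>n. u n \<bullet> L2_class (partial_deriv i \<phi>)) = (\<lambda>n. - (g n \<bullet> L2_class (\<lambda>x. \<phi> x *\<^sub>R axis i 1)))"
    using assms(1) \<phi> by (simp add: weak_gradient_iff_inner)
  moreover have "(\<lambda>n. - (g n \<bullet> L2_class (\<lambda>x. \<phi> x *\<^sub>R axis i 1))) \<longlonglongrightarrow> - (h \<bullet> L2_class (\<lambda>x. \<phi> x *\<^sub>R axis i 1))"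
    by (intro tendsto_intros assms)
  ultimately show "v \<bullet> L2_class (partial_deriv i \<phi>) = - (h \<bullet> L2_class (\<lambda>x. \<phi> x *\<^sub>R axis i 1))"
    by (metis LIMSEQ_unique)
qed

text \<open>The components of \<open>g\<close> are orthogonal to all test functions, in particular
  to bumps tending to the indicator of a box; hence their box integrals vanish. This makes
  \<open>grad\<close> well defined.\<close>

lemma weak_gradient_0_imp_zero:
  assumes "weak_gradient 0 g"
  shows "g = 0"
proof -
  have sq: "square_integrable (L2_fun g)" by (rule square_integrable_L2_fun)
  have test: "(LINT x|lebesgue. L2_fun g x $ i * \<phi> x) = 0" if "test_function UNIV \<phi>" for \<phi> i
    using assms that inner_L2_class[OF square_integrable_test_function(2)[OF that], of g i]
    by (simp add: weak_gradient_iff_inner inner_axis mult.commute)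
  have "AE x in lebesgue. L2_fun g x $ i = 0" for i
  proof (rule zero_box_integrals_imp_AE_zero)
    show [measurable]: "(\<lambda>x. L2_fun g x $ i) \<in> borel_measurable lebesgue"
      using L2_fun_measurable by (rule measurable_compose) simp
    have [measurable]: "box a b \<in> sets lebesgue" for a b :: "real^'a" by simp
    \<comment> \<open>\<open>g\<close> is only square integrable; on the box, |g_i| <= 1 + |g|^2
      supplies an integrable majorant.\<close>
    have dom: "integrable lebesgue (\<lambda>x. indicator (box a b) x + (norm (L2_fun g x))\<^sup>2 :: real)" for a b
      using sq by (intro Bochner_Integration.integrable_add integrable_real_indicator)
        (auto simp: square_integrable_def emeasure_bounded_finite simp flip: infinity_ennreal_def)
    have bound: "\<bar>L2_fun g x $ i\<bar> \<le> 1 + (norm (L2_fun g x))\<^sup>2" for x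
    proof -
      have "\<bar>L2_fun g x $ i\<bar> \<le> norm (L2_fun g x)" by (rule component_le_norm_cart)
      also have "\<dots> \<le> 1 + (norm (L2_fun g x))\<^sup>2"
        using sum_squares_bound[of 1 "norm (L2_fun g x)"] norm_ge_zero[of "L2_fun g x"] by (simp, linarith)
      finally show ?thesis .
    qed
    fix a b
    show "integrable lebesgue (\<lambda>x. indicator (box a b) x * L2_fun g x $ i)"
      by (rule Bochner_Integration.integrable_bound[OF dom[of a b]])
        (use bound in \<open>auto split: split_indicator\<close>)
    have tf: "test_function UNIV (box_bump (real (Suc n)) a b)" for n
      by (rule test_function_box_bump) auto
    have "(\<lambda>n. LINT x|lebesgue. L2_fun g x $ i * box_bump (real (Suc n)) a b x) \<longlonglongrightarrow>
        (LINT x|lebesgue. L2_fun g x $ i * indicator (box a b) x)"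
    proof (rule integral_dominated_convergence[OF _ _ dom[of a b]])
      show "(\<lambda>x. L2_fun g x $ i * box_bump (real (Suc n)) a b x) \<in> borel_measurable lebesgue" for n
        using square_integrable_measurable[OF square_integrable_test_function(1)[OF tf[of n]]] by measurable
      show "AE x in lebesgue. (\<lambda>n. L2_fun g x $ i * box_bump (real (Suc n)) a b x) \<longlonglongrightarrow>
          L2_fun g x $ i * indicator (box a b) x"
        by (intro AE_I2 tendsto_mult tendsto_const tendsto_box_bump)
      show "AE x in lebesgue. norm (L2_fun g x $ i * box_bump (real (Suc n)) a b x) \<le>
          indicator (box a b) x + (norm (L2_fun g x))\<^sup>2" for n
      proof (rule AE_I2)
        fix x
        show "norm (L2_fun g x $ i * box_bump (real (Suc n)) a b x) \<le> indicator (box a b) x + (norm (L2_fun g x))\<^sup>2"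
        proof (cases "x \<in> box a b")
          case True
          have "\<bar>L2_fun g x $ i\<bar> * box_bump (real (Suc n)) a b x \<le> \<bar>L2_fun g x $ i\<bar> * 1"
            by (intro mult_left_mono box_bump_bounds) auto
          then show ?thesis using True bound[of x] box_bump_bounds(1)[of "real (Suc n)" a b x]
            by (simp add: abs_mult)
        next
          case False
          then have "box_bump (real (Suc n)) a b x = 0"
            using box_bump_nonzero[of "real (Suc n)" a b x] by auto
          then show ?thesis by simp
        qed
      qed
    qed measurable
    then show "(LINT x|lebesgue. indicator (box a b) x * L2_fun g x $ i) = 0"
      by (simp add: test[OF tf] LIMSEQ_const_iff mult.commute del: of_nat_Suc)
  qed
  then have "AE x in lebesgue. \<forall>i. L2_fun g x $ i = 0" by (simp add: AE_all_countable)
  then have "AE x in lebesgue. L2_fun g x = 0" by eventually_elim (simp add: vec_eq_iff)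
  then have "L2_class (L2_fun g) = L2_class (\<lambda>x. 0)"
    by (intro L2_class_eqI square_integrable_L2_fun square_integrable_zero)
  then show ?thesis by (simp add: L2_class_zero)
qed

lemma grad_eq:
  assumes "weak_gradient u g"
  shows "grad u = g"
  unfolding grad_def
proof (rule the_equality)
  fix g' assume "weak_gradient u g'"
  then have "weak_gradient (u - u) (g' - g)" using assms by (rule weak_gradient_diff)
  then show "g' = g" using weak_gradient_0_imp_zero by fastforce
qed (rule assms)

lemma weak_gradient_grad: "u \<in> H1 \<Longrightarrow> weak_gradient u (grad u)"
  unfolding H1_def using grad_eq by auto

lemma H1I: "weak_gradient u g \<Longrightarrow> u \<in> H1"
  by (auto simp: H1_def)

lemma grad_ops:
  "u \<in> H1 \<Longrightarrow> v \<in> H1 \<Longrightarrow> grad (u + v) = grad u + grad v"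
  "u \<in> H1 \<Longrightarrow> v \<in> H1 \<Longrightarrow> grad (u - v) = grad u - grad v"
  "u \<in> H1 \<Longrightarrow> grad (r *\<^sub>R u) = r *\<^sub>R grad u"
  by (rule grad_eq, (rule weak_gradient_add weak_gradient_diff weak_gradient_scaleR)?;
      erule weak_gradient_grad)+

lemma lipschitz_gradient_weak_gradient:
  assumes "lipschitz_gradient f g"
  shows "weak_gradient (L2_class f) (L2_class g)"
  unfolding weak_gradient_def
proof (intro allI impI)
  fix \<phi> :: "real^'a \<Rightarrow> real" and i
  assume \<phi>: "test_function UNIV \<phi>"
  note sq = lipschitz_gradient_square_integrable[OF assms]
  note sq\<phi> = square_integrable_test_function[OF \<phi>]
  have [measurable]: "\<phi> \<in> borel_measurable lebesgue" "partial_deriv i \<phi> \<in> borel_measurable lebesgue"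
    "f \<in> borel_measurable lebesgue"
    by (intro square_integrable_measurable sq sq\<phi>
        square_integrable_test_function(1)[OF test_function_partial_deriv[OF \<phi>]])+
  have [measurable]: "(\<lambda>x. g x $ i) \<in> borel_measurable lebesgue"
    by (rule measurable_compose[OF square_integrable_measurable[OF sq(2)]]) simp
  have [measurable]: "(\<lambda>x. L2_fun (L2_class g) x $ i) \<in> borel_measurable lebesgue"
    by (rule measurable_compose[OF L2_fun_measurable]) simp
  have "(LINT x|lebesgue. L2_fun (L2_class f) x * partial_deriv i \<phi> x) = (LINT x|lebesgue. f x * partial_deriv i \<phi> x)"
  proof (rule integral_cong_AE)
    show "AE x in lebesgue. L2_fun (L2_class f) x * partial_deriv i \<phi> x = f x * partial_deriv i \<phi> x"
      using L2_fun_L2_class[OF sq(1)] by eventually_elim simp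
  qed measurable
  moreover have "(LINT x|lebesgue. L2_fun (L2_class g) x $ i * \<phi> x) = (LINT x|lebesgue. g x $ i * \<phi> x)"
  proof (rule integral_cong_AE)
    show "(\<lambda>x. L2_fun (L2_class g) x $ i * \<phi> x) \<in> borel_measurable lebesgue"
      "(\<lambda>x. g x $ i * \<phi> x) \<in> borel_measurable lebesgue" by measurable
    show "AE x in lebesgue. L2_fun (L2_class g) x $ i * \<phi> x = g x $ i * \<phi> x"
      using L2_fun_L2_class[OF sq(2)] by eventually_elim simp
  qed
  ultimately show "(LINT x|lebesgue. L2_fun (L2_class f) x * partial_deriv i \<phi> x) =
      - (LINT x|lebesgue. L2_fun (L2_class g) x $ i * \<phi> x)"
    using lipschitz_gradient_by_parts[OF assms \<phi>] by simp
qed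

section \<open>H_0^1 as a closed space of limits of test functions\<close>

definition test_gradient :: "(real^'n::finite \<Rightarrow> real) \<Rightarrow> (real^'n, real^'n) L2" where
  "test_gradient \<phi> = L2_class (\<lambda>x. \<chi> i. partial_deriv i \<phi> x)"

lemma weak_gradient_test_function: "test_function \<Omega> \<phi> \<Longrightarrow> weak_gradient (L2_class \<phi>) (test_gradient \<phi>)"
  unfolding test_gradient_def
  by (rule lipschitz_gradient_weak_gradient[OF test_function_lipschitz_gradient])

text \<open>Splits the H^1 norm into two estimates and replaces \<open>grad\<close> by a witness, so
  that membership can be proved from an explicit candidate for the gradient.\<close>

lemma H01_iff:
  "u \<in> H01 \<Omega> \<longleftrightarrow> (\<exists>g. weak_gradient u g \<and> (\<forall>\<epsilon>>0. \<exists>\<phi>. test_function \<Omega> \<phi> \<and>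
     norm (u - L2_class \<phi>) < \<epsilon> \<and> norm (g - test_gradient \<phi>) < \<epsilon>))"
proof -
  have eq: "H1_norm (u - L2_class \<phi>) = sqrt ((norm (u - L2_class \<phi>))\<^sup>2 + (norm (g - test_gradient \<phi>))\<^sup>2)"
    if "weak_gradient u g" "test_function \<Omega> \<phi>" for g \<phi>
    using that by (simp add: H1_norm_def grad_eq[OF weak_gradient_diff[OF _ weak_gradient_test_function]])
  show ?thesis
  proof
    assume u: "u \<in> H01 \<Omega>"
    then have wg: "weak_gradient u (grad u)" by (simp add: H01_def weak_gradient_grad)
    show "\<exists>g. weak_gradient u g \<and> (\<forall>\<epsilon>>0. \<exists>\<phi>. test_function \<Omega> \<phi> \<and>
     norm (u - L2_class \<phi>) < \<epsilon> \<and> norm (g - test_gradient \<phi>) < \<epsilon>)"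
    proof (intro exI[of _ "grad u"] conjI allI impI wg)
      fix \<epsilon> :: real assume "0 < \<epsilon>"
      then obtain \<phi> where \<phi>: "test_function \<Omega> \<phi>" "H1_norm (u - L2_class \<phi>) < \<epsilon>"
        using u by (auto simp: H01_def)
      then show "\<exists>\<phi>. test_function \<Omega> \<phi> \<and> norm (u - L2_class \<phi>) < \<epsilon> \<and> norm (grad u - test_gradient \<phi>) < \<epsilon>"
        using real_sqrt_sum_squares_ge1[of "norm (u - L2_class \<phi>)" "norm (grad u - test_gradient \<phi>)"]
          real_sqrt_sum_squares_ge2[of "norm (grad u - test_gradient \<phi>)" "norm (u - L2_class \<phi>)"]
        unfolding eq[OF wg \<phi>(1)] by (intro exI[of _ \<phi>]) linarith
    qed
  next
    assume "\<exists>g. weak_gradient u g \<and> (\<forall>\<epsilon>>0. \<exists>\<phi>. test_function \<Omega> \<phi> \<and>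
     norm (u - L2_class \<phi>) < \<epsilon> \<and> norm (g - test_gradient \<phi>) < \<epsilon>)"
    then obtain g where wg: "weak_gradient u g" and approx: "\<And>\<epsilon>. 0 < \<epsilon> \<Longrightarrow> \<exists>\<phi>. test_function \<Omega> \<phi> \<and>
     norm (u - L2_class \<phi>) < \<epsilon> \<and> norm (g - test_gradient \<phi>) < \<epsilon>" by blast
    have "\<exists>\<phi>. test_function \<Omega> \<phi> \<and> H1_norm (u - L2_class \<phi>) < \<epsilon>" if \<epsilon>: "0 < \<epsilon>" for \<epsilon>
    proof -
      obtain \<phi> where \<phi>: "test_function \<Omega> \<phi>" "norm (u - L2_class \<phi>) < \<epsilon> / 2" "norm (g - test_gradient \<phi>) < \<epsilon> / 2"
        using approx[OF half_gt_zero[OF \<epsilon>]] by blast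
      have "sqrt ((norm (u - L2_class \<phi>))\<^sup>2 + (norm (g - test_gradient \<phi>))\<^sup>2) \<le>
          norm (u - L2_class \<phi>) + norm (g - test_gradient \<phi>)"
        by (rule sqrt_sum_squares_le_sum) auto
      then show ?thesis using \<phi> by (intro exI[of _ \<phi>]) (auto simp: eq[OF wg])
    qed
    then show "u \<in> H01 \<Omega>" using wg by (auto simp: H01_def intro: H1I)
  qed
qed

lemma H01_approx:
  assumes u: "u \<in> H01 \<Omega>" and "0 < \<epsilon>"
  obtains \<phi> where "test_function \<Omega> \<phi>" "norm (u - L2_class \<phi>) < \<epsilon>" "norm (grad u - test_gradient \<phi>) < \<epsilon>"
proof -
  from u obtain g where g: "weak_gradient u g" "\<And>\<epsilon>. 0 < \<epsilon> \<Longrightarrow> \<exists>\<phi>. test_function \<Omega> \<phi> \<and>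
     norm (u - L2_class \<phi>) < \<epsilon> \<and> norm (g - test_gradient \<phi>) < \<epsilon>"
    unfolding H01_iff by blast
  show ?thesis
    using g(2)[OF \<open>0 < \<epsilon>\<close>] that grad_eq[OF g(1)] by blast
qed

lemma H01_H1: "u \<in> H01 \<Omega> \<Longrightarrow> u \<in> H1"
  by (simp add: H01_def)

lemma H01_mono: "\<Omega> \<subseteq> \<Omega>' \<Longrightarrow> H01 \<Omega> \<subseteq> H01 \<Omega>'"
  unfolding H01_def using test_function_mono by blast

lemma test_gradient_add:
  assumes \<phi>: "test_function \<Omega> \<phi>" and \<psi>: "test_function \<Omega> \<psi>"
  shows "test_gradient (\<lambda>x. \<phi> x + \<psi> x) = test_gradient \<phi> + test_gradient \<psi>"
  using grad_eq[OF weak_gradient_test_function[OF test_function_add[OF \<phi> \<psi>]]]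
    grad_eq[OF weak_gradient_add[OF weak_gradient_test_function[OF \<phi>] weak_gradient_test_function[OF \<psi>]]]
    L2_class_add[OF square_integrable_test_function(1)[OF \<phi>] square_integrable_test_function(1)[OF \<psi>]]
  by simp

lemma test_gradient_cmult:
  assumes "test_function \<Omega> \<phi>"
  shows "test_gradient (\<lambda>x. r * \<phi> x) = r *\<^sub>R test_gradient \<phi>"
proof -
  have "L2_class (\<lambda>x. r * \<phi> x) = r *\<^sub>R L2_class \<phi>"
    using L2_class_scaleR[OF square_integrable_test_function(1)[OF assms], of r] by simp
  then show ?thesis
    using grad_eq[OF weak_gradient_test_function[OF test_function_cmult[OF assms, of r]]]
      grad_eq[OF weak_gradient_scaleR[OF weak_gradient_test_function[OF assms], of r]] by simp
qed

lemma subspace_H01: "subspace (H01 \<Omega>)"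
proof (rule subspaceI)
  have "test_gradient (\<lambda>x. 0) = (0 :: (real^'a, real^'a) L2)"
    using grad_eq[OF weak_gradient_test_function[OF test_function_zero]] grad_eq[OF weak_gradient_zero]
    by (metis L2_class_zero)
  then show "0 \<in> H01 \<Omega>"
    unfolding H01_iff
    by (intro exI[of _ 0] conjI weak_gradient_zero allI impI exI[of _ "\<lambda>x. 0"])
      (auto simp: test_function_zero L2_class_zero)
next
  fix u v assume uv: "u \<in> H01 \<Omega>" "v \<in> H01 \<Omega>"
  show "u + v \<in> H01 \<Omega>"
    unfolding H01_iff
  proof (intro exI[of _ "grad u + grad v"] conjI allI impI)
    show "weak_gradient (u + v) (grad u + grad v)"
      using uv by (intro weak_gradient_add weak_gradient_grad H01_H1)
    fix e :: real assume "0 < e"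
    then have "0 < e / 2" by simp
    from H01_approx[OF uv(1) this] obtain \<phi> where \<phi>: "test_function \<Omega> \<phi>"
      "norm (u - L2_class \<phi>) < e / 2" "norm (grad u - test_gradient \<phi>) < e / 2" .
    from H01_approx[OF uv(2) \<open>0 < e / 2\<close>] obtain \<psi> where \<psi>: "test_function \<Omega> \<psi>"
      "norm (v - L2_class \<psi>) < e / 2" "norm (grad v - test_gradient \<psi>) < e / 2" .
    have "norm (u + v - (L2_class \<phi> + L2_class \<psi>)) < e"
      using norm_triangle_ineq[of "u - L2_class \<phi>" "v - L2_class \<psi>"] \<phi> \<psi> by (simp add: algebra_simps)
    moreover have "norm (grad u + grad v - (test_gradient \<phi> + test_gradient \<psi>)) < e"
      using norm_triangle_ineq[of "grad u - test_gradient \<phi>" "grad v - test_gradient \<psi>"] \<phi> \<psi>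
      by (simp add: algebra_simps)
    ultimately show "\<exists>\<phi>. test_function \<Omega> \<phi> \<and> norm (u + v - L2_class \<phi>) < e \<and>
        norm (grad u + grad v - test_gradient \<phi>) < e"
      using \<phi>(1) \<psi>(1)
      by (intro exI[of _ "\<lambda>x. \<phi> x + \<psi> x"])
        (simp add: test_function_add test_gradient_add L2_class_add square_integrable_test_function)
  qed
next
  fix r :: real and u assume u: "u \<in> H01 \<Omega>"
  show "r *\<^sub>R u \<in> H01 \<Omega>"
    unfolding H01_iff
  proof (intro exI[of _ "r *\<^sub>R grad u"] conjI allI impI)
    show "weak_gradient (r *\<^sub>R u) (r *\<^sub>R grad u)"
      using u by (intro weak_gradient_scaleR weak_gradient_grad H01_H1)
    fix e :: real assume "0 < e"
    \<comment> \<open>The summand 1 avoids a division by zero for \<open>r = 0\<close>.\<close>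
    then have e: "0 < e / (\<bar>r\<bar> + 1)" by simp
    from H01_approx[OF u this] obtain \<phi> where \<phi>: "test_function \<Omega> \<phi>"
      "norm (u - L2_class \<phi>) < e / (\<bar>r\<bar> + 1)" "norm (grad u - test_gradient \<phi>) < e / (\<bar>r\<bar> + 1)" .
    have scale: "norm (r *\<^sub>R x - r *\<^sub>R y) < e" if "norm (x - y) < e / (\<bar>r\<bar> + 1)"
      for x y :: "'x::real_normed_vector"
    proof -
      have "norm (r *\<^sub>R x - r *\<^sub>R y) = \<bar>r\<bar> * norm (x - y)" by (simp flip: scaleR_diff_right)
      also have "\<dots> \<le> (\<bar>r\<bar> + 1) * norm (x - y)" by (simp add: mult_right_mono)
      also have "\<dots> < e" using that by (simp add: field_simps add_pos_nonneg)
      finally show ?thesis .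
    qed
    have "L2_class (\<lambda>x. r * \<phi> x) = r *\<^sub>R L2_class \<phi>"
      using L2_class_scaleR[OF square_integrable_test_function(1)[OF \<phi>(1)], of r] by simp
    then show "\<exists>\<phi>. test_function \<Omega> \<phi> \<and> norm (r *\<^sub>R u - L2_class \<phi>) < e \<and> norm (r *\<^sub>R grad u - test_gradient \<phi>) < e"
      using \<phi> scale[OF \<phi>(2)] scale[OF \<phi>(3)]
      by (intro exI[of _ "\<lambda>x. r * \<phi> x"]) (simp add: test_function_cmult test_gradient_cmult)
  qed
qed

text \<open>\<open>weak_gradient_limit\<close> identifies the gradient of the limit; an approximant
  of a close \<open>u n\<close> approximates \<open>v\<close>. This serves both the completeness of
  the energy space and the limit in \<open>piecewise_affine_H01\<close>.\<close>

lemma H01_limit: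
  assumes "\<And>n. u n \<in> H01 \<Omega>" "u \<longlonglongrightarrow> v" "(\<lambda>n. grad (u n)) \<longlonglongrightarrow> h"
  shows "v \<in> H01 \<Omega>" "grad v = h"
proof -
  have wg: "weak_gradient v h"
    using assms by (intro weak_gradient_limit[OF weak_gradient_grad]) (auto intro: H01_H1)
  then show "grad v = h" by (rule grad_eq)
  show "v \<in> H01 \<Omega>"
    unfolding H01_iff
  proof (intro exI[of _ h] conjI wg allI impI)
    fix e :: real assume "0 < e"
    then have e: "0 < e / 2" by simp
    from LIMSEQ_D[OF assms(2) e] LIMSEQ_D[OF assms(3) e] obtain n where
      n: "norm (u n - v) < e / 2" "norm (grad (u n) - h) < e / 2"
      by (meson nat_le_linear order_refl)
    from H01_approx[OF assms(1) e, of n] obtain \<phi> where \<phi>: "test_function \<Omega> \<phi>"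
      "norm (u n - L2_class \<phi>) < e / 2" "norm (grad (u n) - test_gradient \<phi>) < e / 2" .
    have "norm (v - L2_class \<phi>) < e"
      using norm_triangle_ineq4[of "u n - L2_class \<phi>" "u n - v"] n \<phi> by simp
    moreover have "norm (h - test_gradient \<phi>) < e"
      using norm_triangle_ineq4[of "grad (u n) - test_gradient \<phi>" "grad (u n) - h"] n \<phi> by simp
    ultimately show "\<exists>\<phi>. test_function \<Omega> \<phi> \<and> norm (v - L2_class \<phi>) < e \<and> norm (h - test_gradient \<phi>) < e"
      using \<phi>(1) by blast
  qed
qed

section \<open>Poincare inequality and the energy form\<close>

lemma Ck_coord: "Ck k (\<lambda>x :: real^'n::finite. x $ i)"
proof (cases k)
  case (Suc k)
  have D: "((\<lambda>x :: real^'n. x $ i) has_derivative (\<lambda>h. h $ i)) (at x)" for x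
    by (intro bounded_linear_imp_has_derivative bounded_linear_vec_nth)
  have "partial_deriv j (\<lambda>x :: real^'n. x $ i) = (\<lambda>x. if i = j then 1 else 0)" for j
    by (rule ext, subst partial_deriv_eq[OF D]) (auto simp: axis_def)
  then show ?thesis using D by (auto simp: Suc Ck_const intro: differentiableI)
qed (auto intro: continuous_intros)

lemma inner_L2_class_class:
  assumes "square_integrable f" "square_integrable g"
  shows "L2_class f \<bullet> L2_class g = (LINT x|lebesgue. f x \<bullet> g x)"
proof -
  note [measurable] = assms[THEN square_integrable_measurable]
  have "(LINT x|lebesgue. L2_fun (L2_class f) x \<bullet> g x) = (LINT x|lebesgue. f x \<bullet> g x)"
  proof (rule integral_cong_AE)
    show "AE x in lebesgue. L2_fun (L2_class f) x \<bullet> g x = f x \<bullet> g x"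
      using L2_fun_L2_class[OF assms(1)] by eventually_elim simp
  qed measurable
  then show ?thesis by (simp add: inner_L2_class[OF assms(2)])
qed

text \<open>Integration by parts of \<open>\<phi>\<^sup>2 \<partial>\<^sub>i x\<^sub>i\<close>.\<close>

lemma poincare_test_function:
  fixes \<Omega> :: "(real^'n::finite) set"
  assumes \<phi>: "test_function \<Omega> \<phi>" and R: "\<Omega> \<subseteq> cball 0 R" "0 \<le> R"
  shows "norm (L2_class \<phi>) \<le> 2 * R * norm (test_gradient \<phi>)"
proof -
  \<comment> \<open>Any fixed coordinate direction will do.\<close>
  define i where "i = (undefined :: 'n)"
  define \<psi> where "\<psi> = (\<lambda>x. x $ i * \<phi> x)"
  define \<xi> where "\<xi> = (\<lambda>x. x $ i * partial_deriv i \<phi> x)"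
  have \<psi>: "test_function \<Omega> \<psi>" and \<xi>: "test_function \<Omega> \<xi>"
    unfolding \<psi>_def \<xi>_def by (intro test_function_mult test_function_partial_deriv \<phi> Ck_coord)+
  note sq = square_integrable_test_function(1)
  have int: "integrable lebesgue (\<lambda>x. \<xi> x * \<phi> x)" "integrable lebesgue (\<lambda>x. \<phi> x * \<phi> x)"
    using square_integrable_inner[OF sq[OF \<xi>] sq[OF \<phi>]] square_integrable_inner[OF sq[OF \<phi>] sq[OF \<phi>]] by auto
  have "(\<lambda>x :: real^'n. x $ i) differentiable at x" for x
    using Ck_coord[of 1 i] by auto
  moreover have "partial_deriv i (\<lambda>x. x $ i) x = 1" for x :: "real^'n"
    by (subst partial_deriv_eq[OF bounded_linear_imp_has_derivative[OF bounded_linear_vec_nth]]) simp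
  ultimately have "partial_deriv i \<psi> x = \<xi> x + \<phi> x" for x
    unfolding \<psi>_def \<xi>_def by (subst partial_deriv_mult) (auto simp: test_functionD(2)[OF \<phi>])
  then have "(LINT x|lebesgue. \<psi> x * partial_deriv i \<phi> x) = - (LINT x|lebesgue. (\<xi> x + \<phi> x) * \<phi> x)"
    using lipschitz_gradient_by_parts[OF test_function_lipschitz_gradient[OF \<psi>] test_function_mono[OF \<phi> subset_UNIV], of i]
    by simp
  \<comment> \<open>The left-hand integral is again that of \<xi> \<phi>; collecting its two copies
    produces the factor 2.\<close>
  also have "(\<lambda>x. \<psi> x * partial_deriv i \<phi> x) = (\<lambda>x. \<xi> x * \<phi> x)"
    by (simp add: \<psi>_def \<xi>_def mult_ac)
  finally have "(LINT x|lebesgue. \<phi> x * \<phi> x) = - 2 * (LINT x|lebesgue. \<xi> x * \<phi> x)"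
    using int by (simp add: distrib_right)
  then have "L2_class \<phi> \<bullet> L2_class \<phi> = - 2 * (L2_class \<xi> \<bullet> L2_class \<phi>)"
    by (simp add: inner_L2_class_class sq[OF \<phi>] sq[OF \<xi>])
  then have "(norm (L2_class \<phi>))\<^sup>2 = - 2 * (L2_class \<xi> \<bullet> L2_class \<phi>)"
    by (simp add: power2_norm_eq_inner)
  also have "\<dots> \<le> 2 * (norm (L2_class \<xi>) * norm (L2_class \<phi>))"
    using Cauchy_Schwarz_ineq2[of "L2_class \<xi>" "L2_class \<phi>"] by linarith
  finally have le: "norm (L2_class \<phi>) * norm (L2_class \<phi>) \<le> (2 * norm (L2_class \<xi>)) * norm (L2_class \<phi>)"
    by (simp add: power2_eq_square)
  have "norm (L2_class \<phi>) \<le> 2 * norm (L2_class \<xi>)"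
  proof (cases "norm (L2_class \<phi>) = 0")
    case False
    then have "0 < norm (L2_class \<phi>)" by simp
    with le show ?thesis by (rule mult_right_le_imp_le)
  qed simp
  also have "norm (L2_class \<xi>) \<le> R * norm (test_gradient \<phi>)"
  proof (rule power2_le_imp_le)
    let ?g = "\<lambda>x. \<chi> i. partial_deriv i \<phi> x"
    have sqg: "square_integrable ?g" by (rule square_integrable_test_function[OF \<phi>])
    have "(norm (L2_class \<xi>))\<^sup>2 = (LINT x|lebesgue. (norm (\<xi> x))\<^sup>2)"
      by (rule norm_L2_class_sq[OF sq[OF \<xi>]])
    also have "\<dots> \<le> (LINT x|lebesgue. R\<^sup>2 * (norm (?g x))\<^sup>2)"
    proof (rule integral_mono)
      show "integrable lebesgue (\<lambda>x. (norm (\<xi> x))\<^sup>2)" using sq[OF \<xi>] by (simp add: square_integrable_def)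
      show "integrable lebesgue (\<lambda>x. R\<^sup>2 * (norm (?g x))\<^sup>2)" using sqg by (simp add: square_integrable_def)
      fix x
      have "norm (\<xi> x) \<le> R * norm (?g x)"
      proof (cases "x \<in> \<Omega>")
        case True
        then have "\<bar>x $ i\<bar> \<le> R" using R component_le_norm_cart[of x i] by auto
        moreover have "\<bar>partial_deriv i \<phi> x\<bar> \<le> norm (?g x)" using component_le_norm_cart[of "?g x" i] by simp
        ultimately show ?thesis unfolding \<xi>_def by (auto simp: abs_mult intro: mult_mono)
      next
        case False
        then have "\<xi> x = 0" using test_function_zero_outside[OF \<xi>] by simp
        then show ?thesis using R by simp
      qed
      then show "(norm (\<xi> x))\<^sup>2 \<le> R\<^sup>2 * (norm (?g x))\<^sup>2"
        using power_mono[of "norm (\<xi> x)" "R * norm (?g x)" 2] by (simp add: power_mult_distrib)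
    qed
    also have "\<dots> = (R * norm (test_gradient \<phi>))\<^sup>2"
      by (simp add: test_gradient_def norm_L2_class_sq[OF sqg] power_mult_distrib)
    finally show "(norm (L2_class \<xi>))\<^sup>2 \<le> (R * norm (test_gradient \<phi>))\<^sup>2" .
  qed (use R in simp)
  finally show ?thesis by simp
qed

lemma poincare:
  assumes u: "u \<in> H01 \<Omega>" and R: "\<Omega> \<subseteq> cball 0 R" "0 \<le> R"
  shows "norm u \<le> 2 * R * norm (grad u)"
proof (rule field_le_epsilon)
  fix e :: real assume "0 < e"
  \<comment> \<open>The tolerance enters once through \<open>u\<close> and \<open>2 * R\<close>
    times through the gradient.\<close>
  then have e: "0 < e / (2 * R + 1)" using R by simp
  from H01_approx[OF u this] obtain \<phi> where \<phi>: "test_function \<Omega> \<phi>" "norm (u - L2_class \<phi>) < e / (2 * R + 1)"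
    "norm (grad u - test_gradient \<phi>) < e / (2 * R + 1)" .
  have "norm u \<le> norm (L2_class \<phi>) + norm (u - L2_class \<phi>)"
    using norm_triangle_ineq[of "L2_class \<phi>" "u - L2_class \<phi>"] by simp
  also have "\<dots> \<le> 2 * R * norm (test_gradient \<phi>) + e / (2 * R + 1)"
    using poincare_test_function[OF \<phi>(1) R] \<phi>(2) by simp
  also have "norm (test_gradient \<phi>) \<le> norm (grad u) + e / (2 * R + 1)"
    using norm_triangle_ineq4[of "grad u" "grad u - test_gradient \<phi>"] \<phi>(3) by simp
  then have "2 * R * norm (test_gradient \<phi>) \<le> 2 * R * (norm (grad u) + e / (2 * R + 1))"
    using R by (intro mult_left_mono) auto
  also have "2 * R * (norm (grad u) + e / (2 * R + 1)) + e / (2 * R + 1) = 2 * R * norm (grad u) + e"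
    using R by (simp add: field_simps add_nonneg_eq_0_iff)
  finally show "norm u \<le> 2 * R * norm (grad u) + e" by simp
qed

text \<open>The gradients of test functions on \<Omega> vanish outside \<Omega>, and this survives
  the limit in \<open>L2\<close>. It reconciles \<open>bilinear_form\<close>, an integral over
  \<Omega>, with \<open>norm (grad u)\<close>, an integral over the whole space.\<close>

lemma grad_zero_outside:
  assumes u: "u \<in> H01 \<Omega>" and \<Omega>: "\<Omega> \<in> sets lebesgue"
  shows "AE x in lebesgue. x \<notin> \<Omega> \<longrightarrow> L2_fun (grad u) x = 0"
proof -
  note [measurable] = \<Omega> L2_fun_measurable
  define I where "I = (LINT x|lebesgue. indicator (- \<Omega>) x * (norm (L2_fun (grad u) x))\<^sup>2)"
  have sqn: "integrable lebesgue (\<lambda>x. (norm (L2_fun v x))\<^sup>2)" for v :: "(real^'a, real^'a) L2"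
    using square_integrable_L2_fun[of v] by (simp add: square_integrable_def)
  have int: "integrable lebesgue (\<lambda>x. indicator (- \<Omega>) x * (norm (L2_fun (grad u) x))\<^sup>2)"
    by (rule Bochner_Integration.integrable_bound[OF sqn[of "grad u"]]) (auto split: split_indicator)
  have "I \<le> e" if "0 < e" for e
  proof -
    have "0 < sqrt e" using that by simp
    from H01_approx[OF u this] obtain \<phi> where \<phi>: "test_function \<Omega> \<phi>" "norm (grad u - test_gradient \<phi>) < sqrt e" .
    let ?g = "\<lambda>x. \<chi> i. partial_deriv i \<phi> x"
    have "I \<le> (LINT x|lebesgue. (norm (L2_fun (grad u - test_gradient \<phi>) x))\<^sup>2)"
      unfolding I_def
    proof (rule integral_mono_AE[OF int sqn])
      have "?g x = 0" if "x \<notin> \<Omega>" for x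
        using that test_function_zero_outside[OF test_function_partial_deriv[OF \<phi>(1)]] by (simp add: vec_eq_iff)
      moreover have "AE x in lebesgue. L2_fun (test_gradient \<phi>) x = ?g x"
        unfolding test_gradient_def by (rule L2_fun_L2_class[OF square_integrable_test_function(3)[OF \<phi>(1)]])
      ultimately show "AE x in lebesgue. indicator (- \<Omega>) x * (norm (L2_fun (grad u) x))\<^sup>2 \<le>
          (norm (L2_fun (grad u - test_gradient \<phi>) x))\<^sup>2"
        using L2_fun_diff[of "grad u" "test_gradient \<phi>"]
        by (auto elim!: eventually_elim2 split: split_indicator)
    qed
    also have "\<dots> = (norm (grad u - test_gradient \<phi>))\<^sup>2" by (simp add: norm_L2_sq)
    also have "\<dots> \<le> (sqrt e)\<^sup>2" using \<phi>(2) by (intro power_mono) auto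
    finally show ?thesis using that by simp
  qed
  then have "I \<le> 0" by (rule field_le_epsilon[of I 0, simplified])
  moreover have "0 \<le> I" unfolding I_def by (intro integral_nonneg_AE) auto
  ultimately have "I = 0" by simp
  then have "AE x in lebesgue. indicator (- \<Omega>) x * (norm (L2_fun (grad u) x))\<^sup>2 = 0"
    unfolding I_def by (subst (asm) integral_nonneg_eq_0_iff_AE[OF int]) auto
  then show ?thesis by eventually_elim (auto split: split_indicator_asm)
qed

text \<open>By \<open>poincare\<close>, a sequence with Cauchy gradients is itself Cauchy in
  \<open>L2\<close>; both limits exist there, and \<open>H01_limit\<close> ties them
  together.\<close>

lemma H01_complete:
  assumes \<Omega>: "bounded \<Omega>" and X: "\<And>n. X n \<in> H01 \<Omega>"
    and Cauchy: "\<And>e. 0 < e \<Longrightarrow> \<exists>N. \<forall>m\<ge>N. \<forall>n\<ge>N. norm (grad (X m - X n)) < e"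
  shows "\<exists>L\<in>H01 \<Omega>. (\<lambda>n. norm (grad (X n - L))) \<longlonglongrightarrow> 0"
proof -
  obtain R where R: "\<Omega> \<subseteq> cball 0 R" "0 \<le> R"
    using bounded_subset_ballD[OF \<Omega>, of 0] ball_subset_cball by (meson less_imp_le order_trans)
  have diff: "grad (X m - X n) = grad (X m) - grad (X n)" for m n
    using X by (intro grad_ops(2) H01_H1)
  have le: "norm (X m - X n) \<le> (2 * R + 1) * norm (grad (X m - X n))" for m n
    using poincare[OF subspace_diff[OF subspace_H01 X X] R, of m n] norm_ge_zero[of "grad (X m - X n)"]
    unfolding distrib_right by linarith
  have "Cauchy (\<lambda>n. grad (X n))"
    by (rule CauchyI) (use Cauchy in \<open>simp add: diff\<close>)
  then obtain g where g: "(\<lambda>n. grad (X n)) \<longlonglongrightarrow> g"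
    using L2_Cauchy_convergent convergent_def by blast
  have "Cauchy X"
  proof (rule CauchyI)
    fix e :: real assume "0 < e"
    then have "0 < e / (2 * R + 1)" using R by simp
    from Cauchy[OF this] obtain N where N: "\<And>m n. N \<le> m \<Longrightarrow> N \<le> n \<Longrightarrow> norm (grad (X m - X n)) < e / (2 * R + 1)"
      by blast
    have "norm (X m - X n) < e" if "N \<le> m" "N \<le> n" for m n
      using le[of m n] N[OF that] R by (simp add: pos_less_divide_eq mult.commute)
    then show "\<exists>M. \<forall>m\<ge>M. \<forall>n\<ge>M. norm (X m - X n) < e" by blast
  qed
  then obtain L where L: "X \<longlonglongrightarrow> L" using L2_Cauchy_convergent convergent_def by blast
  note lim = H01_limit[OF X L g]
  have "grad (X n - L) = grad (X n) - g" for n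
    using grad_ops(2)[OF H01_H1[OF X] H01_H1[OF lim(1)]] lim(2) by simp
  then have "(\<lambda>n. norm (grad (X n - L))) \<longlonglongrightarrow> 0"
    using g by (simp add: LIM_zero tendsto_norm_zero)
  then show ?thesis using lim(1) by blast
qed

section \<open>The energy form of the elliptic problem\<close>

locale elliptic_coefficient =
  fixes \<Omega> :: "(real^'n::finite) set" and A :: "real^'n \<Rightarrow> real^'n^'n" and \<delta> M :: real
  assumes coefficient: "admissible_coefficient \<Omega> A \<delta> M"
    and open_domain: "open \<Omega>"
begin

text \<open>On arbitrary square integrable fields, bilinearity and bounds are statements about
  integrals alone; \<open>grad\<close>, whose linearity is tied to \<open>H1\<close>, is substituted
  afterwards.\<close>

definition gradient_form :: "(real^'n, real^'n) L2 \<Rightarrow> (real^'n, real^'n) L2 \<Rightarrow> real" where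
  "gradient_form g h = (LINT x|lebesgue_on \<Omega>. L2_fun g x \<bullet> (A x *v L2_fun h x))"

lemma \<Omega>_sets: "\<Omega> \<in> sets lebesgue"
  using open_domain by simp

lemma bounds: "0 < \<delta>" "\<delta> \<le> M" "AE x in lebesgue_on \<Omega>.
    \<forall>\<eta>. \<delta> * (norm \<eta>)\<^sup>2 \<le> \<eta> \<bullet> (A x *v \<eta>) \<and> \<eta> \<bullet> (A x *v \<eta>) \<le> M * (norm \<eta>)\<^sup>2"
  using coefficient by (auto simp: admissible_coefficient_def)

lemma A_sym: "x \<in> \<Omega> \<Longrightarrow> \<xi> \<bullet> (A x *v \<eta>) = \<eta> \<bullet> (A x *v \<xi>)"
  using coefficient dot_lmul_matrix[of \<xi> "A x" \<eta>]
  by (metis admissible_coefficient_def inner_commute transpose_matrix_vector)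

lemma AE_domain: "AE x in lebesgue. P x \<Longrightarrow> AE x in lebesgue_on \<Omega>. P x"
  using \<Omega>_sets by (subst AE_restrict_space_iff) (auto elim: eventually_mono)

lemma measurable_domain [measurable]: "L2_fun g \<in> borel_measurable (lebesgue_on \<Omega>)"
  by (rule measurable_restrict_space1[OF L2_fun_measurable])

lemma form_measurable [measurable]:
  "(\<lambda>x. L2_fun g x \<bullet> (A x *v L2_fun h x)) \<in> borel_measurable (lebesgue_on \<Omega>)"
    for g h :: "(real^'n, real^'n) L2"
proof -
  have [measurable]: "(\<lambda>x. A x $ i $ j) \<in> borel_measurable (lebesgue_on \<Omega>)" for i j
    using coefficient by (simp add: admissible_coefficient_def)
  have [measurable]: "(\<lambda>x. L2_fun g x $ i) \<in> borel_measurable (lebesgue_on \<Omega>)"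
    for i and g :: "(real^'n, real^'n) L2"
    by (rule measurable_compose[OF measurable_domain]) simp
  have "(\<lambda>x. L2_fun g x \<bullet> (A x *v L2_fun h x)) =
      (\<lambda>x. \<Sum>i\<in>UNIV. L2_fun g x $ i * (\<Sum>j\<in>UNIV. A x $ i $ j * L2_fun h x $ j))"
    by (simp add: inner_vec_def matrix_vector_mult_def)
  then show ?thesis by simp
qed

lemma norm_sq_integrable: "integrable (lebesgue_on \<Omega>) (\<lambda>x. (norm (L2_fun g x))\<^sup>2)"
  for g :: "(real^'n, real^'n) L2"
proof -
  have "integrable lebesgue (\<lambda>x. (norm (L2_fun g x))\<^sup>2)"
    using square_integrable_L2_fun[of g] by (simp add: square_integrable_def)
  from integrable_mult_indicator[OF \<Omega>_sets this] show ?thesis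
    using \<Omega>_sets by (subst integrable_restrict_space) simp_all
qed

text \<open>Polarisation: positivity at a + b and a - b bounds twice the modulus of the mixed term
  by the sum of the two diagonal terms, which the ellipticity constant \<open>M\<close>
  controls.\<close>

lemma form_integrable: "integrable (lebesgue_on \<Omega>) (\<lambda>x. L2_fun g x \<bullet> (A x *v L2_fun h x))"
  for g h :: "(real^'n, real^'n) L2"
proof (rule Bochner_Integration.integrable_bound)
  show "integrable (lebesgue_on \<Omega>) (\<lambda>x. M * ((norm (L2_fun g x))\<^sup>2 + (norm (L2_fun h x))\<^sup>2))"
    by (intro integrable_mult_right Bochner_Integration.integrable_add norm_sq_integrable)
  show "AE x in lebesgue_on \<Omega>. norm (L2_fun g x \<bullet> (A x *v L2_fun h x)) \<le>
      norm (M * ((norm (L2_fun g x))\<^sup>2 + (norm (L2_fun h x))\<^sup>2))"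
    using bounds(3) AE_space
  proof eventually_elim
    case (elim x)
    define a b where "a = L2_fun g x" and "b = L2_fun h x"
    have x: "x \<in> \<Omega>" using elim(2) by (simp add: space_restrict_space)
    have pos: "0 \<le> \<eta> \<bullet> (A x *v \<eta>)" for \<eta>
      using elim(1) bounds(1) by (meson mult_nonneg_nonneg less_imp_le order_trans zero_le_power2)
    have 1: "(a + b) \<bullet> (A x *v (a + b)) = a \<bullet> (A x *v a) + 2 * (a \<bullet> (A x *v b)) + b \<bullet> (A x *v b)"
      using A_sym[OF x, of a b] by (simp add: matrix_vector_right_distrib inner_add_left inner_add_right)
    have 2: "(a - b) \<bullet> (A x *v (a - b)) = a \<bullet> (A x *v a) - 2 * (a \<bullet> (A x *v b)) + b \<bullet> (A x *v b)"
      using A_sym[OF x, of a b] by (simp add: matrix_vector_mult_diff_distrib inner_diff_left inner_diff_right)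
    have "2 * \<bar>a \<bullet> (A x *v b)\<bar> \<le> a \<bullet> (A x *v a) + b \<bullet> (A x *v b)"
      using pos[of "a + b"] pos[of "a - b"] unfolding 1 2 by linarith
    also have "\<dots> \<le> M * (norm a)\<^sup>2 + M * (norm b)\<^sup>2"
      using elim(1) by (intro add_mono) auto
    finally have "\<bar>a \<bullet> (A x *v b)\<bar> \<le> M * ((norm a)\<^sup>2 + (norm b)\<^sup>2)"
      using bounds(1,2) by (simp add: distrib_left)
    then show ?case unfolding a_def b_def by simp
  qed
qed measurable

lemma gradient_form_add: "gradient_form (g + g') h = gradient_form g h + gradient_form g' h"
proof -
  have "gradient_form (g + g') h =
      (LINT x|lebesgue_on \<Omega>. L2_fun g x \<bullet> (A x *v L2_fun h x) + L2_fun g' x \<bullet> (A x *v L2_fun h x))"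
    unfolding gradient_form_def
  proof (rule integral_cong_AE)
    show "AE x in lebesgue_on \<Omega>. L2_fun (g + g') x \<bullet> (A x *v L2_fun h x) =
        L2_fun g x \<bullet> (A x *v L2_fun h x) + L2_fun g' x \<bullet> (A x *v L2_fun h x)"
      using AE_domain[OF L2_fun_add[of g g']] by eventually_elim (simp add: inner_add_left)
  qed measurable
  then show ?thesis by (simp add: gradient_form_def form_integrable)
qed

lemma gradient_form_scaleR: "gradient_form (r *\<^sub>R g) h = r * gradient_form g h"
proof -
  have "gradient_form (r *\<^sub>R g) h = (LINT x|lebesgue_on \<Omega>. r * (L2_fun g x \<bullet> (A x *v L2_fun h x)))"
    unfolding gradient_form_def
  proof (rule integral_cong_AE)
    show "AE x in lebesgue_on \<Omega>. L2_fun (r *\<^sub>R g) x \<bullet> (A x *v L2_fun h x) =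
        r * (L2_fun g x \<bullet> (A x *v L2_fun h x))"
      using AE_domain[OF L2_fun_scaleR[of r g]] by eventually_elim simp
  qed measurable
  then show ?thesis by (simp add: gradient_form_def)
qed

lemma gradient_form_sym: "gradient_form g h = gradient_form h g"
  unfolding gradient_form_def
  by (rule Bochner_Integration.integral_cong) (auto simp: space_restrict_space A_sym)

lemma gradient_form_bounds:
  "\<delta> * (LINT x|lebesgue_on \<Omega>. (norm (L2_fun g x))\<^sup>2) \<le> gradient_form g g"
  "gradient_form g g \<le> M * (LINT x|lebesgue_on \<Omega>. (norm (L2_fun g x))\<^sup>2)"
proof -
  have "(LINT x|lebesgue_on \<Omega>. \<delta> * (norm (L2_fun g x))\<^sup>2) \<le> gradient_form g g"
    unfolding gradient_form_def
    by (rule integral_mono_AE[OF integrable_mult_right[OF norm_sq_integrable] form_integrable])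
      (use bounds(3) in \<open>auto elim: eventually_mono\<close>)
  then show "\<delta> * (LINT x|lebesgue_on \<Omega>. (norm (L2_fun g x))\<^sup>2) \<le> gradient_form g g" by simp
  have "gradient_form g g \<le> (LINT x|lebesgue_on \<Omega>. M * (norm (L2_fun g x))\<^sup>2)"
    unfolding gradient_form_def
    by (rule integral_mono_AE[OF form_integrable integrable_mult_right[OF norm_sq_integrable]])
      (use bounds(3) in \<open>auto elim: eventually_mono\<close>)
  then show "gradient_form g g \<le> M * (LINT x|lebesgue_on \<Omega>. (norm (L2_fun g x))\<^sup>2)" by simp
qed

lemma energy_bounds:
  assumes u: "u \<in> H01 \<Omega>"
  shows "\<delta> * (norm (grad u))\<^sup>2 \<le> bilinear_form \<Omega> A u u" "bilinear_form \<Omega> A u u \<le> M * (norm (grad u))\<^sup>2"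
proof -
  have "(LINT x|lebesgue_on \<Omega>. (norm (L2_fun (grad u) x))\<^sup>2) =
      (LINT x|lebesgue. indicator \<Omega> x *\<^sub>R (norm (L2_fun (grad u) x))\<^sup>2)"
    using \<Omega>_sets by (subst integral_restrict_space) auto
  also have "\<dots> = (LINT x|lebesgue. (norm (L2_fun (grad u) x))\<^sup>2)"
  proof (rule integral_cong_AE)
    note [measurable] = L2_fun_measurable \<Omega>_sets
    show "(\<lambda>x. indicator \<Omega> x *\<^sub>R (norm (L2_fun (grad u) x))\<^sup>2) \<in> borel_measurable lebesgue"
      "(\<lambda>x. (norm (L2_fun (grad u) x))\<^sup>2) \<in> borel_measurable lebesgue" by measurable
    show "AE x in lebesgue. indicator \<Omega> x *\<^sub>R (norm (L2_fun (grad u) x))\<^sup>2 = (norm (L2_fun (grad u) x))\<^sup>2"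
      using grad_zero_outside[OF u \<Omega>_sets] by eventually_elim (auto split: split_indicator)
  qed
  finally have eq: "(LINT x|lebesgue_on \<Omega>. (norm (L2_fun (grad u) x))\<^sup>2) = (norm (grad u))\<^sup>2"
    by (simp add: norm_L2_sq)
  show "\<delta> * (norm (grad u))\<^sup>2 \<le> bilinear_form \<Omega> A u u" "bilinear_form \<Omega> A u u \<le> M * (norm (grad u))\<^sup>2"
    using gradient_form_bounds[of "grad u"] unfolding eq by (simp_all add: gradient_form_def bilinear_form_def)
qed

lemma bilinear_form_eq: "bilinear_form \<Omega> A u v = gradient_form (grad u) (grad v)"
  by (simp add: bilinear_form_def gradient_form_def)

lemma energy_norm_bounds:
  assumes "u \<in> H01 \<Omega>"
  shows "sqrt \<delta> * norm (grad u) \<le> energy_norm (bilinear_form \<Omega> A) u"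
    "energy_norm (bilinear_form \<Omega> A) u \<le> sqrt M * norm (grad u)"
  using energy_bounds[OF assms, THEN real_sqrt_le_mono] bounds(1,2)
  by (simp_all add: energy_norm_def real_sqrt_mult)

text \<open>By \<open>energy_norm_bounds\<close> the energy norm is equivalent to the norm of the
  gradient, for which \<open>poincare\<close> gives definiteness and \<open>H01_complete\<close>
  completeness.\<close>

lemma hilbert_on_H01:
  assumes "bounded \<Omega>"
  shows "hilbert_on (H01 \<Omega>) (bilinear_form \<Omega> A)"
proof
  show "subspace (H01 \<Omega>)" by (rule subspace_H01)
  show "bilinear_form \<Omega> A u v = bilinear_form \<Omega> A v u" for u v
    by (simp add: bilinear_form_eq gradient_form_sym)
  show "bilinear_form \<Omega> A (u + v) w = bilinear_form \<Omega> A u w + bilinear_form \<Omega> A v w"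
    if "u \<in> H01 \<Omega>" "v \<in> H01 \<Omega>" for u v w
    using that by (simp add: bilinear_form_eq grad_ops H01_H1 gradient_form_add)
  show "bilinear_form \<Omega> A (r *\<^sub>R u) v = r * bilinear_form \<Omega> A u v" if "u \<in> H01 \<Omega>" for r u v
    using that by (simp add: bilinear_form_eq grad_ops H01_H1 gradient_form_scaleR)
  show "0 \<le> bilinear_form \<Omega> A v v" if "v \<in> H01 \<Omega>" for v
    using energy_bounds(1)[OF that] bounds(1) by (meson mult_nonneg_nonneg less_imp_le order_trans zero_le_power2)
  obtain R where R: "\<Omega> \<subseteq> cball 0 R" "0 \<le> R"
    using bounded_subset_ballD[OF assms, of 0] ball_subset_cball by (meson less_imp_le order_trans)
  show "v = 0" if "v \<in> H01 \<Omega>" "bilinear_form \<Omega> A v v = 0" for v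
  proof -
    have "\<delta> * (norm (grad v))\<^sup>2 \<le> 0" using energy_bounds(1)[OF that(1)] that(2) by simp
    then have "grad v = 0" using bounds(1) by (simp add: mult_le_0_iff)
    then show ?thesis using poincare[OF that(1) R] by simp
  qed
  show "\<exists>L\<in>H01 \<Omega>. (\<lambda>n. energy_norm (bilinear_form \<Omega> A) (X n - L)) \<longlonglongrightarrow> 0"
    if X: "\<And>n. X n \<in> H01 \<Omega>"
      and Cauchy: "\<And>e. 0 < e \<Longrightarrow> \<exists>N. \<forall>m\<ge>N. \<forall>n\<ge>N. energy_norm (bilinear_form \<Omega> A) (X m - X n) < e" for X
  proof -
    note sub = subspace_diff[OF subspace_H01]
    have "\<exists>N. \<forall>m\<ge>N. \<forall>n\<ge>N. norm (grad (X m - X n)) < e" if "0 < e" for e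
    proof -
      have "0 < sqrt \<delta> * e" using that bounds(1) by simp
      from Cauchy[OF this] obtain N where
        N: "\<And>m n. N \<le> m \<Longrightarrow> N \<le> n \<Longrightarrow> energy_norm (bilinear_form \<Omega> A) (X m - X n) < sqrt \<delta> * e" by blast
      have "norm (grad (X m - X n)) < e" if "N \<le> m" "N \<le> n" for m n
      proof -
        have "sqrt \<delta> * norm (grad (X m - X n)) < sqrt \<delta> * e"
          using energy_norm_bounds(1)[OF sub[OF X X]] N[OF that] by (rule le_less_trans)
        then show ?thesis using bounds(1) by simp
      qed
      then show ?thesis by blast
    qed
    from H01_complete[OF assms X this] obtain L where L: "L \<in> H01 \<Omega>" "(\<lambda>n. norm (grad (X n - L))) \<longlonglongrightarrow> 0"
      by blast
    have "(\<lambda>n. energy_norm (bilinear_form \<Omega> A) (X n - L)) \<longlonglongrightarrow> 0"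
    proof (rule Lim_null_comparison)
      show "(\<lambda>n. sqrt M * norm (grad (X n - L))) \<longlonglongrightarrow> 0"
        using tendsto_mult_right_zero[OF L(2)] .
      have "norm (energy_norm (bilinear_form \<Omega> A) (X n - L)) \<le> sqrt M * norm (grad (X n - L))" for n
      proof -
        have "0 \<le> sqrt \<delta> * norm (grad (X n - L))" using bounds(1) by simp
        then show ?thesis using energy_norm_bounds[OF sub[OF X L(1)], of n] by simp
      qed
      then show "\<forall>\<^sub>F n in sequentially. norm (energy_norm (bilinear_form \<Omega> A) (X n - L)) \<le> sqrt M * norm (grad (X n - L))"
        by simp
    qed
    then show ?thesis using L(1) by blast
  qed
qed

end

section \<open>Convolution and locally affine functions\<close>

text \<open>The gradient is globally Lipschitz, so the remainder is quadratic uniformly in the base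
  point; this uniformity permits integrating the expansion in
  \<open>convolution_has_derivative\<close>.\<close>

lemma test_function_taylor:
  assumes "test_function \<Omega> (\<psi> :: real^'n::finite \<Rightarrow> real)"
  obtains C where "0 \<le> C"
    "\<And>z h. \<bar>\<psi> (z + h) - \<psi> z - (\<chi> i. partial_deriv i \<psi> z) \<bullet> h\<bar> \<le> C * (norm h)\<^sup>2"
proof -
  have "\<exists>L. 0 \<le> L \<and> (\<forall>x y. \<bar>partial_deriv i \<psi> x - partial_deriv i \<psi> y\<bar> \<le> L * norm (x - y))" for i
    using test_function_lipschitz[OF test_function_partial_deriv[OF assms, of i]] by metis
  then obtain L where L: "\<And>i. 0 \<le> L i"
    "\<And>i x y. \<bar>partial_deriv i \<psi> x - partial_deriv i \<psi> y\<bar> \<le> L i * norm (x - y)" by metis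
  define C where "C = (\<Sum>i\<in>UNIV. L i)"
  have C: "0 \<le> C" unfolding C_def using L by (intro sum_nonneg) auto
  define G where "G = (\<lambda>x. \<chi> i. partial_deriv i \<psi> x)"
  have G: "norm (G x - G y) \<le> C * norm (x - y)" for x y
  proof -
    have "norm (G x - G y) \<le> (\<Sum>i\<in>UNIV. \<bar>(G x - G y) $ i\<bar>)" by (rule norm_le_l1_cart)
    also have "\<dots> \<le> (\<Sum>i\<in>UNIV. L i * norm (x - y))"
      by (intro sum_mono) (use L in \<open>simp add: G_def\<close>)
    finally show ?thesis by (simp add: C_def sum_distrib_right)
  qed
  have "norm (\<psi> (z + h) - \<psi> z - G z \<bullet> ((z + h) - z)) \<le> norm ((z + h) - z) * (C * norm h)" for z h
  proof (rule differentiable_bound_linearization[where S = "cball z (norm h)" and f' = "\<lambda>x k. G x \<bullet> k" and ?x0.0 = z])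
    show "(\<psi> has_derivative (\<lambda>k. G x \<bullet> k)) (at x within cball z (norm h))" for x
      unfolding G_def using has_derivative_partial_deriv[OF test_functionD(2)[OF assms]]
      by (rule has_derivative_at_withinI)
    show "onorm ((\<lambda>k. G x \<bullet> k) - (\<lambda>k. G z \<bullet> k)) \<le> C * norm h" if "x \<in> cball z (norm h)" for x
    proof (rule onorm_bound)
      fix k
      have "norm (((\<lambda>k. G x \<bullet> k) - (\<lambda>k. G z \<bullet> k)) k) = \<bar>(G x - G z) \<bullet> k\<bar>" by (simp add: inner_diff_left)
      also have "\<dots> \<le> norm (G x - G z) * norm k" by (rule Cauchy_Schwarz_ineq2)
      also have "\<dots> \<le> C * norm h * norm k"
      proof (rule mult_right_mono)
        have "norm (x - z) \<le> norm h" using that by (simp add: dist_norm norm_minus_commute)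
        then have "C * norm (x - z) \<le> C * norm h" using C by (rule mult_left_mono)
        then show "norm (G x - G z) \<le> C * norm h" using G[of x z] by linarith
      qed simp
      finally show "norm (((\<lambda>k. G x \<bullet> k) - (\<lambda>k. G z \<bullet> k)) k) \<le> C * norm h * norm k" .
    qed (use C in simp)
    show "t \<in> {0..1} \<Longrightarrow> z + t *\<^sub>R ((z + h) - z) \<in> cball z (norm h)" for t
      by (auto simp: dist_norm mult_left_le_one_le)
  qed auto
  then show ?thesis using that[OF C] by (simp add: G_def power2_eq_square mult_ac)
qed

definition convolution :: "('a::euclidean_space \<Rightarrow> real) \<Rightarrow> ('a \<Rightarrow> real) \<Rightarrow> 'a \<Rightarrow> real" where
  "convolution f \<psi> x = (LINT y|lebesgue. f y * \<psi> (x - y))"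

lemma test_function_measurable_reflect:
  assumes "test_function UNIV \<psi>"
  shows "(\<lambda>y. \<psi> (x - y)) \<in> borel_measurable lebesgue"
  using measurable_lebesgue_reflect_translate[of "-1" \<psi> x]
    square_integrable_measurable[OF square_integrable_test_function(1)[OF assms]] by simp

lemma convolution_integrable:
  assumes f: "integrable lebesgue f" and \<psi>: "test_function UNIV \<psi>"
  shows "integrable lebesgue (\<lambda>y. f y * \<psi> (x - y))"
proof -
  obtain B where B: "0 \<le> B" "\<And>x. \<bar>\<psi> x\<bar> \<le> B" using test_function_bounded[OF \<psi>] by metis
  note [measurable] = test_function_measurable_reflect[OF \<psi>] borel_measurable_integrable[OF f]
  show ?thesis
  proof (rule Bochner_Integration.integrable_bound[OF integrable_mult_left[OF integrable_abs[OF f], of B]])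
    show "AE y in lebesgue. norm (f y * \<psi> (x - y)) \<le> norm (\<bar>f y\<bar> * B)"
      using B by (intro AE_I2) (simp add: abs_mult mult_left_mono)
  qed measurable
qed

text \<open>Integrating the Taylor expansion of the mollifier against \<open>f\<close> leaves a
  remainder of at most the L1 norm of \<open>f\<close> times C |h|^2.\<close>

lemma convolution_has_derivative:
  assumes f: "integrable lebesgue f" and \<psi>: "test_function UNIV \<psi>"
  shows "(convolution f \<psi> has_derivative (\<lambda>h. (\<chi> i. convolution f (partial_deriv i \<psi>) x) \<bullet> h)) (at x)"
  unfolding has_derivative_at_alt
proof (intro conjI allI impI)
  show "bounded_linear (\<lambda>h. (\<chi> i. convolution f (partial_deriv i \<psi>) x) \<bullet> h)"
    by (rule bounded_linear_inner_right)
  fix e :: real assume e: "0 < e"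
  obtain C where C: "0 \<le> C" "\<And>z h. \<bar>\<psi> (z + h) - \<psi> z - (\<chi> i. partial_deriv i \<psi> z) \<bullet> h\<bar> \<le> C * (norm h)\<^sup>2"
    using test_function_taylor[OF \<psi>] by metis
  define I where "I = (LINT y|lebesgue. \<bar>f y\<bar>)"
  have I: "0 \<le> I" unfolding I_def by (intro integral_nonneg_AE) auto
  note int = convolution_integrable[OF f \<psi>]
  note int' = convolution_integrable[OF f test_function_partial_deriv[OF \<psi>]]
  have main: "norm (convolution f \<psi> y - convolution f \<psi> x - (\<chi> i. convolution f (partial_deriv i \<psi>) x) \<bullet> (y - x))
      \<le> I * C * (norm (y - x))\<^sup>2" for y
  proof -
    define h where "h = y - x"
    have "(\<chi> i. convolution f (partial_deriv i \<psi>) x) \<bullet> h =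
        (LINT z|lebesgue. (\<Sum>i\<in>UNIV. f z * partial_deriv i \<psi> (x - z) * h $ i))"
      using int' by (simp add: inner_vec_def convolution_def)
    also have "\<dots> = (LINT z|lebesgue. f z * ((\<chi> i. partial_deriv i \<psi> (x - z)) \<bullet> h))"
      by (simp add: inner_vec_def sum_distrib_left mult_ac)
    finally have D: "(\<chi> i. convolution f (partial_deriv i \<psi>) x) \<bullet> h =
      (LINT z|lebesgue. f z * ((\<chi> i. partial_deriv i \<psi> (x - z)) \<bullet> h))" .
    have intD: "integrable lebesgue (\<lambda>z. f z * ((\<chi> i. partial_deriv i \<psi> (x - z)) \<bullet> h))"
    proof -
      have "integrable lebesgue (\<lambda>z. \<Sum>i\<in>UNIV. f z * partial_deriv i \<psi> (x - z) * h $ i)"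
        using int' by (intro Bochner_Integration.integrable_sum integrable_mult_left)
      then show ?thesis by (simp add: inner_vec_def sum_distrib_left mult_ac)
    qed
    have "convolution f \<psi> y - convolution f \<psi> x - (\<chi> i. convolution f (partial_deriv i \<psi>) x) \<bullet> h =
        (LINT z|lebesgue. f z * \<psi> (y - z) - f z * \<psi> (x - z) - f z * ((\<chi> i. partial_deriv i \<psi> (x - z)) \<bullet> h))"
      unfolding D unfolding convolution_def
      by (simp only: Bochner_Integration.integral_diff Bochner_Integration.integrable_diff int intD)
    also have "norm \<dots> \<le> (LINT z|lebesgue. \<bar>f z\<bar> * (C * (norm h)\<^sup>2))"
    proof (rule order_trans[OF integral_norm_bound integral_mono])
      show "integrable lebesgue (\<lambda>z. norm (f z * \<psi> (y - z) - f z * \<psi> (x - z) - f z * ((\<chi> i. partial_deriv i \<psi> (x - z)) \<bullet> h)))"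
        using int intD by (intro integrable_norm Bochner_Integration.integrable_diff)
      show "integrable lebesgue (\<lambda>z. \<bar>f z\<bar> * (C * (norm h)\<^sup>2))" using f by simp
      fix z
      have "f z * \<psi> (y - z) - f z * \<psi> (x - z) - f z * ((\<chi> i. partial_deriv i \<psi> (x - z)) \<bullet> h) =
        f z * (\<psi> ((x - z) + h) - \<psi> (x - z) - (\<chi> i. partial_deriv i \<psi> (x - z)) \<bullet> h)"
        by (simp add: h_def algebra_simps)
      also have "norm \<dots> \<le> \<bar>f z\<bar> * (C * (norm h)\<^sup>2)"
        using C(2)[of "x - z" h] by (simp add: abs_mult mult_left_mono)
      finally show "norm (f z * \<psi> (y - z) - f z * \<psi> (x - z) - f z * ((\<chi> i. partial_deriv i \<psi> (x - z)) \<bullet> h))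
        \<le> \<bar>f z\<bar> * (C * (norm h)\<^sup>2)" .
    qed
    also have "\<dots> = I * C * (norm h)\<^sup>2" by (simp add: I_def)
    finally show ?thesis by (simp add: h_def)
  qed
  show "\<exists>d>0. \<forall>y. norm (y - x) < d \<longrightarrow>
      norm (convolution f \<psi> y - convolution f \<psi> x - (\<chi> i. convolution f (partial_deriv i \<psi>) x) \<bullet> (y - x)) \<le> e * norm (y - x)"
  proof (intro exI[of _ "e / (I * C + 1)"] conjI allI impI)
    have pos: "0 < I * C + 1" using I C by (simp add: add_nonneg_pos)
    then show "0 < e / (I * C + 1)" using e by simp
    fix y assume "norm (y - x) < e / (I * C + 1)"
    then have "(I * C + 1) * norm (y - x) \<le> e" using pos by (simp add: field_simps)
    moreover have "I * C * norm (y - x) \<le> (I * C + 1) * norm (y - x)" by (intro mult_right_mono) auto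
    ultimately have "I * C * norm (y - x) \<le> e" by linarith
    then have "I * C * norm (y - x) * norm (y - x) \<le> e * norm (y - x)" by (rule mult_right_mono) simp
    then show "norm (convolution f \<psi> y - convolution f \<psi> x - (\<chi> i. convolution f (partial_deriv i \<psi>) x) \<bullet> (y - x)) \<le> e * norm (y - x)"
      using main[of y] by (simp add: power2_eq_square mult.assoc)
  qed
qed

lemma partial_deriv_convolution:
  assumes "integrable lebesgue f" "test_function UNIV \<psi>"
  shows "partial_deriv i (convolution f \<psi>) = convolution f (partial_deriv i \<psi>)"
  by (rule ext, subst partial_deriv_eq[OF convolution_has_derivative[OF assms]]) (simp add: inner_axis)

lemma Ck_convolution:
  assumes f: "integrable lebesgue f" and "test_function UNIV \<psi>"
  shows "Ck k (convolution f \<psi>)"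
  using assms(2)
proof (induction k arbitrary: \<psi>)
  case 0
  then show ?case
    using has_derivative_continuous[OF convolution_has_derivative[OF f]] by (auto simp: continuous_on_eq_continuous_at)
next
  case (Suc k)
  then show ?case
    using differentiableI[OF convolution_has_derivative[OF f Suc.prems]]
    by (auto simp: partial_deriv_convolution[OF f] intro: test_function_partial_deriv)
qed

lemma tendsto_L2_zero:
  fixes h :: "nat \<Rightarrow> 'a::euclidean_space \<Rightarrow> 'b::euclidean_space"
  assumes meas: "\<And>n. h n \<in> borel_measurable lebesgue"
    and B: "\<And>n x. norm (h n x) \<le> B" and R: "\<And>n x. h n x \<noteq> 0 \<Longrightarrow> norm x \<le> R"
    and lim: "AE x in lebesgue. (\<lambda>n. h n x) \<longlonglongrightarrow> 0"
  shows "square_integrable (h n)" "(\<lambda>n. norm (L2_class (h n))) \<longlonglongrightarrow> 0"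
proof -
  note [measurable] = meas
  show sq: "square_integrable (h n)" for n
    unfolding square_integrable_def
  proof
    have "norm ((norm (h n x))\<^sup>2) \<le> B\<^sup>2" for x
      using power_mono[OF B, of n x 2] by simp
    moreover have "bounded {x. (norm (h n x))\<^sup>2 \<noteq> 0}"
      using R[of n] by (auto simp: bounded_iff)
    ultimately show "integrable lebesgue (\<lambda>x. (norm (h n x))\<^sup>2)"
      by (intro integrable_bounded_support[of _ "B\<^sup>2"]) auto
  qed (rule meas)
  have "(\<lambda>n. LINT x|lebesgue. (norm (h n x))\<^sup>2) \<longlonglongrightarrow> (LINT x|(lebesgue :: 'a measure). 0)"
  proof (rule integral_dominated_convergence[where w = "\<lambda>x. B\<^sup>2 * indicator (cball 0 R) x"])
    show "integrable lebesgue (\<lambda>x :: 'a. B\<^sup>2 * indicator (cball 0 R) x :: real)"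
      by (intro integrable_mult_right integrable_real_indicator)
        (auto simp: emeasure_bounded_finite simp flip: infinity_ennreal_def)
    show "AE x in lebesgue. (\<lambda>n. (norm (h n x))\<^sup>2) \<longlonglongrightarrow> 0"
      using lim by eventually_elim (auto intro!: tendsto_eq_intros)
    show "AE x in lebesgue. norm ((norm (h n x))\<^sup>2) \<le> B\<^sup>2 * indicator (cball 0 R) x" for n
    proof (rule AE_I2)
      fix x
      show "norm ((norm (h n x))\<^sup>2) \<le> B\<^sup>2 * indicator (cball 0 R) x"
        using power_mono[OF B, of n x 2] R[of n x] by (cases "h n x = 0") auto
    qed
  qed measurable
  then have "(\<lambda>n. (norm (L2_class (h n)))\<^sup>2) \<longlonglongrightarrow> 0"
    by (simp add: norm_L2_class_sq[OF sq])
  from tendsto_real_sqrt[OF this] show "(\<lambda>n. norm (L2_class (h n))) \<longlonglongrightarrow> 0" by simp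
qed

section \<open>Locally affine functions and mollifiers\<close>

definition locally_affine :: "('a::euclidean_space \<Rightarrow> real) \<Rightarrow> 'a \<Rightarrow> 'a \<Rightarrow> bool" where
  "locally_affine f x b \<longleftrightarrow> (\<exists>e>0. \<forall>y\<in>ball x e. f y = f x + b \<bullet> (y - x))"

text \<open>By \<open>locally_affine_unique\<close> the choice is determined. The default 0 off the
  open set where \<open>f\<close> is locally affine keeps the function measurable.\<close>

definition affine_gradient :: "('a::euclidean_space \<Rightarrow> real) \<Rightarrow> 'a \<Rightarrow> 'a" where
  "affine_gradient f x = (if \<exists>b. locally_affine f x b then SOME b. locally_affine f x b else 0)"

lemma locally_affine_has_derivative:
  assumes "locally_affine f x b"
  shows "(f has_derivative (\<lambda>h. b \<bullet> h)) (at x)"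
proof -
  obtain e where e: "0 < e" "\<And>y. y \<in> ball x e \<Longrightarrow> f y = f x + b \<bullet> (y - x)"
    using assms unfolding locally_affine_def by blast
  have "((\<lambda>y. f x + b \<bullet> (y - x)) has_derivative (\<lambda>h. b \<bullet> h)) (at x)"
    by (auto intro!: derivative_eq_intros)
  then show ?thesis
    by (rule has_derivative_transform_within_open[OF _ open_ball centre_in_ball[THEN iffD2, OF e(1)]])
      (rule e(2)[symmetric])
qed

lemma locally_affine_unique:
  assumes "locally_affine f x b" "locally_affine f x c"
  shows "b = c"
  using has_derivative_unique[OF assms[THEN locally_affine_has_derivative]]
  by (metis vector_eq_rdot)

lemma affine_gradient_eq: "locally_affine f x b \<Longrightarrow> affine_gradient f x = b"
  unfolding affine_gradient_def using locally_affine_unique by (auto intro!: some_equality)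

lemma locally_affine_open:
  assumes "locally_affine f x b"
  shows "\<exists>e>0. \<forall>y\<in>ball x e. f y = f x + b \<bullet> (y - x) \<and> locally_affine f y b"
proof -
  obtain e where e: "0 < e" "\<And>y. y \<in> ball x e \<Longrightarrow> f y = f x + b \<bullet> (y - x)"
    using assms unfolding locally_affine_def by blast
  have "locally_affine f y b" if y: "y \<in> ball x e" for y
  proof -
    obtain d where d: "0 < d" "ball y d \<subseteq> ball x e" using openE[OF open_ball y] by blast
    have "f z = f y + b \<bullet> (z - y)" if "z \<in> ball y d" for z
    proof -
      have "z \<in> ball x e" using that d(2) by blast
      from e(2)[OF this] e(2)[OF y] show ?thesis by (simp only: inner_diff_right)
    qed
    then show ?thesis unfolding locally_affine_def using d(1) by blast
  qed
  then show ?thesis using e by blast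
qed

text \<open>The points where \<open>f\<close> is locally affine form an open set, on which the
  gradient is locally constant and hence continuous.\<close>

lemma affine_gradient_measurable: "affine_gradient f \<in> borel_measurable lebesgue"
  for f :: "'a::euclidean_space \<Rightarrow> real"
proof -
  define U where "U = {x. \<exists>b. locally_affine f x b}"
  have "open U" unfolding open_contains_ball U_def using locally_affine_open by fastforce
  have "continuous_on U (affine_gradient f)"
    unfolding continuous_on_eq_continuous_at[OF \<open>open U\<close>]
  proof
    fix x assume "x \<in> U"
    then obtain b where b: "locally_affine f x b" by (auto simp: U_def)
    from locally_affine_open[OF b] obtain e where e: "0 < e" "\<And>y. y \<in> ball x e \<Longrightarrow> locally_affine f y b" by blast
    have "\<forall>\<^sub>F y in nhds x. affine_gradient f y = b"
      using e by (auto simp: eventually_nhds intro!: exI[of _ "ball x e"] affine_gradient_eq)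
    then show "isCont (affine_gradient f) x"
      by (subst isCont_cong[where g = "\<lambda>_. b"]) auto
  qed
  then have "(\<lambda>x. indicator U x *\<^sub>R affine_gradient f x) \<in> borel_measurable borel"
    using \<open>open U\<close> by (intro borel_measurable_continuous_on_indicator) auto
  also have "(\<lambda>x. indicator U x *\<^sub>R affine_gradient f x) = affine_gradient f"
    by (auto simp: U_def affine_gradient_def split: split_indicator)
  finally show ?thesis by (intro measurable_completion) simp
qed

text \<open>A short step in the direction of \<open>b\<close> itself changes \<open>f\<close> by
  \<open>norm b\<close> times the distance travelled.\<close>

lemma affine_gradient_bound:
  assumes "\<And>x y. \<bar>f x - f y\<bar> \<le> L * norm (x - y)" "0 \<le> L"
  shows "norm (affine_gradient f x) \<le> L"
proof (cases "\<exists>b. locally_affine f x b")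
  case True
  then obtain b where b: "locally_affine f x b" by blast
  then obtain e where e: "0 < e" "\<And>y. y \<in> ball x e \<Longrightarrow> f y = f x + b \<bullet> (y - x)"
    unfolding locally_affine_def by blast
  have "norm b \<le> L"
  proof (cases "b = 0")
    case False
    define t where "t = e / (2 * norm b)"
    have t: "0 < t" "t * norm b < e" using e False by (auto simp: t_def)
    then have "f (x + t *\<^sub>R b) - f x = t * (norm b)\<^sup>2"
      using e(2)[of "x + t *\<^sub>R b"] by (simp add: dist_norm power2_norm_eq_inner)
    moreover have "\<bar>f (x + t *\<^sub>R b) - f x\<bar> \<le> L * (t * norm b)"
      using assms(1)[of "x + t *\<^sub>R b" x] t by simp
    ultimately have "(t * norm b) * norm b \<le> (t * norm b) * L" using t by (simp add: power2_eq_square mult_ac)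
    then show ?thesis using t False by simp
  qed (use assms in simp)
  then show ?thesis using affine_gradient_eq[OF b] by simp
qed (use assms in \<open>simp add: affine_gradient_def\<close>)

text \<open>No mesh is mentioned: soft thresholding cuts elements along level sets, and the class
  has to be stable under it.\<close>

definition piecewise_affine :: "('a::euclidean_space \<Rightarrow> real) \<Rightarrow> bool" where
  "piecewise_affine f \<longleftrightarrow> (\<exists>L\<ge>0. \<forall>x y. \<bar>f x - f y\<bar> \<le> L * norm (x - y)) \<and> bounded {x. f x \<noteq> 0} \<and>
     (AE x in lebesgue. \<exists>b. locally_affine f x b)"

lemma affine_gradient_zero_outside:
  assumes "x \<notin> closure {x. f x \<noteq> 0}"
  shows "affine_gradient f x = 0"
proof -
  obtain e where e: "0 < e" "ball x e \<subseteq> - closure {x. f x \<noteq> 0}"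
    using openE[of "- closure {x. f x \<noteq> 0}" x] assms by auto
  have z: "f y = 0" if "y \<in> ball x e" for y
    using that e(2) closure_subset[of "{x. f x \<noteq> 0}"] by blast
  have "locally_affine f x 0"
    unfolding locally_affine_def
  proof (intro exI[of _ e] conjI ballI e(1))
    fix y assume "y \<in> ball x e"
    then show "f y = f x + 0 \<bullet> (y - x)" using z[of y] z[of x] e(1) by simp
  qed
  then show ?thesis by (rule affine_gradient_eq)
qed

lemma piecewise_affine_lipschitz_gradient:
  assumes "piecewise_affine f"
  shows "lipschitz_gradient f (affine_gradient f)"
proof -
  obtain L where L: "0 \<le> L" "\<And>x y. \<bar>f x - f y\<bar> \<le> L * norm (x - y)"
    using assms by (auto simp: piecewise_affine_def)
  have "{x. affine_gradient f x \<noteq> 0} \<subseteq> closure {x. f x \<noteq> 0}"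
    using affine_gradient_zero_outside by blast
  moreover have "bounded (closure {x. f x \<noteq> 0})"
    using assms by (intro bounded_closure) (simp add: piecewise_affine_def)
  ultimately have "bounded {x. affine_gradient f x \<noteq> 0}" by (rule bounded_subset[rotated])
  moreover have "AE x in lebesgue. (f has_derivative (\<lambda>h. affine_gradient f x \<bullet> h)) (at x)"
  proof -
    have "AE x in lebesgue. \<exists>b. locally_affine f x b" using assms by (simp add: piecewise_affine_def)
    then show ?thesis
    proof eventually_elim
      case (elim x)
      then obtain b where "locally_affine f x b" by blast
      then show ?case using locally_affine_has_derivative by (simp add: affine_gradient_eq)
    qed
  qed
  moreover have "bounded (range (affine_gradient f))"
    using affine_gradient_bound[OF L(2) L(1)] by (auto simp: bounded_iff)
  ultimately show ?thesis
    using assms affine_gradient_measurable[of f] by (auto simp: lipschitz_gradient_def piecewise_affine_def)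
qed

lemma mollifier_exists:
  assumes "0 < \<eta>"
  obtains \<psi> :: "real^'n::finite \<Rightarrow> real" where "test_function UNIV \<psi>" "\<And>x. 0 \<le> \<psi> x"
    "\<And>x. \<psi> x \<noteq> 0 \<Longrightarrow> norm x < \<eta>" "(LINT x|lebesgue. \<psi> x) = 1"
proof -
  \<comment> \<open>Division by the dimension keeps the sum of the moduli of the coordinates, a
    bound of the Euclidean norm, below \<eta>.\<close>
  define r where "r = \<eta> / real CARD('n)"
  have r: "0 < r" using assms by (simp add: r_def)
  define b :: "real^'n" where "b = (\<chi> i. r)"
  define c where "c = box_bump 1 (- b) b"
  have tf: "test_function UNIV c" unfolding c_def by (rule test_function_box_bump) auto
  note sq = square_integrable_test_function(1)[OF tf]
  have small: "norm x < \<eta>" if "c x \<noteq> 0" for x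
  proof -
    have "\<bar>x $ i\<bar> < r" for i
      using that box_bump_nonzero[of 1 "- b" b x] by (auto simp: c_def b_def mem_box_cart abs_less_iff minus_less_iff)
    then have "(\<Sum>i\<in>UNIV. \<bar>x $ i\<bar>) < (\<Sum>i\<in>(UNIV :: 'n set). r)" by (intro sum_strict_mono) auto
    also have "\<dots> = \<eta>" by (simp add: r_def)
    finally show ?thesis using norm_le_l1_cart[of x] by simp
  qed
  have int: "integrable lebesgue c"
    using square_integrable_measurable[OF sq] small
    by (intro integrable_bounded_support[of _ 1]) (auto simp: c_def box_bump_bounds bounded_iff intro!: less_imp_le)
  define I where "I = (LINT x|lebesgue. c x)"
  have "I \<noteq> 0"
  proof
    assume "I = 0"
    then have "AE x in lebesgue. c x = 0"
      unfolding I_def using int by (subst (asm) integral_nonneg_eq_0_iff_AE) (auto simp: c_def box_bump_bounds)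
    then have "AE x in lebesgue. x \<notin> box (- b) b"
      by eventually_elim (use box_bump_nonzero[of 1 "- b" b] in \<open>auto simp: c_def\<close>)
    then have "box (- b) b \<in> null_sets lebesgue"
      by (subst AE_iff_null_sets) auto
    then have "box (- b) b = {}"
      using negligible_interval(2)[of "- b" b] by (simp add: negligible_iff_null_sets)
    moreover have "0 \<in> box (- b) b" using r by (auto simp: b_def mem_box_cart)
    ultimately show False by blast
  qed
  moreover have "0 \<le> I" unfolding I_def by (intro integral_nonneg_AE) (auto simp: c_def box_bump_bounds)
  ultimately have I: "0 < I" by simp
  show ?thesis
  proof (rule that[of "\<lambda>x. 1 / I * c x"])
    show "test_function UNIV (\<lambda>x. 1 / I * c x)" by (rule test_function_cmult[OF tf])
    show "(LINT x|lebesgue. 1 / I * c x) = 1" using I by (simp add: I_def)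
  qed (use small I in \<open>auto simp: c_def box_bump_bounds\<close>)
qed

section \<open>Piecewise affine functions with zero boundary values\<close>

lemma test_function_reflect:
  assumes "test_function UNIV \<psi>"
  shows "test_function UNIV (\<lambda>y. \<psi> (x - y))"
proof (rule test_functionI_support)
  show "Ck k (\<lambda>y. \<psi> (x - y))" for k by (rule Ck_reflect[OF test_functionD(1)[OF assms]])
  have K: "compact (closure {x. \<psi> x \<noteq> 0})" using assms by (simp add: test_function_def)
  have "(\<lambda>z. x - z) ` closure {x. \<psi> x \<noteq> 0} = (\<lambda>z. x + z) ` (uminus ` closure {x. \<psi> x \<noteq> 0})"
    by (simp add: image_image)
  then show "compact ((\<lambda>z. x - z) ` closure {x. \<psi> x \<noteq> 0})"
    using K by (simp add: compact_translation compact_negations del: compact_closure)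
  show "{y. \<psi> (x - y) \<noteq> 0} \<subseteq> (\<lambda>z. x - z) ` closure {x. \<psi> x \<noteq> 0}"
  proof
    fix y assume "y \<in> {y. \<psi> (x - y) \<noteq> 0}"
    then have "x - y \<in> closure {x. \<psi> x \<noteq> 0}" using closure_subset[of "{x. \<psi> x \<noteq> 0}"] by auto
    then show "y \<in> (\<lambda>z. x - z) ` closure {x. \<psi> x \<noteq> 0}" by (rule rev_image_eqI) simp
  qed
qed simp

lemma L2_small:
  assumes "(\<lambda>n. norm (L2_class (h n))) \<longlonglongrightarrow> 0" "0 < e"
  shows "\<exists>N. \<forall>n\<ge>N. norm (L2_class (h n)) < e"
  using LIMSEQ_D[OF assms] by simp

text \<open>The reflected bump is a probability density concentrated within \<eta> of
  \<open>x\<close>. With \<open>d = 0\<close> the estimate says that averaging reproduces a function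
  that is constant near \<open>x\<close>.\<close>

lemma integral_bump_average:
  assumes \<psi>: "test_function UNIV \<psi>" "\<And>x. 0 \<le> \<psi> x" "\<And>x. \<psi> x \<noteq> 0 \<Longrightarrow> norm x < \<eta>" "(LINT x|lebesgue. \<psi> x) = 1"
    and k: "integrable lebesgue (\<lambda>y. k y * \<psi> (x - y))" and bound: "\<And>y. norm (x - y) < \<eta> \<Longrightarrow> \<bar>k y - c\<bar> \<le> d"
  shows "\<bar>(LINT y|lebesgue. k y * \<psi> (x - y)) - c\<bar> \<le> d"
proof -
  have meas: "\<psi> \<in> borel_measurable lebesgue"
    by (rule square_integrable_measurable[OF square_integrable_test_function(1)[OF \<psi>(1)]])
  have one: "(LINT y|lebesgue. \<psi> (x - y)) = 1"
    using integral_lebesgue_reflect_translate[of "-1" \<psi> x] meas \<psi>(4) by simp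
  \<comment> \<open>A function that is not integrable would have the integral 0, not 1.\<close>
  then have int: "integrable lebesgue (\<lambda>y. \<psi> (x - y))"
    using not_integrable_integral_eq by fastforce
  have int': "integrable lebesgue (\<lambda>y. (k y - c) * \<psi> (x - y))"
    using k int by (simp add: left_diff_distrib)
  have "(LINT y|lebesgue. k y * \<psi> (x - y)) - c = (LINT y|lebesgue. (k y - c) * \<psi> (x - y))"
    using k int one by (simp add: left_diff_distrib)
  also have "norm \<dots> \<le> (LINT y|lebesgue. d * \<psi> (x - y))"
  proof (rule order_trans[OF integral_norm_bound integral_mono])
    show "integrable lebesgue (\<lambda>y. norm ((k y - c) * \<psi> (x - y)))" using int' by (rule integrable_norm)
    show "integrable lebesgue (\<lambda>y. d * \<psi> (x - y))" using int by simp
    fix y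
    show "norm ((k y - c) * \<psi> (x - y)) \<le> d * \<psi> (x - y)"
    proof (cases "\<psi> (x - y) = 0")
      case False
      then show ?thesis using bound[OF \<psi>(3)[OF False]] \<psi>(2)[of "x - y"] by (simp add: abs_mult mult_right_mono)
    qed simp
  qed
  also have "\<dots> = d" using one by simp
  finally show ?thesis by simp
qed

text \<open>Mollification; almost everywhere, the mollified gradient is eventually the exact one.\<close>

lemma piecewise_affine_compact_support_H01:
  fixes F :: "real^'n::finite \<Rightarrow> real"
  assumes F: "piecewise_affine F" and "open \<Omega>" and supp: "closure {x. F x \<noteq> 0} \<subseteq> \<Omega>"
  shows "L2_class F \<in> H01 \<Omega>"
proof -
  define g where "g = affine_gradient F"
  have fg: "lipschitz_gradient F g" unfolding g_def by (rule piecewise_affine_lipschitz_gradient[OF F])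
  obtain L B R where L: "0 \<le> L" "0 \<le> B" "\<And>x y. \<bar>F x - F y\<bar> \<le> L * norm (x - y)"
    "\<And>x. norm (g x) \<le> B" "\<And>x. F x \<noteq> 0 \<Longrightarrow> norm x \<le> R" "\<And>x. g x \<noteq> 0 \<Longrightarrow> norm x \<le> R"
    using lipschitz_gradientE[OF fg] by metis
  note sq = lipschitz_gradient_square_integrable[OF fg]
  note meas[measurable] = lipschitz_gradient_measurable[OF fg]
  define K where "K = closure {x. F x \<noteq> 0}"
  have K: "compact K" using F by (simp add: K_def piecewise_affine_def)
  obtain \<epsilon> where \<epsilon>: "0 < \<epsilon>" "(\<Union>x\<in>K. cball x \<epsilon>) \<subseteq> \<Omega>"
    using compact_subset_open_imp_cball_epsilon_subset[OF K \<open>open \<Omega>\<close>] supp unfolding K_def by blast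
  \<comment> \<open>Widths of at most \<epsilon> keep the mollified supports in the
    \<epsilon>-neighbourhood of \<open>K\<close>, inside \<Omega>.\<close>
  define \<eta> where "\<eta> = (\<lambda>n. \<epsilon> * inverse (real (Suc n)))"
  have \<eta>: "0 < \<eta> n" "\<eta> n \<le> \<epsilon>" for n using \<epsilon> by (auto simp: \<eta>_def field_simps)
  have \<eta>_lim: "\<eta> \<longlonglongrightarrow> 0"
    unfolding \<eta>_def using tendsto_mult_right_zero[OF LIMSEQ_inverse_real_of_nat] .
  have "\<exists>\<psi>::real^'n \<Rightarrow> real. test_function UNIV \<psi> \<and> (\<forall>x. 0 \<le> \<psi> x) \<and> (\<forall>x. \<psi> x \<noteq> 0 \<longrightarrow> norm x < \<eta> n) \<and>
      (LINT x|lebesgue. \<psi> x) = 1" for n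
    using mollifier_exists[OF \<eta>(1)] by metis
  then obtain \<psi> :: "nat \<Rightarrow> real^'n \<Rightarrow> real" where \<psi>: "\<And>n. test_function UNIV (\<psi> n)" "\<And>n x. 0 \<le> \<psi> n x"
    "\<And>n x. \<psi> n x \<noteq> 0 \<Longrightarrow> norm x < \<eta> n" "\<And>n. (LINT x|lebesgue. \<psi> n x) = 1" by metis
  have intF: "integrable lebesgue F"
  proof -
    obtain M where "\<And>x. \<bar>F x\<bar> \<le> M" using lipschitz_gradientE[OF fg] by metis
    then show ?thesis using F by (intro integrable_bounded_support[OF meas(1), of M]) (auto simp: piecewise_affine_def)
  qed
  have intg: "integrable lebesgue (\<lambda>x. g x $ i)" for i
  proof (rule integrable_bounded_support)
    show "(\<lambda>x. g x $ i) \<in> borel_measurable lebesgue" by (rule measurable_compose[OF meas(2)]) simp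
    show "norm (g x $ i) \<le> B" for x using component_le_norm_cart[of "g x" i] L(4)[of x] by simp
    show "bounded {x. g x $ i \<noteq> 0}" unfolding bounded_iff
    proof (intro exI[of _ R] ballI)
      fix x assume "x \<in> {x. g x $ i \<noteq> 0}"
      then have "g x \<noteq> 0" by auto
      then show "norm x \<le> R" by (rule L(6))
    qed
  qed
  define \<Phi> where "\<Phi> = (\<lambda>n. convolution F (\<psi> n))"
  define G where "G = (\<lambda>n x. \<chi> i. partial_deriv i (\<Phi> n) x)"
  \<comment> \<open>Integration by parts in \<open>y\<close> moves the derivative from the mollifier
    to \<open>F\<close>: the gradient of the mollification is the mollified gradient.\<close>
  have G_eq: "G n x $ i = (LINT y|lebesgue. g y $ i * \<psi> n (x - y))" for n x i
  proof -
    have "partial_deriv i (\<lambda>y. \<psi> n (x - y)) y = - partial_deriv i (\<psi> n) (x - y)" for y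
      by (rule partial_deriv_reflect(1)[OF test_functionD(2)[OF \<psi>(1)]])
    then have "(LINT y|lebesgue. F y * partial_deriv i (\<psi> n) (x - y)) = (LINT y|lebesgue. g y $ i * \<psi> n (x - y))"
      using lipschitz_gradient_by_parts[OF fg test_function_reflect[OF \<psi>(1)], of i n x] by simp
    then show ?thesis by (simp add: G_def \<Phi>_def partial_deriv_convolution[OF intF \<psi>(1)] convolution_def)
  qed
  define K' where "K' = {x + y |x y. x \<in> K \<and> y \<in> cball 0 \<epsilon>}"
  have K': "compact K'" unfolding K'_def using K by (intro compact_sums) auto
  have "K' \<subseteq> \<Omega>"
  proof
    fix z assume "z \<in> K'"
    then obtain x y where "z = x + y" "x \<in> K" "norm y \<le> \<epsilon>" by (auto simp: K'_def)
    then have "z \<in> (\<Union>x\<in>K. cball x \<epsilon>)" by (auto intro!: bexI[of _ x] simp: dist_norm)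
    then show "z \<in> \<Omega>" using \<epsilon>(2) by blast
  qed
  have \<Phi>_sub: "{x. \<Phi> n x \<noteq> 0} \<subseteq> K'" for n
  proof
    fix x assume x: "x \<in> {x. \<Phi> n x \<noteq> 0}"
    have "\<exists>y. F y * \<psi> n (x - y) \<noteq> 0"
    proof (rule ccontr)
      assume "\<nexists>y. F y * \<psi> n (x - y) \<noteq> 0"
      then have "(\<lambda>y. F y * \<psi> n (x - y)) = (\<lambda>y. 0)" by blast
      then have "\<Phi> n x = 0" by (simp add: \<Phi>_def convolution_def)
      with x show False by simp
    qed
    then obtain y where y: "F y \<noteq> 0" "\<psi> n (x - y) \<noteq> 0" by auto
    then have "y \<in> K" "norm (x - y) \<le> \<epsilon>"
      using closure_subset[of "{x. F x \<noteq> 0}"] \<psi>(3)[OF y(2)] \<eta>(2)[of n] by (auto simp: K_def)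
    then show "x \<in> K'" unfolding K'_def by (intro CollectI exI[of _ y] exI[of _ "x - y"]) simp
  qed
  have tf: "test_function \<Omega> (\<Phi> n)" for n
  proof (rule test_functionI_support[OF _ _ K' \<open>K' \<subseteq> \<Omega>\<close>])
    show "Ck k (\<Phi> n)" for k unfolding \<Phi>_def by (rule Ck_convolution[OF intF \<psi>(1)])
    show "{x. \<Phi> n x \<noteq> 0} \<subseteq> K'" by (rule \<Phi>_sub)
  qed
  obtain R' where R': "\<And>x. x \<in> K' \<Longrightarrow> norm x \<le> R'" using K' compact_imp_bounded by (force simp: bounded_iff)
  have \<Phi>_supp: "\<Phi> n x = 0" "G n x = 0" if "R' < norm x" for n x
  proof -
    have "closure {x. \<Phi> n x \<noteq> 0} \<subseteq> K'" using K' \<Phi>_sub by (intro closure_minimal compact_imp_closed)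
    then have "x \<notin> closure {x. \<Phi> n x \<noteq> 0}" using that R' by force
    then show "\<Phi> n x = 0" "G n x = 0"
      using closure_subset[of "{x. \<Phi> n x \<noteq> 0}"] partial_deriv_zero_outside by (auto simp: G_def vec_eq_iff)
  qed
  have close: "\<bar>\<Phi> n x - F x\<bar> \<le> L * \<eta> n" for n x
    unfolding \<Phi>_def convolution_def
  proof (rule integral_bump_average[OF \<psi>])
    show "integrable lebesgue (\<lambda>y. F y * \<psi> n (x - y))" by (rule convolution_integrable[OF intF \<psi>(1)])
    show "\<bar>F y - F x\<bar> \<le> L * \<eta> n" if "norm (x - y) < \<eta> n" for y
      using L(3)[of y x] mult_left_mono[of "norm (x - y)" "\<eta> n" L] that L(1) by (simp add: norm_minus_commute)
  qed
  have G_bound: "norm (G n x) \<le> real CARD('n) * B" for n x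
  proof -
    have "\<bar>G n x $ i - 0\<bar> \<le> B" for i
      unfolding G_eq
    proof (rule integral_bump_average[OF \<psi> convolution_integrable[OF intg \<psi>(1)]])
      show "\<bar>g y $ i - 0\<bar> \<le> B" for y using component_le_norm_cart[of "g y" i] L(4)[of y] by simp
    qed
    then have "(\<Sum>i\<in>UNIV. \<bar>G n x $ i\<bar>) \<le> (\<Sum>i\<in>(UNIV :: 'n set). B)" by (intro sum_mono) simp
    then show ?thesis using norm_le_l1_cart[of "G n x"] by simp
  qed
  have G_lim: "(\<lambda>n. g x - G n x) \<longlonglongrightarrow> 0" if "locally_affine F x b" for x b
  proof -
    from locally_affine_open[OF that] obtain e where e: "0 < e" "\<And>y. y \<in> ball x e \<Longrightarrow> locally_affine F y b" by blast
    have gb: "g y = b" if "norm (x - y) < e" for y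
      using that e(2)[of y] unfolding g_def by (intro affine_gradient_eq) (simp add: dist_norm)
    have "\<forall>\<^sub>F n in sequentially. \<eta> n < e" using \<eta>_lim e(1) by (rule order_tendstoD)
    then have "\<forall>\<^sub>F n in sequentially. g x - G n x = 0"
    proof eventually_elim
      case (elim n)
      have "\<bar>G n x $ i - b $ i\<bar> \<le> 0" for i
        unfolding G_eq
        by (rule integral_bump_average[OF \<psi> convolution_integrable[OF intg \<psi>(1)]]) (use elim gb in auto)
      then show ?case using gb[of x] e(1) by (simp add: vec_eq_iff)
    qed
    then show ?thesis by (rule tendsto_eventually)
  qed
  have 1: "(\<lambda>n. norm (L2_class (\<lambda>x. F x - \<Phi> n x))) \<longlonglongrightarrow> 0"
  proof (rule tendsto_L2_zero(2)[where B = "L * \<epsilon>" and R = "max R R'"])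
    show "(\<lambda>x. F x - \<Phi> n x) \<in> borel_measurable lebesgue" for n
      using square_integrable_measurable[OF square_integrable_test_function(1)[OF tf]] by measurable
    show "norm (F x - \<Phi> n x) \<le> L * \<epsilon>" for n x
      using close[of n x] mult_left_mono[OF \<eta>(2) L(1), of n] by (simp add: abs_minus_commute)
    show "norm x \<le> max R R'" if "F x - \<Phi> n x \<noteq> 0" for n x
      using that L(5)[of x] \<Phi>_supp(1)[of x n] by (cases "F x = 0"; cases "R' < norm x") auto
    show "AE x in lebesgue. (\<lambda>n. F x - \<Phi> n x) \<longlonglongrightarrow> 0"
    proof (rule AE_I2, rule Lim_null_comparison)
      show "(\<lambda>n. L * \<eta> n) \<longlonglongrightarrow> 0" using tendsto_mult_right_zero[OF \<eta>_lim] .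
      show "\<forall>\<^sub>F n in sequentially. norm (F x - \<Phi> n x) \<le> L * \<eta> n" for x
        using close by (simp add: abs_minus_commute)
    qed
  qed
  have 2: "(\<lambda>n. norm (L2_class (\<lambda>x. g x - G n x))) \<longlonglongrightarrow> 0"
  proof (rule tendsto_L2_zero(2)[where B = "B + real CARD('n) * B" and R = "max R R'"])
    show "(\<lambda>x. g x - G n x) \<in> borel_measurable lebesgue" for n
      using square_integrable_measurable[OF square_integrable_test_function(3)[OF tf]] unfolding G_def by measurable
    show "norm (g x - G n x) \<le> B + real CARD('n) * B" for n x
      using norm_triangle_ineq4[of "g x" "G n x"] L(4)[of x] G_bound[of n x] by simp
    show "norm x \<le> max R R'" if "g x - G n x \<noteq> 0" for n x
      using that L(6)[of x] \<Phi>_supp(2)[of x n] by (cases "g x = 0"; cases "R' < norm x") auto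
    have "AE x in lebesgue. \<exists>b. locally_affine F x b" using F by (simp add: piecewise_affine_def)
    then show "AE x in lebesgue. (\<lambda>n. g x - G n x) \<longlonglongrightarrow> 0"
      by eventually_elim (use G_lim in blast)
  qed
  show ?thesis
    unfolding H01_iff
  proof (intro exI[of _ "L2_class g"] conjI allI impI)
    show "weak_gradient (L2_class F) (L2_class g)" by (rule lipschitz_gradient_weak_gradient[OF fg])
    fix e :: real assume "0 < e"
    from L2_small[OF 1 this] L2_small[OF 2 this] obtain n where
      "norm (L2_class (\<lambda>x. F x - \<Phi> n x)) < e" "norm (L2_class (\<lambda>x. g x - G n x)) < e"
      by (meson nat_le_linear order_refl)
    then show "\<exists>\<phi>. test_function \<Omega> \<phi> \<and> norm (L2_class F - L2_class \<phi>) < e \<and> norm (L2_class g - test_gradient \<phi>) < e"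
      using tf[of n] unfolding test_gradient_def G_def
      by (intro exI[of _ "\<Phi> n"]) (simp add: L2_class_diff sq square_integrable_test_function[OF tf])
  qed
qed

text \<open>The shrinkage map: zero on [-\<epsilon>, \<epsilon>] and of slope 1 beyond. For
  continuous \<open>f\<close> vanishing off \<Omega>, the support of the composition lies in the
  closed set where |f| >= \<epsilon>, a subset of \<Omega>.\<close>

definition soft_threshold :: "real \<Rightarrow> real \<Rightarrow> real" where
  "soft_threshold \<epsilon> s = max (s - \<epsilon>) 0 + min (s + \<epsilon>) 0"

text \<open>Near a point where \<open>f\<close> is affine with nonzero gradient, a level set is part
  of a hyperplane, and locally negligible sets are negligible. The levels \<epsilon> and -\<epsilon>
  handle the kinks of the threshold, level 0 the limit of the gradients.\<close>

lemma AE_level_set: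
  fixes f :: "'a::euclidean_space \<Rightarrow> real"
  shows "AE x in lebesgue. \<forall>b. locally_affine f x b \<longrightarrow> f x = s \<longrightarrow> b = 0"
proof -
  define N where "N = {x. \<exists>b. locally_affine f x b \<and> f x = s \<and> b \<noteq> 0}"
  have "negligible N"
  proof (rule locally_negligible_alt[THEN iffD2], rule ballI)
    fix x assume "x \<in> N"
    then obtain b where b: "locally_affine f x b" "f x = s" "b \<noteq> 0" unfolding N_def by blast
    then obtain e where e: "0 < e" "\<And>y. y \<in> ball x e \<Longrightarrow> f y = f x + b \<bullet> (y - x)"
      unfolding locally_affine_def by blast
    have "N \<inter> ball x e \<subseteq> {y. b \<bullet> y = b \<bullet> x}"
    proof
      fix y assume y: "y \<in> N \<inter> ball x e"
      then have "f y = s" by (auto simp: N_def)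
      then show "y \<in> {y. b \<bullet> y = b \<bullet> x}" using e(2)[of y] y b(2) by (simp add: inner_diff_right)
    qed
    then have "negligible (N \<inter> ball x e)"
      using negligible_hyperplane[of b "b \<bullet> x"] b(3) negligible_subset by blast
    then show "\<exists>U. openin (top_of_set N) U \<and> x \<in> U \<and> negligible U"
      using \<open>x \<in> N\<close> e(1) by (intro exI[of _ "N \<inter> ball x e"]) (auto intro: openin_open_Int)
  qed
  then have "AE x in lebesgue. x \<notin> N" by (intro AE_not_in) (simp add: negligible_iff_null_sets)
  then show ?thesis by eventually_elim (auto simp: N_def)
qed

text \<open>At a kink, where |f x| = \<epsilon>, the hypothesis \<open>level\<close> makes
  \<open>f\<close> constant near \<open>x\<close>; elsewhere continuity keeps \<open>f\<close>
  within one linear branch of the threshold.\<close>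

lemma soft_threshold_locally_affine:
  fixes f :: "'a::euclidean_space \<Rightarrow> real"
  assumes f: "locally_affine f x b" and "continuous_on UNIV f" and \<epsilon>: "0 < \<epsilon>"
    and level: "f x = \<epsilon> \<or> f x = - \<epsilon> \<Longrightarrow> b = 0"
  shows "locally_affine (\<lambda>x. soft_threshold \<epsilon> (f x)) x (if \<epsilon> < \<bar>f x\<bar> then b else 0)"
proof -
  obtain e where e: "0 < e" "\<And>y. y \<in> ball x e \<Longrightarrow> f y = f x + b \<bullet> (y - x)"
    using f unfolding locally_affine_def by blast
  have *: ?thesis if "open U" "x \<in> U" "\<And>y. y \<in> ball x e \<inter> U \<Longrightarrow>
      soft_threshold \<epsilon> (f y) = soft_threshold \<epsilon> (f x) + (if \<epsilon> < \<bar>f x\<bar> then b else 0) \<bullet> (y - x)" for U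
  proof -
    have "x \<in> ball x e \<inter> U" using e(1) that by simp
    then obtain d where "0 < d" "ball x d \<subseteq> ball x e \<inter> U"
      using openE[of "ball x e \<inter> U" x] \<open>open U\<close> by auto
    then show ?thesis unfolding locally_affine_def using that(3) by blast
  qed
  note opn = open_vimage[OF _ assms(2)]
  consider "\<epsilon> < f x" | "f x < - \<epsilon>" | "\<bar>f x\<bar> < \<epsilon>" | "b = 0" "\<bar>f x\<bar> = \<epsilon>" using level by linarith
  then show ?thesis
  proof cases
    case 1
    show ?thesis
    proof (rule *[of "f -` {\<epsilon><..}"])
      fix y assume y: "y \<in> ball x e \<inter> f -` {\<epsilon><..}"
      then have "\<epsilon> < f y" by simp
      then show "soft_threshold \<epsilon> (f y) = soft_threshold \<epsilon> (f x) + (if \<epsilon> < \<bar>f x\<bar> then b else 0) \<bullet> (y - x)"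
        using 1 \<epsilon> e(2)[of y] y by (simp add: soft_threshold_def)
    qed (use 1 opn in auto)
  next
    case 2
    show ?thesis
    proof (rule *[of "f -` {..<-\<epsilon>}"])
      fix y assume y: "y \<in> ball x e \<inter> f -` {..<-\<epsilon>}"
      then have "f y < - \<epsilon>" by simp
      then show "soft_threshold \<epsilon> (f y) = soft_threshold \<epsilon> (f x) + (if \<epsilon> < \<bar>f x\<bar> then b else 0) \<bullet> (y - x)"
        using 2 \<epsilon> e(2)[of y] y by (simp add: soft_threshold_def)
    qed (use 2 opn in auto)
  next
    case 3
    show ?thesis
    proof (rule *[of "f -` {-\<epsilon><..<\<epsilon>}"])
      fix y assume y: "y \<in> ball x e \<inter> f -` {-\<epsilon><..<\<epsilon>}"
      then have "- \<epsilon> < f y" "f y < \<epsilon>" by auto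
      then show "soft_threshold \<epsilon> (f y) = soft_threshold \<epsilon> (f x) + (if \<epsilon> < \<bar>f x\<bar> then b else 0) \<bullet> (y - x)"
        using 3 \<epsilon> by (auto simp: soft_threshold_def)
    qed (use 3 opn in auto)
  next
    case 4
    show ?thesis by (rule *[of UNIV]) (use 4 e(2) in auto)
  qed
qed

lemma soft_threshold_lipschitz: "0 \<le> \<epsilon> \<Longrightarrow> \<bar>soft_threshold \<epsilon> s - soft_threshold \<epsilon> t\<bar> \<le> \<bar>s - t\<bar>"
  by (simp add: soft_threshold_def max_def min_def)

lemma soft_threshold_close: "0 \<le> \<epsilon> \<Longrightarrow> \<bar>s - soft_threshold \<epsilon> s\<bar> \<le> \<epsilon>"
  by (simp add: soft_threshold_def max_def min_def abs_le_iff)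

lemma soft_threshold_nonzero: "0 \<le> \<epsilon> \<Longrightarrow> soft_threshold \<epsilon> s \<noteq> 0 \<Longrightarrow> \<epsilon> < \<bar>s\<bar>"
  by (auto simp: soft_threshold_def max_def min_def split: if_splits)

lemma piecewise_affine_soft_threshold:
  fixes f :: "real^'n::finite \<Rightarrow> real"
  assumes f: "piecewise_affine f" and \<epsilon>: "0 < \<epsilon>"
  shows "piecewise_affine (\<lambda>x. soft_threshold \<epsilon> (f x))"
    "AE x in lebesgue. affine_gradient (\<lambda>x. soft_threshold \<epsilon> (f x)) x = (if \<epsilon> < \<bar>f x\<bar> then affine_gradient f x else 0)"
proof -
  have cont: "continuous_on UNIV f"
    by (rule lipschitz_gradient_continuous[OF piecewise_affine_lipschitz_gradient[OF f]])
  have ae: "AE x in lebesgue. \<exists>b. locally_affine f x b \<and>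
      locally_affine (\<lambda>x. soft_threshold \<epsilon> (f x)) x (if \<epsilon> < \<bar>f x\<bar> then b else 0)"
  proof -
    have "AE x in lebesgue. \<exists>b. locally_affine f x b" using f by (simp add: piecewise_affine_def)
    with AE_level_set[of f \<epsilon>] AE_level_set[of f "- \<epsilon>"] show ?thesis
    proof eventually_elim
      case (elim x)
      then obtain b where b: "locally_affine f x b" by blast
      show ?case using soft_threshold_locally_affine[OF b cont \<epsilon>] elim b by blast
    qed
  qed
  then show "AE x in lebesgue. affine_gradient (\<lambda>x. soft_threshold \<epsilon> (f x)) x = (if \<epsilon> < \<bar>f x\<bar> then affine_gradient f x else 0)"
  proof eventually_elim
    case (elim x)
    then obtain b where b: "locally_affine f x b"
      "locally_affine (\<lambda>x. soft_threshold \<epsilon> (f x)) x (if \<epsilon> < \<bar>f x\<bar> then b else 0)" by blast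
    show ?case by (simp only: affine_gradient_eq[OF b(1)] affine_gradient_eq[OF b(2)])
  qed
  obtain L where L: "0 \<le> L" "\<And>x y. \<bar>f x - f y\<bar> \<le> L * norm (x - y)" using f by (auto simp: piecewise_affine_def)
  have "\<bar>soft_threshold \<epsilon> (f x) - soft_threshold \<epsilon> (f y)\<bar> \<le> L * norm (x - y)" for x y
    using soft_threshold_lipschitz[of \<epsilon> "f x" "f y"] L(2)[of x y] \<epsilon> by simp
  moreover have "bounded {x. soft_threshold \<epsilon> (f x) \<noteq> 0}"
  proof (rule bounded_subset)
    show "bounded {x. f x \<noteq> 0}" using f by (simp add: piecewise_affine_def)
    show "{x. soft_threshold \<epsilon> (f x) \<noteq> 0} \<subseteq> {x. f x \<noteq> 0}"
      using soft_threshold_nonzero[of \<epsilon>] \<epsilon> by force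
  qed
  ultimately show "piecewise_affine (\<lambda>x. soft_threshold \<epsilon> (f x))"
    unfolding piecewise_affine_def using ae L(1) by (auto elim: eventually_mono)
qed

text \<open>The gradients of the thresholded functions are \<open>g\<close> cut off to |f| >
  \<open>\<epsilon> n\<close>. They converge to \<open>g\<close> where \<open>f\<close> is nonzero,
  and where \<open>f\<close> is zero, \<open>g\<close> vanishes almost everywhere by
  \<open>AE_level_set\<close>.\<close>

lemma piecewise_affine_H01:
  fixes f :: "real^'n::finite \<Rightarrow> real"
  assumes f: "piecewise_affine f" and "open \<Omega>" and zero: "\<And>x. x \<notin> \<Omega> \<Longrightarrow> f x = 0"
  shows "L2_class f \<in> H01 \<Omega>"
proof -
  define g where "g = affine_gradient f"
  have fg: "lipschitz_gradient f g" unfolding g_def by (rule piecewise_affine_lipschitz_gradient[OF f])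
  have cont: "continuous_on UNIV f" by (rule lipschitz_gradient_continuous[OF fg])
  obtain L' B R where "0 \<le> L'" "\<And>x y. \<bar>f x - f y\<bar> \<le> L' * norm (x - y)" "\<And>x. \<bar>f x\<bar> \<le> B"
    and B: "0 \<le> B" "\<And>x. norm (g x) \<le> B"
    and R: "\<And>x. f x \<noteq> 0 \<Longrightarrow> norm x \<le> R" "\<And>x. g x \<noteq> 0 \<Longrightarrow> norm x \<le> R"
    using lipschitz_gradientE[OF fg] by metis
  note sq = lipschitz_gradient_square_integrable[OF fg]
  note [measurable] = lipschitz_gradient_measurable[OF fg]
  define \<epsilon> where "\<epsilon> = (\<lambda>n. inverse (real (Suc n)))"
  have \<epsilon>: "0 < \<epsilon> n" "\<epsilon> n \<le> 1" for n by (auto simp: \<epsilon>_def inverse_le_1_iff)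
  have \<epsilon>_lim: "\<epsilon> \<longlonglongrightarrow> 0" unfolding \<epsilon>_def by (rule LIMSEQ_inverse_real_of_nat)
  define F where "F = (\<lambda>n x. soft_threshold (\<epsilon> n) (f x))"
  define G where "G = (\<lambda>n. affine_gradient (F n))"
  have F: "piecewise_affine (F n)" for n
    unfolding F_def by (rule piecewise_affine_soft_threshold(1)[OF f \<epsilon>(1)])
  have FG: "lipschitz_gradient (F n) (G n)" for n
    unfolding G_def by (rule piecewise_affine_lipschitz_gradient[OF F])
  note sqF = lipschitz_gradient_square_integrable[OF FG]
  have F_H01: "L2_class (F n) \<in> H01 \<Omega>" for n
  proof (rule piecewise_affine_compact_support_H01[OF F \<open>open \<Omega>\<close>])
    have "closure {x. F n x \<noteq> 0} \<subseteq> {x. \<epsilon> n \<le> \<bar>f x\<bar>}"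
    proof (rule closure_minimal)
      show "{x. F n x \<noteq> 0} \<subseteq> {x. \<epsilon> n \<le> \<bar>f x\<bar>}"
        unfolding F_def using soft_threshold_nonzero[of "\<epsilon> n"] \<epsilon>(1)[of n] by fastforce
      show "closed {x. \<epsilon> n \<le> \<bar>f x\<bar>}"
        by (intro closed_Collect_le continuous_intros cont)
    qed
    also have "\<dots> \<subseteq> \<Omega>" using zero \<epsilon>(1)[of n] by force
    finally show "closure {x. F n x \<noteq> 0} \<subseteq> \<Omega>" .
  qed
  have gradF: "grad (L2_class (F n)) = L2_class (G n)" for n
    by (rule grad_eq[OF lipschitz_gradient_weak_gradient[OF FG]])
  have Gae: "AE x in lebesgue. G n x = (if \<epsilon> n < \<bar>f x\<bar> then g x else 0)" for n
    unfolding G_def F_def g_def by (rule piecewise_affine_soft_threshold(2)[OF f \<epsilon>(1)])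
  have 1: "(\<lambda>n. norm (L2_class (\<lambda>x. F n x - f x))) \<longlonglongrightarrow> 0"
  proof (rule tendsto_L2_zero(2)[where B = 1 and R = R])
    show "(\<lambda>x. F n x - f x) \<in> borel_measurable lebesgue" for n
      using lipschitz_gradient_measurable(1)[OF FG[of n]] by measurable
    show "norm (F n x - f x) \<le> 1" for n x
      using soft_threshold_close[of "\<epsilon> n" "f x"] \<epsilon>[of n] by (simp add: F_def abs_minus_commute)
    show "norm x \<le> R" if "F n x - f x \<noteq> 0" for n x
      using that \<epsilon>(1)[of n] by (intro R(1)) (auto simp: F_def soft_threshold_def)
    show "AE x in lebesgue. (\<lambda>n. F n x - f x) \<longlonglongrightarrow> 0"
    proof (rule AE_I2, rule Lim_null_comparison[OF _ \<epsilon>_lim])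
      show "\<forall>\<^sub>F n in sequentially. norm (F n x - f x) \<le> \<epsilon> n" for x
        using soft_threshold_close[OF less_imp_le[OF \<epsilon>(1)]] by (simp add: F_def abs_minus_commute)
    qed
  qed
  \<comment> \<open>\<open>G n - g\<close> is known only almost everywhere; \<open>D n\<close> is a
    representative with the pointwise bound and support that \<open>tendsto_L2_zero\<close> asks
    for.\<close>
  define D where "D = (\<lambda>n x. (if \<epsilon> n < \<bar>f x\<bar> then g x else 0) - g x)"
  have D_meas: "D n \<in> borel_measurable lebesgue" for n
    unfolding D_def by measurable
  have D_bound: "norm (D n x) \<le> B" for n x using B(1) B(2)[of x] by (simp add: D_def)
  have D_supp: "norm x \<le> R" if "D n x \<noteq> 0" for n x
    using that by (intro R(2)) (auto simp: D_def split: if_splits)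
  have D_lim: "AE x in lebesgue. (\<lambda>n. D n x) \<longlonglongrightarrow> 0"
  proof -
    have "AE x in lebesgue. \<exists>b. locally_affine f x b" using f by (simp add: piecewise_affine_def)
    with AE_level_set[of f 0] show ?thesis
    proof eventually_elim
      case (elim x)
      show ?case
      proof (cases "f x = 0")
        case True
        then have "g x = 0" using elim affine_gradient_eq unfolding g_def by metis
        then have "(\<lambda>n. D n x) = (\<lambda>n. 0)" by (auto simp: D_def)
        then show ?thesis by simp
      next
        case False
        then have "\<forall>\<^sub>F n in sequentially. \<epsilon> n < \<bar>f x\<bar>" using \<epsilon>_lim by (intro order_tendstoD) auto
        then have "\<forall>\<^sub>F n in sequentially. D n x = 0" by eventually_elim (simp add: D_def)
        then show ?thesis by (rule tendsto_eventually)
      qed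
    qed
  qed
  note D = tendsto_L2_zero[OF D_meas D_bound D_supp D_lim]
  have "L2_class (\<lambda>x. G n x - g x) = L2_class (D n)" for n
    by (rule L2_class_eqI[OF square_integrable_diff[OF sqF(2) sq(2)] D(1)])
      (use Gae[of n] in \<open>auto simp: D_def elim: eventually_mono\<close>)
  then have 2: "(\<lambda>n. norm (L2_class (\<lambda>x. G n x - g x))) \<longlonglongrightarrow> 0" using D(2) by simp
  show ?thesis
  proof (rule H01_limit(1)[OF F_H01])
    show "(\<lambda>n. L2_class (F n)) \<longlonglongrightarrow> L2_class f"
      using 1 unfolding L2_class_diff[OF sqF(1) sq(1)] by (simp add: LIM_zero_iff tendsto_norm_zero_iff)
    show "(\<lambda>n. grad (L2_class (F n))) \<longlonglongrightarrow> L2_class g"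
      using 2 unfolding gradF L2_class_diff[OF sqF(2) sq(2)] by (simp add: LIM_zero_iff tendsto_norm_zero_iff)
  qed
qed

section \<open>Finite element functions\<close>

lemma affine_agree_convex_hull:
  fixes b b' :: "'a::euclidean_space"
  assumes "\<And>x. x \<in> C \<Longrightarrow> b \<bullet> x + c = b' \<bullet> x + c'" "x \<in> convex hull C"
  shows "b \<bullet> x + c = b' \<bullet> x + c'"
proof -
  have "{x. b \<bullet> x + c = b' \<bullet> x + c'} = {x. (b - b') \<bullet> x = c' - c}"
    by (auto simp: inner_diff_left)
  then have "convex {x. b \<bullet> x + c = b' \<bullet> x + c'}" by (simp add: convex_hyperplane)
  then have "convex hull C \<subseteq> {x. b \<bullet> x + c = b' \<bullet> x + c'}"
    using assms(1) by (intro hull_minimal) auto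
  then show ?thesis using assms(2) by blast
qed

text \<open>By Krein-Milman an affine function on a compact convex set is fixed by its values at the
  extreme points. \<open>F\<close> will be a whole element, the intersection of two elements or a
  boundary facet.\<close>

lemma affine_agree_face:
  assumes "F \<subseteq> K" "compact F" "convex F" "affine_function_on K f" "F \<subseteq> K'" "affine_function_on K' g"
    and "\<And>x. x extreme_point_of F \<Longrightarrow> f x = g x" "x \<in> F"
  shows "f x = g x"
proof -
  obtain b c b' c' where f: "\<And>x. x \<in> K \<Longrightarrow> f x = b \<bullet> x + c" and g: "\<And>x. x \<in> K' \<Longrightarrow> g x = b' \<bullet> x + c'"
    using assms(4,6) unfolding affine_function_on_def by blast
  have "b \<bullet> x + c = b' \<bullet> x + c'"
  proof (rule affine_agree_convex_hull[where C = "{x. x extreme_point_of F}"])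
    show "x \<in> convex hull {x. x extreme_point_of F}"
      using Krein_Milman_Minkowski[OF assms(2,3)] \<open>x \<in> F\<close> by simp
    fix y assume "y \<in> {x. x extreme_point_of F}"
    then have "f y = g y" "y \<in> K" "y \<in> K'" using assms(1,5,7) by (auto simp: extreme_point_of_def)
    then show "b \<bullet> y + c = b' \<bullet> y + c'" using f[of y] g[of y] by metis
  qed
  moreover have "x \<in> K" "x \<in> K'" using \<open>x \<in> F\<close> assms(1,5) by auto
  ultimately show ?thesis using f[of x] g[of x] by metis
qed

text \<open>The differences from one vertex \<open>c0\<close> are linearly independent, so a linear
  functional with prescribed values on them exists; \<open>b\<close> represents it.\<close>

lemma affine_interpolation:
  fixes C :: "'a::euclidean_space set"
  assumes "\<not> affine_dependent C"
  shows "\<exists>b c. \<forall>x\<in>C. b \<bullet> x + c = v x"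
proof (cases "C = {}")
  case False
  then obtain c0 where c0: "c0 \<in> C" by blast
  then have "C = insert c0 (C - {c0})" by blast
  then have "independent ((\<lambda>x. - c0 + x) ` (C - {c0}))"
    using affine_dependent_iff_dependent[of c0 "C - {c0}"] assms by auto
  then obtain g where g: "linear g" "\<forall>x\<in>(\<lambda>x. - c0 + x) ` (C - {c0}). g x = v (c0 + x) - v c0"
    using linear_independent_extend[of _ "\<lambda>x. v (c0 + x) - v c0"] by blast
  define b where "b = adjoint g 1"
  have gb: "g x = b \<bullet> x" for x
    using adjoint_works[OF g(1), of x 1] by (simp add: inner_commute b_def)
  have "b \<bullet> x + (v c0 - b \<bullet> c0) = v x" if "x \<in> C" for x
  proof (cases "x = c0")
    case False
    then have "g (- c0 + x) = v x - v c0" using g(2) that by auto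
    then show ?thesis unfolding gb by (simp add: inner_diff_right)
  qed simp
  then show ?thesis by blast
qed auto

text \<open>The claim is moved to the parameter interval of the segment from \<open>x\<close> to
  \<open>y\<close>, which the preimages of finitely many closed sets cover. These sets may be
  nonconvex, like the complement of \<Omega> in the application.\<close>

lemma lipschitz_piecewise:
  fixes f :: "'a::euclidean_space \<Rightarrow> real"
  assumes "finite \<S>" "\<And>S. S \<in> \<S> \<Longrightarrow> closed S" "\<Union>\<S> = UNIV" "0 \<le> L"
    and lip: "\<And>S x y. S \<in> \<S> \<Longrightarrow> x \<in> S \<Longrightarrow> y \<in> S \<Longrightarrow> \<bar>f x - f y\<bar> \<le> L * norm (x - y)"
  shows "\<bar>f x - f y\<bar> \<le> L * norm (x - y)"
proof -
  define \<gamma> where "\<gamma> = (\<lambda>t. x + t *\<^sub>R (y - x))"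
  have "(L * norm (y - x))-lipschitz_on {0..1} (\<lambda>t. f (\<gamma> t))"
  proof (rule lipschitz_on_closed_Union[where I = \<S> and U = "\<lambda>S. \<gamma> -` S"])
    fix S assume S: "S \<in> \<S>"
    show "closed (\<gamma> -` S)"
      using assms(2)[OF S] by (intro closed_vimage) (auto simp: \<gamma>_def intro!: continuous_intros)
    show "(L * norm (y - x))-lipschitz_on (\<gamma> -` S) (\<lambda>t. f (\<gamma> t))"
    proof (rule lipschitz_onI)
      fix s t assume "s \<in> \<gamma> -` S" "t \<in> \<gamma> -` S"
      then have "\<bar>f (\<gamma> s) - f (\<gamma> t)\<bar> \<le> L * norm (\<gamma> s - \<gamma> t)" using lip[OF S] by simp
      also have "\<gamma> s - \<gamma> t = (s - t) *\<^sub>R (y - x)" by (simp add: \<gamma>_def algebra_simps)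
      finally show "dist (f (\<gamma> s)) (f (\<gamma> t)) \<le> L * norm (y - x) * dist s t"
        by (simp add: dist_real_def mult_ac)
    qed (use assms(4) in simp)
  next
    show "{0..1} \<subseteq> (\<Union>S\<in>\<S>. \<gamma> -` S)" using assms(3) by blast
  qed (use assms in auto)
  from lipschitz_onD[OF this, of 0 1] show ?thesis
    by (simp add: \<gamma>_def dist_real_def norm_minus_commute)
qed

section \<open>Nodal interpolation on a conforming mesh\<close>

locale fe_mesh =
  fixes \<T> :: "(real^'n::finite) set set" and \<Omega> :: "(real^'n) set"
  assumes mesh: "triangulates \<T> \<Omega>" and \<Omega>: "open \<Omega>" "bounded \<Omega>"
begin

lemma finite_\<T>: "finite \<T>"
  using mesh by (simp add: triangulates_def triangulation_def)

lemma Union_\<T>: "\<Union>\<T> = closure \<Omega>"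
  using mesh by (simp add: triangulates_def)

lemma simplex_\<T>: "K \<in> \<T> \<Longrightarrow> int CARD('n) simplex K"
  using mesh by (simp add: triangulates_def)

lemma \<T>_props: "K \<in> \<T> \<Longrightarrow> compact K" "K \<in> \<T> \<Longrightarrow> convex K" "K \<in> \<T> \<Longrightarrow> closed K"
  using simplex_\<T> compact_simplex convex_simplex closed_simplex by blast+

lemma face_Int: "K \<in> \<T> \<Longrightarrow> K' \<in> \<T> \<Longrightarrow> (K \<inter> K') face_of K"
  using mesh by (simp add: triangulates_def triangulation_def)

lemma finite_vertices: "finite (vertices \<T>)"
proof -
  have "vertices \<T> = (\<Union>K\<in>\<T>. {x. x extreme_point_of K})" by (auto simp: vertices_def)
  then show ?thesis
    using finite_\<T> simplex_\<T> simplex_imp_polyhedron finite_polyhedron_extreme_points by fastforce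
qed

text \<open>The characterisation inside \<open>hat\<close>, with arbitrary nodal values. It serves
  to show that \<open>hat\<close> is well defined and to compare a finite element function with its
  nodal expansion.\<close>

definition interpolates :: "(real^'n \<Rightarrow> real) \<Rightarrow> (real^'n \<Rightarrow> real) \<Rightarrow> bool" where
  "interpolates v \<phi> \<longleftrightarrow> continuous_on (\<Union>\<T>) \<phi> \<and> (\<forall>K\<in>\<T>. affine_function_on K \<phi>) \<and>
     (\<forall>y\<in>vertices \<T>. \<phi> y = v y) \<and> (\<forall>y. y \<notin> \<Union>\<T> \<longrightarrow> \<phi> y = 0)"

lemma interpolates_unique:
  assumes "interpolates v \<phi>" "interpolates v \<psi>"
  shows "\<phi> = \<psi>"
proof
  fix x
  show "\<phi> x = \<psi> x"
  proof (cases "x \<in> \<Union>\<T>")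
    case True
    then obtain K where K: "K \<in> \<T>" "x \<in> K" by blast
    show ?thesis
    proof (rule affine_agree_face[OF subset_refl \<T>_props(1,2)[OF K(1)] _ subset_refl])
      show "affine_function_on K \<phi>" "affine_function_on K \<psi>"
        using assms K(1) by (auto simp: interpolates_def)
      fix y assume "y extreme_point_of K"
      then have "y \<in> vertices \<T>" using K(1) by (auto simp: vertices_def)
      then show "\<phi> y = \<psi> y" using assms by (simp add: interpolates_def)
    qed (rule K)
  qed (use assms in \<open>simp add: interpolates_def\<close>)
qed

text \<open>The affine interpolants on the elements fit together: extreme points of the common face
  \<open>K \<inter> K'\<close> are vertices of both elements, where the values agree, and
  \<open>affine_agree_face\<close> extends this to the face.\<close>

lemma interpolates_exists: "\<exists>\<phi>. interpolates v \<phi>"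
proof -
  have "\<exists>b c. \<forall>x. x extreme_point_of K \<longrightarrow> b \<bullet> x + c = v x" if K: "K \<in> \<T>" for K
  proof -
    obtain C where C: "\<not> affine_dependent C" "K = convex hull C"
      using simplex_\<T>[OF K] unfolding simplex_def by blast
    then show ?thesis
      using affine_interpolation[OF C(1), of v] extreme_point_of_convex_hull_affine_independent[OF C(1)] by metis
  qed
  then obtain b c where bc: "\<And>K x. K \<in> \<T> \<Longrightarrow> x extreme_point_of K \<Longrightarrow> b K \<bullet> x + c K = v x" by metis
  have agree: "b K \<bullet> x + c K = b K' \<bullet> x + c K'" if K: "K \<in> \<T>" "K' \<in> \<T>" "x \<in> K" "x \<in> K'" for K K' x
  proof (rule affine_agree_face[where F = "K \<inter> K'" and K = K and K' = K'])
    show "compact (K \<inter> K')" "convex (K \<inter> K')" using K \<T>_props by (auto intro: convex_Int)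
    show "affine_function_on K (\<lambda>x. b K \<bullet> x + c K)" "affine_function_on K' (\<lambda>x. b K' \<bullet> x + c K')"
      by (auto simp: affine_function_on_def)
    fix y assume y: "y extreme_point_of K \<inter> K'"
    have "y extreme_point_of K" "y extreme_point_of K'"
      using y extreme_point_of_face[OF face_Int[OF K(1,2)]] extreme_point_of_face[OF face_Int[OF K(2,1)]]
      by (auto simp: Int_commute)
    then show "b K \<bullet> y + c K = b K' \<bullet> y + c K'" using bc K by simp
  qed (use K in auto)
  define \<phi> where "\<phi> = (\<lambda>x. if x \<in> \<Union>\<T> then (let K = SOME K. K \<in> \<T> \<and> x \<in> K in b K \<bullet> x + c K) else 0)"
  have \<phi>: "\<phi> x = b K \<bullet> x + c K" if K: "K \<in> \<T>" "x \<in> K" for K x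
  proof -
    define K' where "K' = (SOME K. K \<in> \<T> \<and> x \<in> K)"
    have "K' \<in> \<T> \<and> x \<in> K'" unfolding K'_def by (rule someI[of _ K]) (use K in simp)
    moreover have "\<phi> x = b K' \<bullet> x + c K'" using K by (auto simp: \<phi>_def K'_def Let_def)
    ultimately show ?thesis using agree K by metis
  qed
  have "continuous_on (\<Union>K\<in>\<T>. K) \<phi>"
  proof (rule continuous_on_closed_Union[OF finite_\<T> \<T>_props(3)])
    fix K assume "K \<in> \<T>"
    then show "continuous_on K \<phi>"
      by (subst continuous_on_cong[OF refl \<phi>]) (auto intro!: continuous_intros)
  qed
  moreover have "affine_function_on K \<phi>" if "K \<in> \<T>" for K
    using \<phi>[OF that] by (auto simp: affine_function_on_def)
  moreover have "\<phi> y = v y" if "y \<in> vertices \<T>" for y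
  proof -
    from that obtain K where "K \<in> \<T>" "y extreme_point_of K" by (auto simp: vertices_def)
    then show ?thesis using \<phi>[of K y] bc[of K y] by (auto simp: extreme_point_of_def)
  qed
  moreover have "\<phi> y = 0" if "y \<notin> \<Union>\<T>" for y using that by (simp add: \<phi>_def)
  ultimately show ?thesis unfolding interpolates_def by auto
qed

lemma interpolates_hat: "interpolates (\<lambda>y. if y = x then 1 else 0) (hat \<T> x)"
proof -
  have "\<exists>!\<phi>. interpolates (\<lambda>y. if y = x then 1 else 0) \<phi>"
    using interpolates_exists interpolates_unique by blast
  from theI'[OF this] show ?thesis
    unfolding hat_def interpolates_def .
qed

definition fe_function :: "(real^'n \<Rightarrow> real) \<Rightarrow> bool" where
  "fe_function f \<longleftrightarrow> continuous_on (closure \<Omega>) f \<and> (\<forall>K\<in>\<T>. affine_function_on K f) \<and> (\<forall>x. x \<notin> \<Omega> \<longrightarrow> f x = 0)"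

lemma fe_space_eq: "fe_space \<T> \<Omega> = L2_class ` Collect fe_function"
  unfolding fe_space_def by (rule arg_cong[where f = "image L2_class"]) (auto simp: fe_function_def)

text \<open>By the boundary condition in \<open>triangulates\<close>, each frontier point lies on an
  element facet contained in the frontier. The point \<open>x\<close> of \<Omega> is no vertex of
  that facet, so \<open>hat\<close> is zero at its extreme points and therefore on all of
  it.\<close>

lemma fe_function_hat:
  assumes x: "x \<in> \<Omega>"
  shows "fe_function (hat \<T> x)"
proof -
  note h = interpolates_hat[of x, unfolded interpolates_def]
  have "hat \<T> x y = 0" if y: "y \<notin> \<Omega>" for y
  proof (cases "y \<in> \<Union>\<T>")
    case True
    then have "y \<in> frontier \<Omega>" using y \<Omega>(1) by (simp add: Union_\<T> frontier_def interior_open)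
    moreover obtain \<F> where \<F>: "\<forall>F\<in>\<F>. \<exists>K\<in>\<T>. F facet_of K" "frontier \<Omega> = \<Union>\<F>"
      using mesh by (auto simp: triangulates_def)
    ultimately have "y \<in> \<Union>\<F>" by simp
    then obtain F where "F \<in> \<F>" "y \<in> F" by blast
    then obtain K where F: "y \<in> F" "F \<subseteq> frontier \<Omega>" "K \<in> \<T>" "F facet_of K"
      using \<F> by blast
    have face: "F face_of K" by (rule facet_of_imp_face_of[OF F(4)])
    have "F \<subseteq> K" by (rule face_of_imp_subset[OF face])
    show ?thesis
    proof (rule affine_agree_face[OF \<open>F \<subseteq> K\<close> _ _ _ \<open>F \<subseteq> K\<close> _ _ F(1), where g = "\<lambda>x. 0"])
      show "compact F" by (rule face_of_imp_compact[OF \<T>_props(2,1)[OF F(3)] face])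
      show "convex F" by (rule face_of_imp_convex[OF face])
      show "affine_function_on K (hat \<T> x)" using h F(3) by blast
      show "affine_function_on K (\<lambda>x. 0)"
        unfolding affine_function_on_def by (intro exI[of _ 0]) simp
      fix z assume z: "z extreme_point_of F"
      then have "z extreme_point_of K" using extreme_point_of_face[OF face] by blast
      then have "z \<in> vertices \<T>" using F(3) by (auto simp: vertices_def)
      moreover have "z \<in> frontier \<Omega>" using z F(2) by (auto simp: extreme_point_of_def)
      then have "z \<noteq> x" using x \<Omega>(1) by (auto simp: frontier_def interior_open)
      ultimately show "hat \<T> x z = 0" using h by simp
    qed
  qed (use h in blast)
  then show ?thesis using h by (simp add: fe_function_def Union_\<T>)
qed

lemma fe_functionD:
  assumes "fe_function f"
  shows "continuous_on (closure \<Omega>) f" "x \<notin> \<Omega> \<Longrightarrow> f x = 0"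
    "K \<in> \<T> \<Longrightarrow> \<exists>b c. \<forall>x\<in>K. f x = b \<bullet> x + c"
  using assms by (simp_all add: fe_function_def affine_function_on_def)

lemma fe_function_add:
  assumes f: "fe_function f" and g: "fe_function g"
  shows "fe_function (\<lambda>x. f x + g x)"
  unfolding fe_function_def affine_function_on_def
proof (intro conjI ballI allI impI)
  fix K assume K: "K \<in> \<T>"
  obtain b c where 1: "\<forall>x\<in>K. f x = b \<bullet> x + c" using fe_functionD(3)[OF f K] by blast
  obtain b' c' where 2: "\<forall>x\<in>K. g x = b' \<bullet> x + c'" using fe_functionD(3)[OF g K] by blast
  show "\<exists>b c. \<forall>x\<in>K. f x + g x = b \<bullet> x + c"
    by (intro exI[of _ "b + b'"] exI[of _ "c + c'"]) (simp add: 1 2 inner_add_left)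
next
  show "continuous_on (closure \<Omega>) (\<lambda>x. f x + g x)"
    by (intro continuous_on_add fe_functionD(1) f g)
  show "x \<notin> \<Omega> \<Longrightarrow> f x + g x = 0" for x
    using fe_functionD(2)[OF f] fe_functionD(2)[OF g] by simp
qed

lemma fe_function_cmult:
  assumes f: "fe_function f"
  shows "fe_function (\<lambda>x. r * f x)"
  unfolding fe_function_def affine_function_on_def
proof (intro conjI ballI allI impI)
  fix K assume K: "K \<in> \<T>"
  obtain b c where 1: "\<forall>x\<in>K. f x = b \<bullet> x + c" using fe_functionD(3)[OF f K] by blast
  show "\<exists>b c. \<forall>x\<in>K. r * f x = b \<bullet> x + c"
    by (intro exI[of _ "r *\<^sub>R b"] exI[of _ "r * c"]) (simp add: 1 distrib_left)
next
  show "continuous_on (closure \<Omega>) (\<lambda>x. r * f x)"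
    by (intro continuous_on_mult_left fe_functionD(1) f)
  show "x \<notin> \<Omega> \<Longrightarrow> r * f x = 0" for x
    using fe_functionD(2)[OF f] by simp
qed

lemma fe_function_zero: "fe_function (\<lambda>x. 0)"
  unfolding fe_function_def affine_function_on_def by (auto intro!: exI[of _ 0])

lemma fe_function_sum: "(\<And>i. i \<in> I \<Longrightarrow> fe_function (f i)) \<Longrightarrow> fe_function (\<lambda>x. \<Sum>i\<in>I. f i x)"
  by (induction I rule: infinite_finite_induct) (auto simp: fe_function_zero fe_function_add)

lemma fe_function_interpolates: "fe_function f \<Longrightarrow> interpolates f f"
  using closure_subset[of \<Omega>] by (auto simp: fe_function_def interpolates_def Union_\<T>)

text \<open>Both sides interpolate the same nodal values; vertices off \<Omega> contribute nothing
  because \<open>f\<close> vanishes there.\<close>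

lemma fe_function_expansion:
  assumes f: "fe_function f"
  shows "f = (\<lambda>y. \<Sum>x\<in>vertices \<T> \<inter> \<Omega>. f x * hat \<T> x y)"
proof (rule interpolates_unique[OF fe_function_interpolates[OF f]])
  have fe: "fe_function (\<lambda>y. \<Sum>x\<in>vertices \<T> \<inter> \<Omega>. f x * hat \<T> x y)"
    by (intro fe_function_sum fe_function_cmult fe_function_hat) auto
  have "(\<Sum>x\<in>vertices \<T> \<inter> \<Omega>. f x * hat \<T> x y) = f y" if y: "y \<in> vertices \<T>" for y
  proof -
    have "(\<Sum>x\<in>vertices \<T> \<inter> \<Omega>. f x * hat \<T> x y) = (\<Sum>x\<in>vertices \<T> \<inter> \<Omega>. if y = x then f x else 0)"
      by (rule sum.cong) (use y interpolates_hat in \<open>auto simp: interpolates_def\<close>)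
    also have "\<dots> = f y"
      using y f finite_vertices by (auto simp: fe_function_def)
    finally show ?thesis .
  qed
  then show "interpolates f (\<lambda>y. \<Sum>x\<in>vertices \<T> \<inter> \<Omega>. f x * hat \<T> x y)"
    using fe_function_interpolates[OF fe] by (simp add: interpolates_def)
qed

lemma fe_function_piecewise_affine:
  assumes f: "fe_function f"
  shows "piecewise_affine f"
proof -
  have zero: "f x = 0" if "x \<notin> \<Omega>" for x using f that by (simp add: fe_function_def)
  have "\<exists>b c. \<forall>x\<in>K. f x = b \<bullet> x + c" if "K \<in> \<T>" for K
    using f that by (auto simp: fe_function_def affine_function_on_def)
  then obtain b c where bc: "\<And>K x. K \<in> \<T> \<Longrightarrow> x \<in> K \<Longrightarrow> f x = b K \<bullet> x + c K" by metis
  \<comment> \<open>The sum is a common bound for the finitely many element gradients.\<close>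
  define L where "L = (\<Sum>K\<in>\<T>. norm (b K))"
  have L: "0 \<le> L" unfolding L_def by (intro sum_nonneg) auto
  \<comment> \<open>The segment from \<open>x\<close> to \<open>y\<close> may leave \<Omega>; the
    complement, on which \<open>f\<close> is zero, is therefore one of the pieces.\<close>
  have "\<bar>f x - f y\<bar> \<le> L * norm (x - y)" for x y
  proof (rule lipschitz_piecewise[where \<S> = "insert (- \<Omega>) \<T>"])
    show "closed S" if "S \<in> insert (- \<Omega>) \<T>" for S using that \<Omega>(1) \<T>_props(3) by auto
    show "\<Union>(insert (- \<Omega>) \<T>) = UNIV" using Union_\<T> closure_subset[of \<Omega>] by auto
    fix S x y assume S: "S \<in> insert (- \<Omega>) \<T>" "x \<in> S" "y \<in> S"
    show "\<bar>f x - f y\<bar> \<le> L * norm (x - y)"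
    proof (cases "S \<in> \<T>")
      case True
      have "norm (b S) \<le> L" unfolding L_def by (rule member_le_sum[OF True]) (auto simp: finite_\<T>)
      have "f x - f y = b S \<bullet> (x - y)" using bc[OF True S(2)] bc[OF True S(3)] by (simp add: inner_diff_right)
      then have "\<bar>f x - f y\<bar> \<le> norm (b S) * norm (x - y)" by (simp add: Cauchy_Schwarz_ineq2)
      also have "\<dots> \<le> L * norm (x - y)" using \<open>norm (b S) \<le> L\<close> by (rule mult_right_mono) simp
      finally show ?thesis .
    next
      case False
      then show ?thesis using S L zero by auto
    qed
  qed (use finite_\<T> L in auto)
  moreover have "bounded {x. f x \<noteq> 0}"
    by (rule bounded_subset[OF \<Omega>(2)]) (use zero in blast)
  moreover have "AE x in lebesgue. \<exists>b. locally_affine f x b"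
  proof -
    \<comment> \<open>Off the element frontiers, a point is interior to an element or lies outside
      the closure of \<Omega>.\<close>
    have "negligible (\<Union>K\<in>\<T>. frontier K)"
      by (rule negligible_Union) (use finite_\<T> \<T>_props(2) negligible_convex_frontier in auto)
    then have "AE x in lebesgue. x \<notin> (\<Union>K\<in>\<T>. frontier K)"
      by (intro AE_not_in) (simp add: negligible_iff_null_sets)
    then show ?thesis
    proof eventually_elim
      case (elim x)
      show ?case
      proof (cases "x \<in> closure \<Omega>")
        case True
        then obtain K where K: "K \<in> \<T>" "x \<in> K" using Union_\<T> by blast
        then have "x \<in> interior K" using elim \<T>_props(3)[OF K(1)] by (auto simp: frontier_def)
        then obtain e where e: "0 < e" "ball x e \<subseteq> K" using mem_interior by blast
        have "f y = f x + b K \<bullet> (y - x)" if "y \<in> ball x e" for y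
        proof -
          have "y \<in> K" using that e(2) by blast
          then show ?thesis unfolding bc[OF K(1) \<open>y \<in> K\<close>] bc[OF K] by (simp add: inner_diff_right)
        qed
        then show ?thesis unfolding locally_affine_def using e(1) by blast
      next
        case False
        then obtain e where e: "0 < e" "ball x e \<subseteq> - closure \<Omega>"
          using openE[of "- closure \<Omega>" x] by auto
        have "f y = 0" if "y \<in> ball x e" for y
          using that e(2) closure_subset[of \<Omega>] by (intro zero) blast
        then have "\<forall>y\<in>ball x e. f y = f x + 0 \<bullet> (y - x)" using e(1) by simp
        then show ?thesis unfolding locally_affine_def using e(1) by blast
      qed
    qed
  qed
  ultimately show ?thesis unfolding piecewise_affine_def using L by blast
qed

lemma fe_function_square_integrable: "fe_function f \<Longrightarrow> square_integrable f"
  using lipschitz_gradient_square_integrable(1) piecewise_affine_lipschitz_gradient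
    fe_function_piecewise_affine by blast

lemma fe_space_subset_H01: "fe_space \<T> \<Omega> \<subseteq> H01 \<Omega>"
proof -
  have "L2_class f \<in> H01 \<Omega>" if f: "fe_function f" for f
    by (rule piecewise_affine_H01[OF fe_function_piecewise_affine[OF f] \<Omega>(1)])
      (use f in \<open>simp add: fe_function_def\<close>)
  then show ?thesis by (auto simp: fe_space_eq)
qed

lemma L2_class_sum_cmult:
  "finite I \<Longrightarrow> (\<And>i. i \<in> I \<Longrightarrow> fe_function (f i)) \<Longrightarrow>
    L2_class (\<lambda>x. \<Sum>i\<in>I. r i * f i x) = (\<Sum>i\<in>I. r i *\<^sub>R L2_class (f i))"
proof (induction I rule: finite_induct)
  case (insert i I)
  have "square_integrable (\<lambda>x. r i * f i x)" "square_integrable (\<lambda>x. \<Sum>i\<in>I. r i * f i x)"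
    using insert.prems by (auto intro!: fe_function_square_integrable fe_function_cmult fe_function_sum)
  then have "L2_class (\<lambda>x. r i * f i x + (\<Sum>i\<in>I. r i * f i x)) =
      L2_class (\<lambda>x. r i * f i x) + L2_class (\<lambda>x. \<Sum>i\<in>I. r i * f i x)"
    by (rule L2_class_add)
  moreover have "L2_class (\<lambda>x. r i * f i x) = r i *\<^sub>R L2_class (f i)"
    using L2_class_scaleR[OF fe_function_square_integrable, of "f i" "r i"] insert.prems by simp
  ultimately show ?case using insert by simp
qed (simp add: L2_class_zero)

lemma fe_space_expansion:
  assumes "s \<in> fe_space \<T> \<Omega>"
  obtains r where "s = (\<Sum>x\<in>vertices \<T> \<inter> \<Omega>. r x *\<^sub>R L2_class (hat \<T> x))"
proof -
  obtain f where f: "fe_function f" "s = L2_class f" using assms by (auto simp: fe_space_eq)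
  have "L2_class f = L2_class (\<lambda>y. \<Sum>x\<in>vertices \<T> \<inter> \<Omega>. f x * hat \<T> x y)"
    using fe_function_expansion[OF f(1)] by simp
  also have "\<dots> = (\<Sum>x\<in>vertices \<T> \<inter> \<Omega>. f x *\<^sub>R L2_class (hat \<T> x))"
    by (rule L2_class_sum_cmult) (use finite_vertices fe_function_hat in auto)
  finally show ?thesis using f(2) that by blast
qed

end

section \<open>The error estimate\<close>

theorem theorem3p3:
  fixes \<Omega> :: "(real^'n::finite) set"
    and A :: "real^'n \<Rightarrow> real^'n^'n" and \<delta> M :: real
    and \<T> :: "(real^'n) set set" and \<sigma> c1 c2 K1 K2 :: real and m l :: nat
    and Proj C :: "(real^'n, real) L2 \<Rightarrow> (real^'n, real) L2"
    and P :: "real^'n \<Rightarrow> (real^'n, real) L2 \<Rightarrow> (real^'n, real) L2"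
    and f :: "(real^'n, real) L2 \<Rightarrow> real"
    and u w w\<^sub>l :: "(real^'n, real) L2"
  defines "H \<equiv> H01 \<Omega>"
    and "a \<equiv> bilinear_form \<Omega> A"
    and "nrm \<equiv> energy_norm (bilinear_form \<Omega> A)"
    and "S \<equiv> fe_space \<T> \<Omega>"
    and "V \<equiv> kernel_space (H01 \<Omega>) Proj"
    and "Vloc \<equiv> local_space \<T> \<Omega> Proj"
    and "T \<equiv> (\<lambda>v. \<Sum>x\<in>vertices \<T>. P x v)"
  defines "\<kappa> \<equiv> condition_number V nrm T"
  defines "q \<equiv> (sqrt \<kappa> - 1) / (sqrt \<kappa> + 1)"
  assumes dim: "CARD('n) = 2 \<or> CARD('n) = 3"
    and domain: "polyhedral_domain \<Omega>"
    and coefficient: "admissible_coefficient \<Omega> A \<delta> M"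
    and triangulation: "triangulates \<T> \<Omega>"
    and shape_regular: "shape_regular \<sigma> \<T>"
    and Proj_bounded_linear: "bounded_linear_on H H1_norm H1_norm Proj"
    and Proj_projection: "\<forall>v\<in>H. Proj v \<in> S" "\<forall>v\<in>S. Proj v = v"
    and Proj_stable: "\<forall>v\<in>H. H1_seminorm (Proj v) \<le> c1 * H1_seminorm v"
    and Proj_approx: "\<forall>v\<in>H. mesh_norm \<T> \<Omega> (v - Proj v) \<le> c2 * H1_seminorm v"
    and Proj_local: "local_operator \<T> \<Omega> m Proj"
    and C: "orthogonal_projection a H V C"
    and P: "\<forall>x\<in>vertices \<T>. orthogonal_projection a H (Vloc x) (P x)"
    and K1: "0 < K1" "stable_decomposition nrm V (vertices \<T>) Vloc K1"
    and K2: "0 < K2" "bounded_superposition nrm V (vertices \<T>) Vloc K2"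
    and f: "bounded_linear_on H H1_norm abs f"
    and u: "u \<in> H" "\<forall>v\<in>H. a u v = f v"
    and w: "best_approximation nrm (W_space C S) u w"
    and wl: "best_approximation nrm (W_level \<T> \<Omega> T l) u w\<^sub>l"
  shows "nrm (u - w\<^sub>l)
    \<le> (1 + 2 * q ^ l / (1 + q ^ (2 * l))) * nrm (u - w)
      + 2 * q ^ l / (1 + q ^ (2 * l)) * nrm (u - Proj u)"
proof -
  have \<Omega>: "open \<Omega>" "bounded \<Omega>" using domain by (auto simp: polyhedral_domain_def)
  interpret E: elliptic_coefficient \<Omega> A \<delta> M by unfold_locales (rule coefficient \<Omega>)+
  interpret mesh: fe_mesh \<T> \<Omega> by unfold_locales (rule triangulation \<Omega>)+
  interpret hilbert: hilbert_on "H01 \<Omega>" "bilinear_form \<Omega> A" by (rule E.hilbert_on_H01[OF \<Omega>(2)])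
  have S_H: "S \<subseteq> H" unfolding S_def H_def by (rule mesh.fe_space_subset_H01)
  have Proj_linear: "u \<in> H \<Longrightarrow> v \<in> H \<Longrightarrow> Proj (u + v) = Proj u + Proj v" "u \<in> H \<Longrightarrow> Proj (r *\<^sub>R u) = r *\<^sub>R Proj u" for u v r
    using Proj_bounded_linear by (auto simp: bounded_linear_on_def)
  have sub_H: "subspace H" unfolding H_def by (rule subspace_H01)
  have patch_H: "patch_H01 \<T> \<Omega> x \<subseteq> H" for x
    unfolding patch_H01_def H_def by (rule H01_mono) simp
  have Vloc_subspace: "subspace (Vloc x)" for x
  proof -
    have sub: "subspace (patch_H01 \<T> \<Omega> x)" unfolding patch_H01_def by (rule subspace_H01)
    have 0: "Proj 0 = 0" using Proj_linear(2)[OF subspace_0[OF sub_H], of 0] by simp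
    show ?thesis
      unfolding Vloc_def local_space_def
    proof (rule subspaceI)
      show "0 \<in> (\<lambda>v. v - Proj v) ` patch_H01 \<T> \<Omega> x"
        using subspace_0[OF sub] 0 by (intro image_eqI[of _ _ 0]) simp_all
    next
      fix y z assume "y \<in> (\<lambda>v. v - Proj v) ` patch_H01 \<T> \<Omega> x" "z \<in> (\<lambda>v. v - Proj v) ` patch_H01 \<T> \<Omega> x"
      then obtain v v' where v: "v \<in> patch_H01 \<T> \<Omega> x" "v' \<in> patch_H01 \<T> \<Omega> x" "y = v - Proj v" "z = v' - Proj v'"
        by blast
      then have "v \<in> H" "v' \<in> H" using patch_H by auto
      then have "y + z = (v + v') - Proj (v + v')" by (simp add: v Proj_linear)
      then show "y + z \<in> (\<lambda>v. v - Proj v) ` patch_H01 \<T> \<Omega> x"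
        using subspace_add[OF sub v(1,2)] by blast
    next
      fix r y assume "y \<in> (\<lambda>v. v - Proj v) ` patch_H01 \<T> \<Omega> x"
      then obtain v where v: "v \<in> patch_H01 \<T> \<Omega> x" "y = v - Proj v" by blast
      then have "v \<in> H" using patch_H by auto
      then have "r *\<^sub>R y = r *\<^sub>R v - Proj (r *\<^sub>R v)" by (simp add: v Proj_linear scaleR_diff_right)
      then show "r *\<^sub>R y \<in> (\<lambda>v. v - Proj v) ` patch_H01 \<T> \<Omega> x"
        using subspace_scale[OF sub v(1)] by blast
    qed
  qed
  have Vloc_V: "Vloc x \<subseteq> V" for x
  proof
    fix y assume "y \<in> Vloc x"
    then obtain v where v: "v \<in> H" "y = v - Proj v" using patch_H by (auto simp: Vloc_def local_space_def)
    have Pv: "Proj v \<in> S" "Proj v \<in> H" using Proj_projection(1) v(1) S_H by auto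
    have "Proj (v + (- 1) *\<^sub>R Proj v) = Proj v + Proj ((- 1) *\<^sub>R Proj v)"
      by (rule Proj_linear(1)[OF v(1) subspace_scale[OF sub_H Pv(2)]])
    also have "Proj ((- 1) *\<^sub>R Proj v) = (- 1) *\<^sub>R Proj (Proj v)" by (rule Proj_linear(2)[OF Pv(2)])
    finally have "Proj y = 0" using Proj_projection(2) Pv(1) by (simp add: v(2))
    moreover have "y \<in> H" using v(1) Pv(2) by (simp add: v(2) subspace_diff[OF sub_H])
    ultimately show "y \<in> V" by (simp add: V_def kernel_space_def H_def)
  qed
  \<comment> \<open>Stability in the seminorm turns into boundedness in the energy norm; the
    absolute value covers a negative \<open>c1\<close>.\<close>
  have Proj_bounded: "nrm (Proj v) \<le> sqrt M * \<bar>c1\<bar> / sqrt \<delta> * nrm v" if v: "v \<in> H" for v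
  proof -
    have Pv: "Proj v \<in> H" using Proj_projection(1) v S_H by blast
    have \<delta>M: "0 < \<delta>" "0 < M" using E.bounds(1,2) by auto
    have "norm (grad (Proj v)) \<le> c1 * norm (grad v)"
      using Proj_stable v by (simp add: H1_seminorm_def)
    also have "\<dots> \<le> \<bar>c1\<bar> * norm (grad v)" by (intro mult_right_mono) auto
    finally have "sqrt M * norm (grad (Proj v)) \<le> sqrt M * (\<bar>c1\<bar> * norm (grad v))"
      using \<delta>M by (intro mult_left_mono) auto
    moreover have "nrm (Proj v) \<le> sqrt M * norm (grad (Proj v))"
      using E.energy_norm_bounds(2) Pv by (simp add: nrm_def H_def)
    moreover have "norm (grad v) \<le> nrm v / sqrt \<delta>"
      using E.energy_norm_bounds(1) v \<delta>M by (simp add: nrm_def H_def field_simps)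
    then have "sqrt M * (\<bar>c1\<bar> * norm (grad v)) \<le> sqrt M * (\<bar>c1\<bar> * (nrm v / sqrt \<delta>))"
      using \<delta>M by (intro mult_left_mono) auto
    ultimately show ?thesis by simp
  qed
  interpret D: projected_decomposition "H01 \<Omega>" "bilinear_form \<Omega> A" S Proj C "vertices \<T>" Vloc P K1 K2
  proof unfold_locales
    show "\<exists>B. \<forall>u\<in>H01 \<Omega>. energy_norm (bilinear_form \<Omega> A) (Proj u) \<le> B * energy_norm (bilinear_form \<Omega> A) u"
      using Proj_bounded unfolding H_def nrm_def by blast
  qed (use S_H Proj_linear Proj_projection C Vloc_subspace Vloc_V P K1 K2
      in \<open>simp_all add: H_def a_def nrm_def V_def\<close>)
  have kern: "D.kern = V" by (simp add: D.kern_def V_def)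
  have T: "D.T = T" by (simp add: fun_eq_iff D.T_def T_def)
  have "s - correction T \<nu> s \<in> W_level \<T> \<Omega> T l" if s: "s \<in> S" and \<nu>: "\<nu> \<le> l" for s \<nu>
  proof -
    \<comment> \<open>By linearity of \<open>correction\<close> the vectors with the desired
      property form a subspace; it contains the interior hat functions, which span
      \<open>S\<close>.\<close>
    define X where "X = {v \<in> H. v - correction T \<nu> v \<in> W_level \<T> \<Omega> T l}"
    have span: "subspace (W_level \<T> \<Omega> T l)" unfolding W_level_def by (rule subspace_span)
    have lin: "correction T \<nu> (u + v) = correction T \<nu> u + correction T \<nu> v" "correction T \<nu> (r *\<^sub>R u) = r *\<^sub>R correction T \<nu> u"
      if "u \<in> H" "v \<in> H" for u v r
      using D.correction_linear that unfolding T H_def by auto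
    have "subspace X"
    proof (rule subspaceI)
      have "correction T \<nu> 0 = 0"
        using lin(2)[OF subspace_0[OF sub_H] subspace_0[OF sub_H], of 0] by simp
      then show "0 \<in> X" using subspace_0[OF sub_H] subspace_0[OF span] by (simp add: X_def)
    next
      fix u v assume uv: "u \<in> X" "v \<in> X"
      then have "(u - correction T \<nu> u) + (v - correction T \<nu> v) \<in> W_level \<T> \<Omega> T l"
        by (intro subspace_add[OF span]) (auto simp: X_def)
      then show "u + v \<in> X"
        using uv by (simp add: X_def subspace_add[OF sub_H] lin algebra_simps)
    next
      fix r u assume u: "u \<in> X"
      then have "r *\<^sub>R (u - correction T \<nu> u) \<in> W_level \<T> \<Omega> T l"
        by (intro subspace_scale[OF span]) (auto simp: X_def)
      then show "r *\<^sub>R u \<in> X"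
        using u lin(2)[of u u r] by (simp add: X_def subspace_scale[OF sub_H] scaleR_diff_right)
    qed
    moreover have hat: "L2_class (hat \<T> x) \<in> X" if x: "x \<in> vertices \<T> \<inter> \<Omega>" for x
    proof -
      have "L2_class (hat \<T> x) \<in> S"
        using mesh.fe_function_hat x unfolding S_def mesh.fe_space_eq by blast
      moreover have "L2_class (hat \<T> x) - correction T \<nu> (L2_class (hat \<T> x)) \<in> W_level \<T> \<Omega> T l"
        unfolding W_level_def by (rule span_base) (use x \<nu> in blast)
      ultimately show ?thesis using S_H by (auto simp: X_def)
    qed
    moreover obtain r where "s = (\<Sum>x\<in>vertices \<T> \<inter> \<Omega>. r x *\<^sub>R L2_class (hat \<T> x))"
      using mesh.fe_space_expansion s unfolding S_def by metis
    ultimately have "s \<in> X" by (auto intro!: subspace_sum subspace_scale)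
    then show ?thesis by (simp add: X_def)
  qed
  moreover have "subspace (W_level \<T> \<Omega> T l)" unfolding W_level_def by (rule subspace_span)
  ultimately show ?thesis
    using D.error_estimate[of u w "W_level \<T> \<Omega> T l" l w\<^sub>l] u(1) w wl
    unfolding kern T \<kappa>_def q_def nrm_def H_def by blast
qed

end
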